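(* Let $T$ be a completely non unitary contraction on a separable complex Hilbert space with characteristic function a polynomial of degree $n$. Among the nilpotent operators $N$ occurring as central diagonal entries in the representations $$T=\begin{bmatrix}S&*&*\\0&N&*\\0&0&C\end{bmatrix}\qquad(S,\ C^*\text{ unilateral shifts},\ N\text{ nilpotent of order }n)$$ of $T$, the family of all ultra-minimal ones is an equivalence class for quasi-similarity, and it contains $N_0$ and $N_{*0}$. Moreover, this quasi-similarity class is a unitary invariant of $T$ (if $T'$ is unitarily equivalent to $T$, then the ultra-minimal nilpotent operators of $T'$ are quasi-similar to those of $T$).
   Context: A contraction $T$ is completely non unitary if there is no nonzero $T$-reducing subspace on which $T$ is unitary. Put $D_T=(I-T^*T)^{1/2}$, $D_{T^*}=(I-TT^* )^{1/2}$, $\mathcal{D}_T=\overline{\mathrm{Ran}\,D_T}$, $\mathcal{D}_{T^*}=\overline{\mathrm{Ran}\,D_{T^*}}$. The characteristic function of $T$ is $\Theta_T(z)=[-T+zD_{T^*}(I-zT^* )^{-1}D_T]|_{\mathcal{D}_T}\in\mathcal{L}(\mathcal{D}_T,\mathcal{D}_{T^*})$, $z\in\mathbb{D}$ (constants, including $0$, have degree $0$). The order of a nilpotent $N$ is the smallest integer $p\ge0$ with $N^p=0$ ($N^0=I$). Representations are with respect to orthogonal decompositions of the space into three closed subspaces (possibly $\{0\}$); shifts may have any multiplicity, including $0$. $P_{\mathcal{K}}$ is the orthogonal projection onto $\mathcal{K}$. $T_1\in\mathcal{L}(\mathcal{K}_1)$ is injected in $T_2\in\mathcal{L}(\mathcal{K}_2)$,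 written $T_1\prec^iT_2$, if there is an injective bounded $X:\mathcal{K}_1\to\mathcal{K}_2$ with $XT_1=T_2X$. They are quasi-similar if there are bounded injective operators with dense range $X:\mathcal{K}_1\to\mathcal{K}_2$, $Y:\mathcal{K}_2\to\mathcal{K}_1$ with $XT_1=T_2X$, $YT_2=T_1Y$. The central nilpotent $N_{um}$ of a representation $T=\begin{bmatrix}S&*&*\\0&N_{um}&*\\0&0&C\end{bmatrix}$ with $S$, $C^*$ unilateral shifts and $N_{um}$ nilpotent of order $n$ is ultra-minimal if $N_{um}\prec^iN$ for the central nilpotent $N$ of every other representation $T=\begin{bmatrix}S'&*&*\\0&N&*\\0&0&C'\end{bmatrix}$ with $S'$, $C'^*$ unilateral shifts and $N$ nilpotent of order $n$. Let $\mathcal{M}_1=\{h:\|T^{k+1}h\|=\|T^kh\|,k\ge0\}$, $\mathcal{M}_{-1}=\{h:\|T^{*(k+1)}h\|=\|T^{*k}h\|,k\ge0\}$ (maximal subspaces invariant under $T$, respectively $T^*$, on which it is isometric). Canonical decomposition: $\mathcal{H}_1=\overline{\mathrm{span}}\{T^kh:h\in\mathcal{D}_{T^*},k\ge n\}$, $\mathcal{H}_{-1}=\mathcal{M}_{-1}$, $\mathcal{H}_0=\mathcal{H}\ominus(\mathcal{H}_1\oplus\mathcal{H}_{-1})$. $*$-canonical decomposition: $\mathcal{H}_{1*}=\mathcal{M}_1$, $\mathcal{H}_{-1*}=\overline{\mathrm{span}}\{T^{*k}h:h\in\mathcal{D}_T,k\ge n\}$, $\mathcal{H}_{0*}=\mathcal{H}\ominus(\mathcal{H}_{1*}\oplus\mathcal{H}_{-1*})$.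 Put $\mathcal{H}_{00}=\mathcal{H}_0\ominus(\mathcal{M}_1\cap\mathcal{H}_0)$, $\mathcal{H}_{0*0}=\mathcal{H}_{0*}\ominus(\mathcal{H}_{0*}\cap\mathcal{M}_{-1})$, and $N_0=P_{\mathcal{H}_{00}}T|_{\mathcal{H}_{00}}$, $N_{*0}=P_{\mathcal{H}_{0*0}}T|_{\mathcal{H}_{0*0}}$; these are the central entries of upper triangular representations of $T$ whose diagonal entries are, in order, a unilateral shift, a nilpotent of order $n$ and the adjoint of a unilateral shift, on $[\mathcal{H}_1\oplus(\mathcal{M}_1\cap\mathcal{H}_0)]\oplus\mathcal{H}_{00}\oplus\mathcal{H}_{-1}$ and $\mathcal{H}_{1*}\oplus\mathcal{H}_{0*0}\oplus[\mathcal{H}_{-1*}\oplus(\mathcal{H}_{0*}\cap\mathcal{M}_{-1})]$, respectively. *)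

theory Defs
  imports "HOL-Analysis.Analysis"
begin

section \<open>Complex Hilbert spaces\<close>

text \<open>The distribution has only real inner product spaces, so a complex Hilbert space is a complete
  real one with a compatible complex structure.  The inner product is linear in its first argument;
  the last axiom makes the norm and the topology those of \<open>cinner\<close>.\<close>

class complex_hilbert = real_inner + complete_space +
  fixes scaleC :: "complex \<Rightarrow> 'a \<Rightarrow> 'a"  (infixr \<open>*\<^sub>C\<close> 75)
    and cinner :: "'a \<Rightarrow> 'a \<Rightarrow> complex"
  assumes scaleC_add_right: "c *\<^sub>C (x + y) = c *\<^sub>C x + c *\<^sub>C y"
    and scaleC_add_left: "(c + d) *\<^sub>C x = c *\<^sub>C x + d *\<^sub>C x"
    and scaleC_scaleC: "c *\<^sub>C d *\<^sub>C x = (c * d) *\<^sub>C x"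
    and scaleC_of_real: "complex_of_real r *\<^sub>C x = r *\<^sub>R x"
    and cinner_commute: "cinner x y = cnj (cinner y x)"
    and cinner_add_left: "cinner (x + y) z = cinner x z + cinner y z"
    and cinner_scaleC_left: "cinner (c *\<^sub>C x) y = c * cinner x y"
    and Re_cinner: "Re (cinner x y) = x \<bullet> y"

global_interpretation complex_vector: vector_space
  "scaleC :: complex \<Rightarrow> 'a \<Rightarrow> 'a::complex_hilbert"
  defines csubspace_raw_def: csubspace = complex_vector.subspace
    and cspan_raw_def: cspan = complex_vector.span
proof
  fix c d :: complex and x y :: 'a
  show "c *\<^sub>C (x + y) = c *\<^sub>C x + c *\<^sub>C y" by (rule scaleC_add_right)
  show "(c + d) *\<^sub>C x = c *\<^sub>C x + d *\<^sub>C x" by (rule scaleC_add_left)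
  show "c *\<^sub>C d *\<^sub>C x = (c * d) *\<^sub>C x" by (rule scaleC_scaleC)
  show "1 *\<^sub>C x = x" using scaleC_of_real[of 1 x] by simp
qed

definition closed_csubspace :: "'a::complex_hilbert set \<Rightarrow> bool"
  where "closed_csubspace K \<longleftrightarrow> csubspace K \<and> closed K"

definition closed_cspan :: "'a::complex_hilbert set \<Rightarrow> 'a set"
  where "closed_cspan A = closure (cspan A)"

definition orth_minus :: "'a::complex_hilbert set \<Rightarrow> 'a set \<Rightarrow> 'a set"  (infixl \<open>\<ominus>\<close> 65)
  where "K \<ominus> L = {x \<in> K. \<forall>y\<in>L. cinner x y = 0}"

definition sum_space :: "'a::complex_hilbert set \<Rightarrow> 'a set \<Rightarrow> 'a set"  (infixl \<open>\<oplus>\<close> 65)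
  where "K \<oplus> L = {x + y |x y. x \<in> K \<and> y \<in> L}"

definition cproj :: "'a::complex_hilbert set \<Rightarrow> 'a \<Rightarrow> 'a"
  where "cproj K x = (THE y. y \<in> K \<and> (\<forall>z\<in>K. cinner (x - y) z = 0))"


section \<open>Operators between closed subspaces\<close>

text \<open>An operator on a closed subspace \<open>K\<close> is a function of which only the values on \<open>K\<close> matter.
  Where operators have to be compared for equality, they are made extensional by \<^const>\<open>restrict\<close>.\<close>

definition bounded_clinear_on ::
    "'a::complex_hilbert set \<Rightarrow> 'b::complex_hilbert set \<Rightarrow> ('a \<Rightarrow> 'b) \<Rightarrow> bool"
  where "bounded_clinear_on K L A \<longleftrightarrow>
    (\<forall>x\<in>K. A x \<in> L) \<and>
    (\<forall>x\<in>K. \<forall>y\<in>K. A (x + y) = A x + A y) \<and>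
    (\<forall>c. \<forall>x\<in>K. A (c *\<^sub>C x) = c *\<^sub>C A x) \<and>
    (\<exists>B. \<forall>x\<in>K. norm (A x) \<le> B * norm x)"

definition adjoint_on :: "'a::complex_hilbert set \<Rightarrow> ('a \<Rightarrow> 'a) \<Rightarrow> 'a \<Rightarrow> 'a"
  where "adjoint_on K A = (\<lambda>y\<in>K. THE z. z \<in> K \<and> (\<forall>x\<in>K. cinner (A x) y = cinner x z))"

abbreviation cadjoint :: "('a::complex_hilbert \<Rightarrow> 'a) \<Rightarrow> 'a \<Rightarrow> 'a"
  where "cadjoint \<equiv> adjoint_on UNIV"

definition positive_op :: "('a::complex_hilbert \<Rightarrow> 'a) \<Rightarrow> bool"
  where "positive_op A \<longleftrightarrow> (\<forall>x. Im (cinner (A x) x) = 0 \<and> Re (cinner (A x) x) \<ge> 0)"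

definition op_sqrt :: "('a::complex_hilbert \<Rightarrow> 'a) \<Rightarrow> 'a \<Rightarrow> 'a"
  where "op_sqrt A = (THE R. bounded_clinear_on UNIV UNIV R \<and> positive_op R \<and> R \<circ> R = A)"

definition nilpotent_order :: "'a::complex_hilbert set \<Rightarrow> ('a \<Rightarrow> 'a) \<Rightarrow> nat \<Rightarrow> bool"
  where "nilpotent_order K N p \<longleftrightarrow>
    (\<forall>x\<in>K. (N ^^ p) x = 0) \<and> (\<forall>q<p. \<not> (\<forall>x\<in>K. (N ^^ q) x = 0))"

text \<open>An isometry on \<open>K\<close> with a generating wandering subspace \<open>E\<close>; the multiplicity is the
  dimension of \<open>E\<close>, and \<open>E = {0}\<close> gives the shift on \<open>{0}\<close>.\<close>

definition unilateral_shift :: "'a::complex_hilbert set \<Rightarrow> ('a \<Rightarrow> 'a) \<Rightarrow> bool"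
  where "unilateral_shift K S \<longleftrightarrow>
    bounded_clinear_on K K S \<and> (\<forall>x\<in>K. norm (S x) = norm x) \<and>
    (\<exists>E. closed_csubspace E \<and> E \<subseteq> K \<and>
      (\<forall>j k. j \<noteq> k \<longrightarrow> (\<forall>x\<in>E. \<forall>y\<in>E. cinner ((S ^^ j) x) ((S ^^ k) y) = 0)) \<and>
      closed_cspan (\<Union>k. (S ^^ k) ` E) = K)"

definition injected :: "'a::complex_hilbert set \<Rightarrow> ('a \<Rightarrow> 'a) \<Rightarrow>
    'b::complex_hilbert set \<Rightarrow> ('b \<Rightarrow> 'b) \<Rightarrow> bool"
  where "injected K1 T1 K2 T2 \<longleftrightarrow>
    (\<exists>X. bounded_clinear_on K1 K2 X \<and> inj_on X K1 \<and> (\<forall>x\<in>K1. X (T1 x) = T2 (X x)))"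

definition quasi_affine :: "'a::complex_hilbert set \<Rightarrow> ('a \<Rightarrow> 'a) \<Rightarrow>
    'b::complex_hilbert set \<Rightarrow> ('b \<Rightarrow> 'b) \<Rightarrow> bool"
  where "quasi_affine K1 T1 K2 T2 \<longleftrightarrow>
    (\<exists>X. bounded_clinear_on K1 K2 X \<and> inj_on X K1 \<and> K2 \<subseteq> closure (X ` K1) \<and>
      (\<forall>x\<in>K1. X (T1 x) = T2 (X x)))"

definition quasi_similar :: "'a::complex_hilbert set \<Rightarrow> ('a \<Rightarrow> 'a) \<Rightarrow>
    'b::complex_hilbert set \<Rightarrow> ('b \<Rightarrow> 'b) \<Rightarrow> bool"
  where "quasi_similar K1 T1 K2 T2 \<longleftrightarrow> quasi_affine K1 T1 K2 T2 \<and> quasi_affine K2 T2 K1 T1"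

definition unitarily_equivalent ::
    "('a::complex_hilbert \<Rightarrow> 'a) \<Rightarrow> ('b::complex_hilbert \<Rightarrow> 'b) \<Rightarrow> bool"
  where "unitarily_equivalent T T' \<longleftrightarrow>
    (\<exists>U. bounded_clinear_on UNIV UNIV U \<and> surj U \<and>
      (\<forall>x y. cinner (U x) (U y) = cinner x y) \<and> (\<forall>x. U (T x) = T' (U x)))"


section \<open>Contractions and characteristic functions\<close>

definition contraction :: "('a::complex_hilbert \<Rightarrow> 'a) \<Rightarrow> bool"
  where "contraction T \<longleftrightarrow> bounded_clinear_on UNIV UNIV T \<and> (\<forall>x. norm (T x) \<le> norm x)"

definition completely_non_unitary :: "('a::complex_hilbert \<Rightarrow> 'a) \<Rightarrow> bool"
  where "completely_non_unitary T \<longleftrightarrow>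
    \<not> (\<exists>M. closed_csubspace M \<and> M \<noteq> {0} \<and> T ` M \<subseteq> M \<and> cadjoint T ` M \<subseteq> M \<and>
        (\<forall>x\<in>M. norm (T x) = norm x) \<and> T ` M = M)"

definition defect_op :: "('a::complex_hilbert \<Rightarrow> 'a) \<Rightarrow> 'a \<Rightarrow> 'a"
  where "defect_op T = op_sqrt (\<lambda>x. x - cadjoint T (T x))"

definition defect_op_star :: "('a::complex_hilbert \<Rightarrow> 'a) \<Rightarrow> 'a \<Rightarrow> 'a"
  where "defect_op_star T = op_sqrt (\<lambda>x. x - T (cadjoint T x))"

definition defect_space :: "('a::complex_hilbert \<Rightarrow> 'a) \<Rightarrow> 'a set"
  where "defect_space T = closure (range (defect_op T))"

definition defect_space_star :: "('a::complex_hilbert \<Rightarrow> 'a) \<Rightarrow> 'a set"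
  where "defect_space_star T = closure (range (defect_op_star T))"

definition char_fun :: "('a::complex_hilbert \<Rightarrow> 'a) \<Rightarrow> complex \<Rightarrow> 'a \<Rightarrow> 'a"
  where "char_fun T z = (\<lambda>h \<in> defect_space T.
    - T h + z *\<^sub>C defect_op_star T (inv (\<lambda>x. x - z *\<^sub>C cadjoint T x) (defect_op T h)))"

text \<open>The leading coefficient is nonzero, except that all constants, including \<open>0\<close>, have
  degree \<open>0\<close>.\<close>

definition op_polynomial_of_degree :: "'a::complex_hilbert set \<Rightarrow> 'b::complex_hilbert set \<Rightarrow>
    (complex \<Rightarrow> 'a \<Rightarrow> 'b) \<Rightarrow> nat \<Rightarrow> bool"
  where "op_polynomial_of_degree K L \<Theta> n \<longleftrightarrow>
    (\<exists>A :: nat \<Rightarrow> 'a \<Rightarrow> 'b. (\<forall>k\<le>n. bounded_clinear_on K L (A k)) \<and>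
      (\<forall>z\<in>ball 0 1. \<forall>x\<in>K. \<Theta> z x = (\<Sum>k\<le>n. z ^ k *\<^sub>C A k x)) \<and>
      (n = 0 \<or> (\<exists>x\<in>K. A n x \<noteq> 0)))"

definition char_fun_degree :: "('a::complex_hilbert \<Rightarrow> 'a) \<Rightarrow> nat \<Rightarrow> bool"
  where "char_fun_degree T n \<longleftrightarrow>
    op_polynomial_of_degree (defect_space T) (defect_space_star T) (char_fun T) n"


section \<open>Triangular representations and their central entries\<close>

definition block :: "'a::complex_hilbert set \<Rightarrow> 'a set \<Rightarrow> ('a \<Rightarrow> 'a) \<Rightarrow> 'a \<Rightarrow> 'a"
  where "block K L T = (\<lambda>x\<in>K. cproj L (T x))"

abbreviation compression :: "'a::complex_hilbert set \<Rightarrow> ('a \<Rightarrow> 'a) \<Rightarrow> 'a \<Rightarrow> 'a"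
  where "compression K \<equiv> block K K"

definition orth_decomposition ::
    "'a::complex_hilbert set \<Rightarrow> 'a set \<Rightarrow> 'a set \<Rightarrow> bool"
  where "orth_decomposition H1 H2 H3 \<longleftrightarrow>
    closed_csubspace H1 \<and> closed_csubspace H2 \<and> closed_csubspace H3 \<and>
    (\<forall>x\<in>H1. \<forall>y\<in>H2. cinner x y = 0) \<and>
    (\<forall>x\<in>H1. \<forall>y\<in>H3. cinner x y = 0) \<and>
    (\<forall>x\<in>H2. \<forall>y\<in>H3. cinner x y = 0) \<and>
    H1 \<oplus> H2 \<oplus> H3 = UNIV"

definition shift_nilpotent_rep :: "nat \<Rightarrow> ('a::complex_hilbert \<Rightarrow> 'a) \<Rightarrow>
    'a set \<Rightarrow> 'a set \<Rightarrow> 'a set \<Rightarrow> bool"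
  where "shift_nilpotent_rep n T H1 H2 H3 \<longleftrightarrow>
    orth_decomposition H1 H2 H3 \<and>
    (\<forall>x\<in>H1. block H1 H2 T x = 0) \<and>
    (\<forall>x\<in>H1. block H1 H3 T x = 0) \<and>
    (\<forall>x\<in>H2. block H2 H3 T x = 0) \<and>
    unilateral_shift H1 (compression H1 T) \<and>
    nilpotent_order H2 (compression H2 T) n \<and>
    unilateral_shift H3 (adjoint_on H3 (compression H3 T))"

text \<open>An operator is recorded together with the subspace on which it acts.\<close>

definition central_nilpotents ::
    "nat \<Rightarrow> ('a::complex_hilbert \<Rightarrow> 'a) \<Rightarrow> ('a set \<times> ('a \<Rightarrow> 'a)) set"
  where "central_nilpotents n T =
    {(H2, compression H2 T) |H1 H2 H3. shift_nilpotent_rep n T H1 H2 H3}"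

definition ultra_minimal_nilpotents ::
    "nat \<Rightarrow> ('a::complex_hilbert \<Rightarrow> 'a) \<Rightarrow> ('a set \<times> ('a \<Rightarrow> 'a)) set"
  where "ultra_minimal_nilpotents n T =
    {(K, N) \<in> central_nilpotents n T.
      \<forall>(K', N') \<in> central_nilpotents n T. injected K N K' N'}"

definition quasi_similarity_on ::
    "('a::complex_hilbert set \<times> ('a \<Rightarrow> 'a)) set \<Rightarrow>
      (('a set \<times> ('a \<Rightarrow> 'a)) \<times> ('a set \<times> ('a \<Rightarrow> 'a))) set"
  where "quasi_similarity_on F =
    {((K, N), (K', N')) |K N K' N'. (K, N) \<in> F \<and> (K', N') \<in> F \<and> quasi_similar K N K' N'}"

lemma quasi_affine_refl: "quasi_affine K T K T"
  unfolding quasi_affine_def bounded_clinear_on_def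
proof (intro exI[of _ "\<lambda>x. x"] conjI)
  show "\<exists>B. \<forall>x\<in>K. norm x \<le> B * norm x" by (rule exI[of _ 1]) simp
  show "K \<subseteq> closure ((\<lambda>x. x) ` K)" by (simp add: closure_subset)
qed simp_all

lemma quasi_affine_trans:
  assumes "csubspace K2" "quasi_affine K1 T1 K2 T2" "quasi_affine K2 T2 K3 T3"
  shows "quasi_affine K1 T1 K3 T3"
proof -
  from assms(2) obtain X where X: "bounded_clinear_on K1 K2 X" "inj_on X K1"
    "K2 \<subseteq> closure (X ` K1)" "\<And>x. x \<in> K1 \<Longrightarrow> X (T1 x) = T2 (X x)"
    unfolding quasi_affine_def by blast
  from assms(3) obtain Y where Y: "bounded_clinear_on K2 K3 Y" "inj_on Y K2"
    "K3 \<subseteq> closure (Y ` K2)" "\<And>x. x \<in> K2 \<Longrightarrow> Y (T2 x) = T3 (Y x)"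
    unfolding quasi_affine_def by blast
  from X(1) obtain B where XK: "X ` K1 \<subseteq> K2" and B: "\<And>x. x \<in> K1 \<Longrightarrow> norm (X x) \<le> B * norm x"
    unfolding bounded_clinear_on_def by blast
  from Y(1) obtain C where C: "\<And>x. x \<in> K2 \<Longrightarrow> norm (Y x) \<le> C * norm x"
    and add: "\<And>x y. \<lbrakk>x \<in> K2; y \<in> K2\<rbrakk> \<Longrightarrow> Y (x + y) = Y x + Y y"
    unfolding bounded_clinear_on_def by blast
  have C': "norm (Y x) \<le> \<bar>C\<bar> * norm x" if "x \<in> K2" for x
    by (rule order_trans[OF C[OF that]]) (simp add: mult_right_mono)
  have "bounded_clinear_on K1 K3 (Y \<circ> X)"
  proof -
    have "norm (Y (X x)) \<le> \<bar>C\<bar> * B * norm x" if "x \<in> K1" for x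
    proof -
      have "norm (Y (X x)) \<le> \<bar>C\<bar> * norm (X x)" using C' XK that by blast
      also have "\<dots> \<le> \<bar>C\<bar> * (B * norm x)" by (rule mult_left_mono[OF B[OF that]]) simp
      finally show ?thesis by (simp add: mult.assoc)
    qed
    then have "\<exists>D. \<forall>x\<in>K1. norm ((Y \<circ> X) x) \<le> D * norm x"
      by (intro exI[of _ "\<bar>C\<bar> * B"]) simp
    moreover have "\<forall>x\<in>K1. Y (X x) \<in> K3"
      using XK Y(1) unfolding bounded_clinear_on_def by blast
    moreover have "Y (X (x + y)) = Y (X x) + Y (X y)" if "x \<in> K1" "y \<in> K1" for x y
    proof -
      have "X (x + y) = X x + X y" using X(1) that unfolding bounded_clinear_on_def by blast
      moreover have "X x \<in> K2" "X y \<in> K2" using XK that by auto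
      ultimately show ?thesis using add by metis
    qed
    moreover have "Y (X (c *\<^sub>C x)) = c *\<^sub>C Y (X x)" if "x \<in> K1" for c x
    proof -
      have "X (c *\<^sub>C x) = c *\<^sub>C X x" using X(1) that unfolding bounded_clinear_on_def by blast
      moreover have "X x \<in> K2" using XK that by auto
      moreover have "\<And>y. y \<in> K2 \<Longrightarrow> Y (c *\<^sub>C y) = c *\<^sub>C Y y"
        using Y(1) unfolding bounded_clinear_on_def by blast
      ultimately show ?thesis by metis
    qed
    ultimately show ?thesis unfolding bounded_clinear_on_def comp_def by blast
  qed
  moreover have "inj_on (Y \<circ> X) K1"
    using X(2) Y(2) XK by (meson comp_inj_on inj_on_subset)
  moreover have "K3 \<subseteq> closure ((Y \<circ> X) ` K1)"
  proof -
    have diff: "x - y \<in> K2" "Y x - Y y = Y (x - y)" if "x \<in> K2" "y \<in> K2" for x y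
    proof -
      show *: "x - y \<in> K2" using assms(1) that by (simp add: complex_vector.subspace_diff)
      show "Y x - Y y = Y (x - y)" using add[OF * that(2)] by simp
    qed
    have "continuous_on K2 Y"
    proof (rule lipschitz_on_continuous_on)
      show "\<bar>C\<bar>-lipschitz_on K2 Y"
        using diff C' by (auto simp: lipschitz_on_def dist_norm)
    qed
    have "Y ` K2 \<subseteq> closure (Y ` (X ` K1))"
    proof (clarify, rule closure_sequential[THEN iffD2])
      fix y assume y: "y \<in> K2"
      have "y \<in> closure (X ` K1)" using X(3) y by (rule subsetD)
      then obtain s where s: "\<And>n. s n \<in> X ` K1" "s \<longlonglongrightarrow> y"
        unfolding closure_sequential by auto
      have "(\<lambda>n. Y (s n)) \<longlonglongrightarrow> Y y"
      proof (rule continuous_on_tendsto_compose[OF \<open>continuous_on K2 Y\<close> s(2) y])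
        show "\<forall>\<^sub>F n in sequentially. s n \<in> K2" using s(1) XK by (simp add: subset_iff)
      qed
      with s(1) show "\<exists>x. (\<forall>n. x n \<in> Y ` X ` K1) \<and> x \<longlonglongrightarrow> Y y"
        by (intro exI[of _ "\<lambda>n. Y (s n)"]) auto
    qed
    then have "closure (Y ` K2) \<subseteq> closure (Y ` (X ` K1))"
      by (simp add: closure_minimal)
    with Y(3) show ?thesis by (simp add: image_comp)
  qed
  moreover have "\<forall>x\<in>K1. (Y \<circ> X) (T1 x) = T3 ((Y \<circ> X) x)"
    using X(4) Y(4) XK by auto
  ultimately show ?thesis unfolding quasi_affine_def by blast
qed

lemma equiv_quasi_similarity_on_central_nilpotents:
  "equiv (central_nilpotents n T) (quasi_similarity_on (central_nilpotents n T))"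
proof (rule equivI)
  have sub: "csubspace K" if "(K, N) \<in> central_nilpotents n T" for K N
    using that unfolding central_nilpotents_def shift_nilpotent_rep_def orth_decomposition_def
      closed_csubspace_def by auto
  show "quasi_similarity_on (central_nilpotents n T)
      \<subseteq> central_nilpotents n T \<times> central_nilpotents n T"
    unfolding quasi_similarity_on_def by auto
  show "refl_on (central_nilpotents n T) (quasi_similarity_on (central_nilpotents n T))"
    unfolding refl_on_def quasi_similarity_on_def quasi_similar_def
    using quasi_affine_refl by fast
  show "sym (quasi_similarity_on (central_nilpotents n T))"
    unfolding sym_def quasi_similarity_on_def quasi_similar_def by fast
  show "trans (quasi_similarity_on (central_nilpotents n T))"
  proof (rule transI)
    fix p q r
    assume pq: "(p, q) \<in> quasi_similarity_on (central_nilpotents n T)"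
      and qr: "(q, r) \<in> quasi_similarity_on (central_nilpotents n T)"
    obtain K N K' N' K'' N'' where eq: "p = (K, N)" "q = (K', N')" "r = (K'', N'')"
      by (metis surj_pair)
    have mem: "p \<in> central_nilpotents n T" "q \<in> central_nilpotents n T"
        "r \<in> central_nilpotents n T"
      and 1: "quasi_similar K N K' N'" and 2: "quasi_similar K' N' K'' N''"
      using pq qr unfolding quasi_similarity_on_def eq by blast+
    have "csubspace K'" using sub mem(2) eq by blast
    with 1 2 have "quasi_similar K N K'' N''"
      unfolding quasi_similar_def by (blast intro: quasi_affine_trans)
    with mem show "(p, r) \<in> quasi_similarity_on (central_nilpotents n T)"
      unfolding quasi_similarity_on_def eq by blast
  qed
qed


section \<open>Canonical and *-canonical decompositions\<close>

definition isometric_part :: "('a::complex_hilbert \<Rightarrow> 'a) \<Rightarrow> 'a set"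
  where "isometric_part T = {h. \<forall>k. norm ((T ^^ Suc k) h) = norm ((T ^^ k) h)}"

definition H1_can :: "nat \<Rightarrow> ('a::complex_hilbert \<Rightarrow> 'a) \<Rightarrow> 'a set"
  where "H1_can n T = closed_cspan {(T ^^ k) h |k h. h \<in> defect_space_star T \<and> k \<ge> n}"

definition H0_can :: "nat \<Rightarrow> ('a::complex_hilbert \<Rightarrow> 'a) \<Rightarrow> 'a set"
  where "H0_can n T = UNIV \<ominus> (H1_can n T \<oplus> isometric_part (cadjoint T))"

definition H00_can :: "nat \<Rightarrow> ('a::complex_hilbert \<Rightarrow> 'a) \<Rightarrow> 'a set"
  where "H00_can n T = H0_can n T \<ominus> (isometric_part T \<inter> H0_can n T)"

definition Hm1_star_can :: "nat \<Rightarrow> ('a::complex_hilbert \<Rightarrow> 'a) \<Rightarrow> 'a set"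
  where "Hm1_star_can n T =
    closed_cspan {(cadjoint T ^^ k) h |k h. h \<in> defect_space T \<and> k \<ge> n}"

definition H0_star_can :: "nat \<Rightarrow> ('a::complex_hilbert \<Rightarrow> 'a) \<Rightarrow> 'a set"
  where "H0_star_can n T = UNIV \<ominus> (isometric_part T \<oplus> Hm1_star_can n T)"

definition H0_star0_can :: "nat \<Rightarrow> ('a::complex_hilbert \<Rightarrow> 'a) \<Rightarrow> 'a set"
  where "H0_star0_can n T =
    H0_star_can n T \<ominus> (H0_star_can n T \<inter> isometric_part (cadjoint T))"

end

theory Submission
  imports Defs
begin

text \<open>
  Write \<open>M\<^sub>1\<close> and \<open>M\<^sub>-\<^sub>1\<close> for the isometric parts of \<open>T\<close> and of \<open>T\<^sup>*\<close>.  A representation of the required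
  form is the same as a pair of closed subspaces \<open>H1\<close>, \<open>H3\<close> that are orthogonal to each other, with
  \<open>T\<close> leaving \<open>H1\<close> invariant and isometric there, and \<open>T\<^sup>*\<close> leaving \<open>H3\<close> invariant and isometric there:
  since \<open>T\<close> is completely non-unitary, the Wold decomposition makes the two isometries shifts
  (\<open>shift_nilpotent_rep_iff\<close>).  The central entry is the operator that \<open>T\<close> induces on the quotient of
  \<open>H3\<^sup>\<bottom>\<close> by \<open>H1\<close>.  Here \<open>H1 \<subseteq> M\<^sub>1\<close> and \<open>H3 \<subseteq> M\<^sub>-\<^sub>1\<close>.

  The smallest candidate is therefore \<open>L / (M\<^sub>1 \<inter> L)\<close> with \<open>L = M\<^sub>-\<^sub>1\<^sup>\<bottom>\<close>, the core of \<open>T\<close>.  The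
  characteristic function is a polynomial of degree \<open>n\<close> if and only if its coefficients vanish from
  \<open>n + 1\<close> on but, for \<open>n \<ge> 1\<close>, not at \<open>n\<close>; in terms of \<open>T\<close> this says that \<open>T\<^sup>n\<close> maps \<open>L\<close> into \<open>M\<^sub>1\<close> and that
  \<open>T\<^sup>n\<^sup>-\<^sup>1\<close> does not.  So the core operator is nilpotent of order \<open>n\<close>
  (\<open>core_space_nilpotent\<close>).  The subspace \<open>H00_can n T\<close> is this core, and \<open>H0_star0_can n T\<close> is the
  core of \<open>T\<^sup>*\<close>.

  Minimality needs a theory of nilpotent operators up to injections.  On a separable space, a nilpotent
  operator \<open>N\<close> has a sequence of finite-dimensional cyclic subspaces (chains), each split off with a complement
  invariant under \<open>N\<close>, that together span a dense subspace; at every step a chain of maximal length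
  is taken (\<open>jordan_system_exists\<close>).  The number of chains of each length, finite or infinite, is
  determined by \<open>N\<close>, is the same for \<open>N\<^sup>*\<close> (\<open>has_chains_adjoint\<close>), and can only grow along injective
  intertwiners (\<open>injected_has_chains\<close>).  Conversely, mapping chains into chains that are at least as
  long, with summable weights, gives an injective intertwiner, with dense range if the lengths agree
  (\<open>intertwiner_exists\<close>).  So chain counts decide both injectability and quasi-similarity
  (\<open>chain_counts_comparison\<close>); in particular, mutual injectability implies quasi-similarity.

  For an arbitrary representation, put \<open>L' = H3\<^sup>\<bottom> \<supseteq> L\<close>.  The core injects into \<open>L' / (M\<^sub>1 \<inter> L')\<close>, which
  is a quotient of the central operator on \<open>L' / H1\<close>.  The adjoint of a quotient is a restriction of the
  adjoint, so chain counts, which do not distinguish an operator from its adjoint, grow along both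
  steps (\<open>core_space_chains_least\<close>).  Hence the ultra-minimal operators are the central ones with the
  chain counts of the core, which is a quasi-similarity class.  It contains the operator on the core
  of \<open>T\<^sup>*\<close>, because the adjoint reverses representations and preserves counts, and the core and its
  counts are carried along by unitary equivalence.
\<close>


section \<open>Hilbert space geometry\<close>

instance complex_hilbert \<subseteq> banach ..

lemma scaleR_scaleC: "r *\<^sub>R x = complex_of_real r *\<^sub>C (x::'a::complex_hilbert)"
  by (simp add: scaleC_of_real)

lemma cinner_add_right: "cinner x (y + z) = cinner x y + cinner x (z::'a::complex_hilbert)"
  by (metis cinner_add_left cinner_commute complex_cnj_add)

lemma cinner_scaleC_right: "cinner x (c *\<^sub>C y) = cnj c * cinner x (y::'a::complex_hilbert)"
  by (metis cinner_scaleC_left cinner_commute complex_cnj_mult)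

lemma cinner_zero_left [simp]: "cinner 0 (y::'a::complex_hilbert) = 0"
  by (metis add_cancel_right_right cinner_add_left)

lemma cinner_zero_right [simp]: "cinner (y::'a::complex_hilbert) 0 = 0"
  by (metis add_cancel_right_right cinner_add_right)

lemma cinner_minus_left: "cinner (- x) y = - cinner x (y::'a::complex_hilbert)"
  by (metis ab_left_minus cinner_add_left cinner_zero_left eq_neg_iff_add_eq_0)

lemma cinner_minus_right: "cinner x (- y) = - cinner x (y::'a::complex_hilbert)"
  by (metis ab_left_minus cinner_add_right cinner_zero_right eq_neg_iff_add_eq_0)

lemma cinner_diff_left: "cinner (x - y) z = cinner x z - cinner y (z::'a::complex_hilbert)"
  using cinner_add_left[of x "- y" z] by (simp add: cinner_minus_left)

lemma cinner_diff_right: "cinner x (y - z) = cinner x y - cinner x (z::'a::complex_hilbert)"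
  using cinner_add_right[of x y "- z"] by (simp add: cinner_minus_right)

lemma cinner_sum_left: "cinner (\<Sum>i\<in>I. f i) (y::'a::complex_hilbert) = (\<Sum>i\<in>I. cinner (f i) y)"
  by (induction I rule: infinite_finite_induct) (auto simp: cinner_add_left)

lemma cinner_sum_right: "cinner (y::'a::complex_hilbert) (\<Sum>i\<in>I. f i) = (\<Sum>i\<in>I. cinner y (f i))"
  by (induction I rule: infinite_finite_induct) (auto simp: cinner_add_right)

lemmas cinner_simps = cinner_add_left cinner_add_right cinner_diff_left cinner_diff_right
  cinner_minus_left cinner_minus_right cinner_scaleC_left cinner_scaleC_right

lemma cinner_self: "cinner x x = complex_of_real ((norm (x::'a::complex_hilbert))\<^sup>2)"
proof (rule complex_eqI)
  show "Re (cinner x x) = Re (complex_of_real ((norm x)\<^sup>2))"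
    by (simp add: Re_cinner power2_norm_eq_inner)
  have "Im (cinner x x) = - Im (cinner x x)"
    by (metis cinner_commute cnj.simps(2))
  then show "Im (cinner x x) = Im (complex_of_real ((norm x)\<^sup>2))" by simp
qed

lemma cinner_self_eq_0 [simp]: "cinner x x = 0 \<longleftrightarrow> (x::'a::complex_hilbert) = 0"
  by (simp add: cinner_self)

lemma cinner_eq_0_commute: "cinner x y = 0 \<longleftrightarrow> cinner y (x::'a::complex_hilbert) = 0"
  by (metis cinner_commute complex_cnj_zero_iff)

lemma norm_scaleC: "norm (c *\<^sub>C x) = cmod c * norm (x::'a::complex_hilbert)"
proof -
  have "cinner (c *\<^sub>C x) (c *\<^sub>C x) = complex_of_real ((cmod c * norm x)\<^sup>2)"
    by (simp add: cinner_scaleC_left cinner_scaleC_right cinner_self[of x] power_mult_distrib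
        complex_norm_square[of c] mult_ac del: of_real_power)
  then have "(norm (c *\<^sub>C x))\<^sup>2 = (cmod c * norm x)\<^sup>2"
    unfolding cinner_self by (simp only: of_real_eq_iff)
  then show ?thesis by (simp add: power2_eq_iff_nonneg)
qed

lemma cinner_cauchy_schwarz: "cmod (cinner x y) \<le> norm x * norm (y::'a::complex_hilbert)"
proof (cases "cinner x y = 0")
  case False
  define c where "c = cnj (cinner x y) / cmod (cinner x y)"
  have c: "cmod c = 1" using False by (simp add: c_def norm_divide)
  have "c * cinner x y = cmod (cinner x y)"
    using False complex_norm_square[of "cinner x y"]
    by (simp add: c_def field_simps power2_eq_square)
  then have "cmod (cinner x y) = (c *\<^sub>C x) \<bullet> y"
    by (metis Re_cinner cinner_scaleC_left Re_complex_of_real)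
  also have "\<dots> \<le> norm (c *\<^sub>C x) * norm y" by (rule norm_cauchy_schwarz)
  finally show ?thesis by (simp add: norm_scaleC c)
qed simp

lemma bounded_linear_cinner_left: "bounded_linear (\<lambda>x. cinner x (y::'a::complex_hilbert))"
  by (rule bounded_linear_intro[where K = "norm y"])
    (simp_all add: cinner_add_left scaleR_scaleC cinner_scaleC_left scaleR_conv_of_real
      cinner_cauchy_schwarz)

lemma bounded_linear_cinner_right: "bounded_linear (\<lambda>x. cinner (y::'a::complex_hilbert) x)"
  by (rule bounded_linear_intro[where K = "norm y"])
    (simp_all add: cinner_add_right scaleR_scaleC cinner_scaleC_right scaleR_conv_of_real
      cinner_cauchy_schwarz mult.commute[of _ "norm y"])

lemma bounded_linear_scaleC: "bounded_linear (\<lambda>x. c *\<^sub>C (x::'a::complex_hilbert))"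
  by (rule bounded_linear_intro[where K = "cmod c"])
    (simp_all add: complex_vector.scale_right_distrib scaleR_scaleC norm_scaleC mult.commute)

lemma cinner_ext: "(\<And>z. cinner x z = cinner y (z::'a::complex_hilbert)) \<Longrightarrow> x = y"
  by (metis cinner_diff_left cinner_self_eq_0 right_minus_eq)

lemma norm_add_orthogonal:
  assumes "cinner x (y::'a::complex_hilbert) = 0"
  shows "(norm (x + y))\<^sup>2 = (norm x)\<^sup>2 + (norm y)\<^sup>2"
proof -
  have "x \<bullet> y = 0" by (metis assms Re_cinner zero_complex.sel(1))
  then show ?thesis by (simp add: dot_norm)
qed

lemma closed_orthogonal: "closed {x. \<forall>y\<in>A. cinner x (y::'a::complex_hilbert) = 0}"
proof -
  have "{x. \<forall>y\<in>A. cinner x y = 0} = (\<Inter>y\<in>A. {x. cinner x y = 0})" by auto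
  moreover have "closed {x. cinner x y = 0}" for y :: 'a
    by (intro closed_Collect_eq continuous_on_const
        bounded_linear.continuous_on[OF bounded_linear_cinner_left] continuous_on_id)
  ultimately show ?thesis by auto
qed


subsection \<open>Closed subspaces and orthogonal projections\<close>

lemma closed_csubspaceD:
  assumes "closed_csubspace (K::'a::complex_hilbert set)"
  shows "csubspace K" "closed K" "0 \<in> K" "x \<in> K \<Longrightarrow> y \<in> K \<Longrightarrow> x + y \<in> K"
    "x \<in> K \<Longrightarrow> y \<in> K \<Longrightarrow> x - y \<in> K" "x \<in> K \<Longrightarrow> c *\<^sub>C x \<in> K" "x \<in> K \<Longrightarrow> - x \<in> K"
  using assms unfolding closed_csubspace_def
  by (auto simp: complex_vector.subspace_0 complex_vector.subspace_add
      complex_vector.subspace_diff complex_vector.subspace_scale complex_vector.subspace_neg)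

lemma closed_csubspace_UNIV [simp]: "closed_csubspace (UNIV::'a::complex_hilbert set)"
  by (simp add: closed_csubspace_def)

lemma closed_csubspace_Int:
  "closed_csubspace K \<Longrightarrow> closed_csubspace L \<Longrightarrow> closed_csubspace (K \<inter> L)"
  by (simp add: closed_csubspace_def closed_Int complex_vector.subspace_inter)

lemma closed_csubspace_orth_minus:
  assumes "closed_csubspace (K::'a::complex_hilbert set)"
  shows "closed_csubspace (K \<ominus> A)"
proof -
  have "csubspace {x. \<forall>y\<in>A. cinner x (y::'a) = 0}"
    by (auto simp: complex_vector.subspace_def cinner_simps)
  then have "closed_csubspace {x. \<forall>y\<in>A. cinner x (y::'a) = 0}"
    by (simp add: closed_csubspace_def closed_orthogonal)
  moreover have "K \<ominus> A = K \<inter> {x. \<forall>y\<in>A. cinner x y = 0}"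
    by (auto simp: orth_minus_def)
  ultimately show ?thesis using assms closed_csubspace_Int by auto
qed

lemma closed_csubspace_closure:
  assumes "csubspace (K::'a::complex_hilbert set)"
  shows "closed_csubspace (closure K)"
proof -
  have "x + y \<in> closure K" if "x \<in> closure K" "y \<in> closure K" for x y
  proof -
    from that obtain f g where fg: "\<forall>n. f n \<in> K" "f \<longlonglongrightarrow> x" "\<forall>n. g n \<in> K" "g \<longlonglongrightarrow> y"
      unfolding closure_sequential by blast
    then have "(\<lambda>n. f n + g n) \<longlonglongrightarrow> x + y" "\<forall>n. f n + g n \<in> K"
      using assms by (auto intro: tendsto_add simp: complex_vector.subspace_add)
    then show ?thesis unfolding closure_sequential by (intro exI[of _ "\<lambda>n. f n + g n"]) auto
  qed
  moreover have "c *\<^sub>C x \<in> closure K" if "x \<in> closure K" for c x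
  proof -
    from that obtain f where f: "\<forall>n. f n \<in> K" "f \<longlonglongrightarrow> x"
      unfolding closure_sequential by blast
    then have "(\<lambda>n. c *\<^sub>C f n) \<longlonglongrightarrow> c *\<^sub>C x" "\<forall>n. c *\<^sub>C f n \<in> K"
      using assms by (auto intro: bounded_linear.tendsto[OF bounded_linear_scaleC]
          simp: complex_vector.subspace_scale)
    then show ?thesis unfolding closure_sequential by (intro exI[of _ "\<lambda>n. c *\<^sub>C f n"]) auto
  qed
  moreover have "0 \<in> closure K"
    using assms closure_subset complex_vector.subspace_0 by blast
  ultimately show ?thesis
    by (simp add: closed_csubspace_def complex_vector.subspace_def)
qed

lemma closed_csubspace_closed_cspan: "closed_csubspace (closed_cspan (A::'a::complex_hilbert set))"
  unfolding closed_cspan_def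
  by (rule closed_csubspace_closure) (simp add: complex_vector.subspace_span)

lemma closed_cspan_superset: "A \<subseteq> closed_cspan (A::'a::complex_hilbert set)"
  unfolding closed_cspan_def
  using complex_vector.span_superset closure_subset by blast

lemma closed_cspan_minimal:
  "A \<subseteq> K \<Longrightarrow> closed_csubspace K \<Longrightarrow> closed_cspan A \<subseteq> (K::'a::complex_hilbert set)"
  unfolding closed_cspan_def closed_csubspace_def
  by (simp add: closure_minimal complex_vector.span_minimal)

text \<open>A sequence in \<open>K\<close> whose distances to \<open>x\<close> tend to the infimum is Cauchy by the parallelogram
  identity, and its limit is the foot of the perpendicular.\<close>

lemma orthogonal_foot_exists:
  assumes K: "closed_csubspace (K::'a::complex_hilbert set)"
  shows "\<exists>y\<in>K. \<forall>z\<in>K. cinner (x - y) z = 0"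
proof -
  have ne: "K \<noteq> {}" using closed_csubspaceD(3)[OF K] by auto
  define d where "d = infdist x K"
  have d0: "0 \<le> d" by (simp add: d_def infdist_nonneg)
  have le: "d \<le> norm (x - y)" if "y \<in> K" for y
    using infdist_le[OF that, of x] by (simp add: d_def dist_norm)
  have "\<exists>y\<in>K. norm (x - y) < d + 1 / real (Suc n)" for n
  proof -
    have "infdist x K < d + 1 / real (Suc n)" by (simp add: d_def)
    then obtain y where "y \<in> K" "dist x y < d + 1 / real (Suc n)"
      using ne by (auto simp: infdist_notempty cInf_less_iff)
    then show ?thesis by (auto simp: dist_norm)
  qed
  then obtain f where f: "\<And>n. f n \<in> K" "\<And>n. norm (x - f n) < d + 1 / real (Suc n)"
    by metis
  have half: "(1/2) *\<^sub>R (u + v) \<in> K" if "u \<in> K" "v \<in> K" for u v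
    using that closed_csubspaceD[OF K] by (simp add: scaleR_scaleC del: of_real_divide)
  have est: "(norm (f m - f n))\<^sup>2 \<le> (8 * d + 4) / real (Suc N)" if "N \<le> m" "N \<le> n" for m n N
  proof -
    let ?u = "x - f m" and ?v = "x - f n" and ?e = "1 / real (Suc N)"
    have e: "0 \<le> ?e" "?e \<le> 1" by auto
    have bd: "norm (x - f k) \<le> d + ?e" if "N \<le> k" for k
    proof -
      have "1 / real (Suc k) \<le> ?e" using that by (simp add: frac_le)
      then show ?thesis using f(2)[of k] by linarith
    qed
    have par: "(norm (?u + ?v))\<^sup>2 + (norm (?u - ?v))\<^sup>2 = 2 * (norm ?u)\<^sup>2 + 2 * (norm ?v)\<^sup>2"
      by (simp add: power2_norm_eq_inner inner_simps inner_commute)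
    have "?u + ?v = 2 *\<^sub>R (x - (1/2) *\<^sub>R (f m + f n))"
      by (simp add: algebra_simps scaleR_2)
    then have "norm (?u + ?v) = 2 * norm (x - (1/2) *\<^sub>R (f m + f n))" by simp
    moreover have "d \<le> norm (x - (1/2) *\<^sub>R (f m + f n))" by (intro le half f(1))
    ultimately have "(2 * d)\<^sup>2 \<le> (norm (?u + ?v))\<^sup>2" using d0 by (intro power_mono) auto
    moreover have "(norm ?u)\<^sup>2 \<le> (d + ?e)\<^sup>2" "(norm ?v)\<^sup>2 \<le> (d + ?e)\<^sup>2"
      using bd that by (auto intro!: power_mono)
    ultimately have "(norm (?u - ?v))\<^sup>2 \<le> 4 * (d + ?e)\<^sup>2 - 4 * d\<^sup>2"
      using par by (simp add: power_mult_distrib)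
    also have "\<dots> = 8 * d * ?e + 4 * (?e * ?e)" by (simp add: power2_eq_square algebra_simps)
    also have "\<dots> \<le> 8 * d * ?e + 4 * (?e * 1)"
      by (intro add_left_mono mult_left_mono e) auto
    also have "\<dots> = (8 * d + 4) / real (Suc N)" by (simp add: add_divide_distrib)
    finally show ?thesis by (simp add: norm_minus_commute)
  qed
  have "Cauchy f"
  proof (rule CauchyI)
    fix e :: real assume e: "0 < e"
    obtain N where N: "(8 * d + 4) / e\<^sup>2 < real N" using reals_Archimedean2 by blast
    have "(8 * d + 4) / real (Suc N) < e\<^sup>2"
    proof -
      have "(8 * d + 4) / e\<^sup>2 < real (Suc N)" using N by simp
      then show ?thesis using e by (simp add: field_simps)
    qed
    then have "(norm (f m - f n))\<^sup>2 < e\<^sup>2" if "N \<le> m" "N \<le> n" for m n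
      using est[OF that] by linarith
    then have "norm (f m - f n) < e" if "N \<le> m" "N \<le> n" for m n
      using that e power_less_imp_less_base less_imp_le by blast
    then show "\<exists>M. \<forall>m\<ge>M. \<forall>n\<ge>M. norm (f m - f n) < e" by blast
  qed
  then obtain y where y: "f \<longlonglongrightarrow> y" by (auto simp: Cauchy_convergent_iff convergent_def)
  have yK: "y \<in> K"
    using closed_sequentially[OF closed_csubspaceD(2)[OF K] f(1) y] .
  have "norm (x - y) \<le> d"
  proof (rule LIMSEQ_le)
    show "(\<lambda>n. norm (x - f n)) \<longlonglongrightarrow> norm (x - y)" by (intro tendsto_intros y)
    show "(\<lambda>n. d + 1 / real (Suc n)) \<longlonglongrightarrow> d"
      using tendsto_add[OF tendsto_const lim_inverse_n', of d]
        LIMSEQ_Suc[of "\<lambda>n. d + 1 / real n" d] by simp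
    show "\<exists>N. \<forall>n\<ge>N. norm (x - f n) \<le> d + 1 / real (Suc n)" using f(2) less_imp_le by blast
  qed
  with le[OF yK] have dy: "norm (x - y) = d" by simp
  have re: "(x - y) \<bullet> z = 0" if z: "z \<in> K" for z
  proof (cases "z = 0")
    case False
    define t where "t = ((x - y) \<bullet> z) / (z \<bullet> z)"
    have "y + t *\<^sub>R z \<in> K" using z yK closed_csubspaceD[OF K] by (simp add: scaleR_scaleC)
    then have "d\<^sup>2 \<le> (norm (x - (y + t *\<^sub>R z)))\<^sup>2" using le d0 by (intro power_mono) auto
    also have "\<dots> = (norm (x - y))\<^sup>2 - ((x - y) \<bullet> z)\<^sup>2 / (z \<bullet> z)"
    proof -
      have "(norm (x - y - t *\<^sub>R z))\<^sup>2
          = (norm (x - y))\<^sup>2 - 2 * t * ((x - y) \<bullet> z) + t * t * (z \<bullet> z)"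
        unfolding power2_norm_eq_inner
        by (simp only: inner_diff_left inner_diff_right inner_scaleR_left inner_scaleR_right)
          (simp add: inner_commute algebra_simps)
      moreover have "t * (z \<bullet> z) = (x - y) \<bullet> z" using False by (simp add: t_def)
      ultimately have "(norm (x - y - t *\<^sub>R z))\<^sup>2 = (norm (x - y))\<^sup>2 - t * ((x - y) \<bullet> z)"
        by (simp add: mult.assoc)
      then show ?thesis by (simp add: t_def power2_eq_square diff_diff_eq)
    qed
    finally have "((x - y) \<bullet> z)\<^sup>2 / (z \<bullet> z) \<le> 0" by (simp add: dy)
    moreover have "0 < z \<bullet> z" using False by simp
    ultimately have "((x - y) \<bullet> z)\<^sup>2 \<le> 0" by (metis divide_pos_pos not_le)
    then show ?thesis by simp
  qed simp
  have "cinner (x - y) z = 0" if z: "z \<in> K" for z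
  proof (rule complex_eqI)
    show "Re (cinner (x - y) z) = Re 0" using re[OF z] by (simp add: Re_cinner)
    have "Re (cinner (x - y) (\<i> *\<^sub>C z)) = 0"
      using re z closed_csubspaceD(6)[OF K] by (simp add: Re_cinner)
    then show "Im (cinner (x - y) z) = Im 0" by (simp add: cinner_scaleC_right)
  qed
  with yK show ?thesis by blast
qed

lemma cproj_unique:
  assumes K: "closed_csubspace (K::'a::complex_hilbert set)"
    and y: "y \<in> K" "\<And>z. z \<in> K \<Longrightarrow> cinner (x - y) z = 0"
  shows "cproj K x = y"
  unfolding cproj_def
proof (rule the_equality)
  show "y \<in> K \<and> (\<forall>z\<in>K. cinner (x - y) z = 0)" using y by blast
next
  fix w assume w: "w \<in> K \<and> (\<forall>z\<in>K. cinner (x - w) z = 0)"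
  then have "w - y \<in> K" using y(1) closed_csubspaceD[OF K] by blast
  with w y(2) have "cinner (x - y) (w - y) - cinner (x - w) (w - y) = 0" by simp
  then have "cinner (w - y) (w - y) = 0" by (simp add: cinner_diff_left)
  then show "w = y" by simp
qed

lemma
  assumes K: "closed_csubspace (K::'a::complex_hilbert set)"
  shows cproj_in: "cproj K x \<in> K"
    and cproj_orth: "z \<in> K \<Longrightarrow> cinner (x - cproj K x) z = 0"
    and cproj_orth': "z \<in> K \<Longrightarrow> cinner z (x - cproj K x) = 0"
proof -
  obtain y where y: "y \<in> K" "\<And>z. z \<in> K \<Longrightarrow> cinner (x - y) z = 0"
    using orthogonal_foot_exists[OF K] by blast
  have eq: "cproj K x = y" by (rule cproj_unique[OF K y])
  show "cproj K x \<in> K" using y eq by simp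
  show *: "z \<in> K \<Longrightarrow> cinner (x - cproj K x) z = 0" using y eq by simp
  show "z \<in> K \<Longrightarrow> cinner z (x - cproj K x) = 0" using * cinner_eq_0_commute by blast
qed

lemma cproj_cinner:
  assumes "closed_csubspace (K::'a::complex_hilbert set)" "z \<in> K"
  shows "cinner (cproj K x) z = cinner x z" "cinner z (cproj K x) = cinner z x"
  using cproj_orth[OF assms, of x] cproj_orth'[OF assms, of x] by (simp_all add: cinner_simps)

lemma cproj_id: "closed_csubspace K \<Longrightarrow> x \<in> K \<Longrightarrow> cproj K x = (x::'a::complex_hilbert)"
  by (rule cproj_unique) auto

lemma cproj_eq_0:
  "closed_csubspace K \<Longrightarrow> (\<And>z. z \<in> K \<Longrightarrow> cinner x z = 0) \<Longrightarrow> cproj K x = (0::'a::complex_hilbert)"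
  by (rule cproj_unique) (auto simp: closed_csubspaceD)

lemma cproj_add:
  assumes "closed_csubspace (K::'a::complex_hilbert set)"
  shows "cproj K (x + y) = cproj K x + cproj K y"
  using cproj_in[OF assms] closed_csubspaceD[OF assms] assms
  by (intro cproj_unique) (simp_all add: cinner_simps cproj_cinner)

lemma cproj_diff:
  assumes "closed_csubspace (K::'a::complex_hilbert set)"
  shows "cproj K (x - y) = cproj K x - cproj K y"
  using cproj_in[OF assms] closed_csubspaceD[OF assms] assms
  by (intro cproj_unique) (simp_all add: cinner_simps cproj_cinner)

lemma cproj_scaleC:
  assumes "closed_csubspace (K::'a::complex_hilbert set)"
  shows "cproj K (c *\<^sub>C x) = c *\<^sub>C cproj K x"
  using cproj_in[OF assms] closed_csubspaceD[OF assms] assms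
  by (intro cproj_unique) (simp_all add: cinner_simps cproj_cinner)

lemma norm_cproj:
  assumes "closed_csubspace (K::'a::complex_hilbert set)"
  shows "(norm x)\<^sup>2 = (norm (cproj K x))\<^sup>2 + (norm (x - cproj K x))\<^sup>2"
  using norm_add_orthogonal[OF cproj_orth'[OF assms cproj_in[OF assms]], of x x] by simp

lemma norm_cproj_le:
  assumes "closed_csubspace (K::'a::complex_hilbert set)"
  shows "norm (cproj K x) \<le> norm x"
proof -
  have "(norm (cproj K x))\<^sup>2 \<le> (norm x)\<^sup>2"
    unfolding norm_cproj[OF assms, of x] by (rule le_add_same_cancel1[THEN iffD2]) (rule zero_le_power2)
  then show ?thesis by (rule power2_le_imp_le) simp
qed

text \<open>This is how isometric diagonal entries will force their subspaces to be invariant.\<close>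

lemma cproj_eq_self_if_norm:
  assumes "closed_csubspace (K::'a::complex_hilbert set)" "norm x \<le> norm (cproj K x)"
  shows "x \<in> K"
proof -
  have "(norm x)\<^sup>2 \<le> (norm (cproj K x))\<^sup>2" using assms(2) by (simp add: power_mono)
  then have "x = cproj K x" using norm_cproj[OF assms(1), of x] by simp
  then show ?thesis using cproj_in[OF assms(1)] by metis
qed

lemma orthogonal_to_complement:
  assumes K: "closed_csubspace (K::'a::complex_hilbert set)"
    and x: "\<And>z. (\<And>y. y \<in> K \<Longrightarrow> cinner z y = 0) \<Longrightarrow> cinner x z = 0"
  shows "x \<in> K"
proof -
  have "cinner x (x - cproj K x) = 0" by (rule x) (rule cproj_orth[OF K])
  moreover have "cinner (cproj K x) (x - cproj K x) = 0"
    by (rule cproj_orth'[OF K cproj_in[OF K]])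
  ultimately have "cinner (x - cproj K x) (x - cproj K x) = 0"
    unfolding cinner_diff_left[of x "cproj K x"] by simp
  then have "x = cproj K x" by simp
  then show ?thesis using cproj_in[OF K] by metis
qed

lemma eq_if_orth_minus_trivial:
  assumes "closed_csubspace (F::'a::complex_hilbert set)" "closed_csubspace E" "F \<subseteq> E"
    and triv: "\<And>x. x \<in> E \<Longrightarrow> (\<And>y. y \<in> F \<Longrightarrow> cinner x y = 0) \<Longrightarrow> x = 0"
  shows "F = E"
proof
  show "E \<subseteq> F"
  proof
    fix x assume "x \<in> E"
    then have "x - cproj F x \<in> E"
      using assms cproj_in closed_csubspaceD(5) by blast
    then have "x - cproj F x = 0" by (rule triv) (rule cproj_orth[OF assms(1)])
    then show "x \<in> F" using cproj_in[OF assms(1), of x] by simp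
  qed
qed (rule assms(3))


subsection \<open>Bounded operators and adjoints\<close>

abbreviation bop :: "('a::complex_hilbert \<Rightarrow> 'a) \<Rightarrow> bool"
  where "bop \<equiv> bounded_clinear_on UNIV UNIV"

lemma bounded_clinear_onI:
  assumes "\<And>x. x \<in> K \<Longrightarrow> A x \<in> L" "\<And>x y. x \<in> K \<Longrightarrow> y \<in> K \<Longrightarrow> A (x + y) = A x + A y"
    "\<And>c x. x \<in> K \<Longrightarrow> A (c *\<^sub>C x) = c *\<^sub>C A x" "\<And>x. x \<in> K \<Longrightarrow> norm (A x) \<le> B * norm x"
  shows "bounded_clinear_on K L A"
  using assms unfolding bounded_clinear_on_def by blast

lemma bounded_clinear_onD:
  assumes "bounded_clinear_on K L A"
  shows "x \<in> K \<Longrightarrow> A x \<in> L" "x \<in> K \<Longrightarrow> y \<in> K \<Longrightarrow> A (x + y) = A x + A y"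
    "x \<in> K \<Longrightarrow> A (c *\<^sub>C x) = c *\<^sub>C A x"
  using assms unfolding bounded_clinear_on_def by blast+

lemma bounded_clinear_on_bound:
  assumes "bounded_clinear_on K L A"
  obtains B where "0 \<le> B" "\<And>x. x \<in> K \<Longrightarrow> norm (A x) \<le> B * norm x"
proof -
  obtain B where B: "\<forall>x\<in>K. norm (A x) \<le> B * norm x"
    using assms unfolding bounded_clinear_on_def by blast
  have "norm (A x) \<le> \<bar>B\<bar> * norm x" if "x \<in> K" for x
    by (rule order_trans[OF B[rule_format, OF that]]) (simp add: mult_right_mono)
  then show ?thesis by (intro that[of "\<bar>B\<bar>"]) auto
qed

lemma bounded_clinear_on_0:
  assumes "bounded_clinear_on K L A" "closed_csubspace K"
  shows "A 0 = 0"
  using bounded_clinear_onD(3)[OF assms(1) closed_csubspaceD(3)[OF assms(2)], of 0] by simp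

lemma bounded_clinear_on_diff:
  assumes "bounded_clinear_on K L A" "closed_csubspace K" "x \<in> K" "y \<in> K"
  shows "A (x - y) = A x - A y"
proof -
  have "A ((x - y) + y) = A (x - y) + A y"
    using assms closed_csubspaceD(5)[OF assms(2)] by (intro bounded_clinear_onD(2)) auto
  then show ?thesis by (simp add: eq_diff_eq)
qed

lemma bounded_clinear_on_sum:
  assumes A: "bounded_clinear_on K L A" and K: "closed_csubspace K"
    and f: "\<And>i. i \<in> I \<Longrightarrow> f i \<in> K"
  shows "A (\<Sum>i\<in>I. f i) = (\<Sum>i\<in>I. A (f i))"
proof -
  have sub: "(\<Sum>i\<in>J. f i) \<in> K" if "J \<subseteq> I" for J
    using that f closed_csubspaceD(1)[OF K] by (auto intro: complex_vector.subspace_sum)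
  show ?thesis using f sub
  proof (induction I rule: infinite_finite_induct)
    case (insert i J)
    have "A (f i + (\<Sum>i\<in>J. f i)) = A (f i) + A (\<Sum>i\<in>J. f i)"
      using insert by (intro bounded_clinear_onD(2)[OF A]) auto
    moreover have "A (\<Sum>i\<in>J. f i) = (\<Sum>i\<in>J. A (f i))" using insert by auto
    ultimately show ?case using insert by simp
  qed (auto simp: bounded_clinear_on_0[OF A K])
qed

lemma bop_bounded_linear: "bounded_clinear_on UNIV UNIV A \<Longrightarrow> bounded_linear A"
proof -
  assume A: "bounded_clinear_on UNIV UNIV A"
  obtain B where "\<And>x. norm (A x) \<le> B * norm x"
    using bounded_clinear_on_bound[OF A] by auto
  then show ?thesis using bounded_clinear_onD[OF A]
    by (intro bounded_linear_intro[of A B]) (auto simp: scaleR_scaleC mult.commute)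
qed

lemma bop_simps:
  assumes "bounded_clinear_on UNIV UNIV A"
  shows "A (x + y) = A x + A y" "A (x - y) = A x - A y" "A (c *\<^sub>C x) = c *\<^sub>C A x" "A 0 = 0"
    "A (- x) = - A x"
  using bounded_clinear_onD[OF assms] bop_bounded_linear[OF assms]
  by (auto simp: linear_diff bounded_linear.linear linear_0 linear_neg)

lemma bop_continuous: "bop A \<Longrightarrow> continuous_on S A"
  by (simp add: bop_bounded_linear linear_continuous_on)

lemma bounded_clinear_on_comp:
  assumes A: "bounded_clinear_on K L A" and B: "bounded_clinear_on L M B"
  shows "bounded_clinear_on K M (\<lambda>x. B (A x))"
proof -
  obtain a b where ab: "0 \<le> b" "\<And>x. x \<in> K \<Longrightarrow> norm (A x) \<le> a * norm x"
    "\<And>x. x \<in> L \<Longrightarrow> norm (B x) \<le> b * norm x"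
    using bounded_clinear_on_bound[OF A] bounded_clinear_on_bound[OF B] by metis
  show ?thesis
  proof (rule bounded_clinear_onI)
    fix x assume x: "x \<in> K"
    have "norm (B (A x)) \<le> b * norm (A x)" using x ab(3) bounded_clinear_onD(1)[OF A] by blast
    also have "\<dots> \<le> b * (a * norm x)" using x ab by (simp add: mult_left_mono)
    finally show "norm (B (A x)) \<le> (b * a) * norm x" by (simp add: mult.assoc)
  qed (use bounded_clinear_onD[OF A] bounded_clinear_onD[OF B] in auto)
qed

lemma bounded_clinear_on_subset:
  "bounded_clinear_on K L A \<Longrightarrow> K' \<subseteq> K \<Longrightarrow> (\<And>x. x \<in> K' \<Longrightarrow> A x \<in> L') \<Longrightarrow> bounded_clinear_on K' L' A"
  unfolding bounded_clinear_on_def by blast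

lemma bounded_clinear_on_cong:
  assumes "closed_csubspace K" "bounded_clinear_on K L A" "\<And>x. x \<in> K \<Longrightarrow> A' x = A x"
  shows "bounded_clinear_on K L A'"
  using assms closed_csubspaceD[OF assms(1)] unfolding bounded_clinear_on_def by metis

lemma bop_id: "bop (\<lambda>x. x)"
  by (rule bounded_clinear_onI[where B = 1]) auto

lemma bop_diff:
  assumes A: "bop A" and B: "bop B"
  shows "bop (\<lambda>x. A x - B x)"
proof -
  obtain a b where ab: "\<And>x. norm (A x) \<le> a * norm x" "\<And>x. norm (B x) \<le> b * norm x"
    using bounded_clinear_on_bound[OF A] bounded_clinear_on_bound[OF B] by (metis UNIV_I)
  show ?thesis
  proof (rule bounded_clinear_onI)
    fix x
    have "norm (A x - B x) \<le> norm (A x) + norm (B x)" by (rule norm_triangle_ineq4)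
    also have "\<dots> \<le> (a + b) * norm x" using ab[of x] by (simp add: distrib_right)
    finally show "norm (A x - B x) \<le> (a + b) * norm x" .
  qed (auto simp: bop_simps[OF A] bop_simps[OF B] complex_vector.scale_right_diff_distrib)
qed

lemma bop_pow: "bop A \<Longrightarrow> bop (A ^^ k)"
proof (induction k)
  case (Suc k)
  then show ?case using bounded_clinear_on_comp[of UNIV UNIV "A ^^ k" UNIV A] by (simp add: comp_def)
qed (simp add: bop_id id_def)

lemma bop_cproj: "closed_csubspace K \<Longrightarrow> bop (cproj K)"
  by (rule bounded_clinear_onI[where B = 1]) (auto simp: cproj_add cproj_scaleC norm_cproj_le)

lemma closed_csubspace_vimage:
  assumes A: "bop A" and K: "closed_csubspace K"
  shows "closed_csubspace {x. A x \<in> K}"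
proof -
  have "closed (A -` K)"
    using closed_vimage[OF closed_csubspaceD(2)[OF K] bop_continuous[OF A]] .
  then show ?thesis using closed_csubspaceD[OF K]
    by (auto simp: closed_csubspace_def vimage_def complex_vector.subspace_def bop_simps[OF A])
qed

lemma closed_csubspace_eq:
  assumes A: "bop A" and B: "bop B"
  shows "closed_csubspace {x. A x = B x}"
proof -
  have "closed_csubspace {x. A x - B x \<in> {0}}"
    by (intro closed_csubspace_vimage bop_diff A B) (simp add: closed_csubspace_def)
  then show ?thesis by simp
qed

text \<open>The Riesz representation theorem: the representing vector is a multiple of any vector
  orthogonal to the kernel.\<close>

lemma riesz_representation:
  fixes \<phi> :: "'a::complex_hilbert \<Rightarrow> complex"
  assumes add: "\<And>x y. \<phi> (x + y) = \<phi> x + \<phi> y" and scale: "\<And>c x. \<phi> (c *\<^sub>C x) = c * \<phi> x"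
    and bound: "\<And>x. cmod (\<phi> x) \<le> B * norm x"
  shows "\<exists>z. \<forall>x. \<phi> x = cinner x z"
proof (cases "\<forall>x. \<phi> x = 0")
  case True
  then show ?thesis by (intro exI[of _ 0]) simp
next
  case False
  then obtain x0 where x0: "\<phi> x0 \<noteq> 0" by blast
  have bl: "bounded_linear \<phi>"
    by (rule bounded_linear_intro[of _ B])
      (simp_all add: add scaleR_scaleC scale scaleR_conv_of_real bound mult.commute)
  have diff: "\<phi> (x - y) = \<phi> x - \<phi> y" and zero: "\<phi> 0 = 0" for x y
    using bl by (simp_all add: bounded_linear.linear linear_diff linear_0)
  define K where "K = {x. \<phi> x = 0}"
  have "closed K" unfolding K_def
    by (intro closed_Collect_eq continuous_on_const linear_continuous_on bl)
  then have K: "closed_csubspace K"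
    by (auto simp: closed_csubspace_def complex_vector.subspace_def K_def add scale zero)
  define w where "w = x0 - cproj K x0"
  have "\<phi> (cproj K x0) = 0" using cproj_in[OF K, of x0] by (simp add: K_def)
  then have w: "\<phi> w \<noteq> 0" using x0 by (simp add: w_def diff)
  then have ww: "cinner w w \<noteq> 0" using zero by auto
  define z where "z = cnj (\<phi> w / cinner w w) *\<^sub>C w"
  have "\<phi> x = cinner x z" for x
  proof -
    define y where "y = x - (\<phi> x / \<phi> w) *\<^sub>C w"
    have "y \<in> K" using w by (simp add: K_def y_def diff scale)
    then have "cinner y w = 0" unfolding w_def by (rule cproj_orth'[OF K])
    then have "cinner x w = (\<phi> x / \<phi> w) * cinner w w" by (simp add: y_def cinner_simps)
    then show ?thesis using w ww by (simp add: z_def cinner_scaleC_right)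
  qed
  then show ?thesis by blast
qed

lemma adjoint_on_eqI:
  assumes K: "closed_csubspace K" and y: "y \<in> K" "z \<in> K"
    and z: "\<And>x. x \<in> K \<Longrightarrow> cinner (A x) y = cinner x z"
  shows "adjoint_on K A y = z"
proof -
  have "(THE z. z \<in> K \<and> (\<forall>x\<in>K. cinner (A x) y = cinner x z)) = z"
  proof (rule the_equality)
    fix z' assume z': "z' \<in> K \<and> (\<forall>x\<in>K. cinner (A x) y = cinner x z')"
    then have "z' - z \<in> K" using y closed_csubspaceD[OF K] by blast
    then have "cinner (z' - z) (z' - z) = 0" using z z' by (simp add: cinner_diff_right)
    then show "z' = z" by simp
  qed (use y z in auto)
  then show ?thesis using y(1) by (simp add: adjoint_on_def)
qed

lemma cinner_cadjoint:
  assumes A: "bop A"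
  shows "cinner (A x) y = cinner x (cadjoint A y)"
proof -
  obtain B where B: "\<And>x. norm (A x) \<le> B * norm x"
    using bounded_clinear_on_bound[OF A] by auto
  have "\<exists>z. \<forall>x. cinner (A x) y = cinner x z"
  proof (rule riesz_representation[where B = "B * norm y"])
    fix x
    have "cmod (cinner (A x) y) \<le> norm (A x) * norm y" by (rule cinner_cauchy_schwarz)
    also have "\<dots> \<le> (B * norm x) * norm y" using B by (simp add: mult_right_mono)
    finally show "cmod (cinner (A x) y) \<le> B * norm y * norm x" by (simp add: mult_ac)
  qed (simp_all add: bop_simps[OF A] cinner_simps)
  then obtain z where z: "\<And>x. cinner (A x) y = cinner x z" by blast
  have "cadjoint A y = z" by (rule adjoint_on_eqI) (simp_all add: z)
  then show ?thesis using z by simp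
qed

lemma cinner_cadjoint':
  "bop A \<Longrightarrow> cinner (cadjoint A x) y = cinner x (A y)"
  by (metis cinner_cadjoint cinner_commute)

lemma cadjoint_eqI:
  assumes "\<And>x y. cinner (A x) y = cinner x (B y)"
  shows "cadjoint A = B"
  by (rule ext, rule adjoint_on_eqI) (simp_all add: assms)

lemma cadjoint_cadjoint: "bop A \<Longrightarrow> cadjoint (cadjoint A) = A"
  by (rule cadjoint_eqI) (rule cinner_cadjoint')

lemma cadjoint_contraction:
  assumes "contraction T"
  shows "contraction (cadjoint T)"
proof -
  have T: "bop T" "\<And>x. norm (T x) \<le> norm x" using assms by (auto simp: contraction_def)
  have le: "norm (cadjoint T x) \<le> norm x" for x
  proof (cases "cadjoint T x = 0")
    case False
    have "(norm (cadjoint T x))\<^sup>2 = cmod (cinner (cadjoint T x) (cadjoint T x))"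
      by (simp add: cinner_self norm_power)
    also have "\<dots> = cmod (cinner (T (cadjoint T x)) x)" by (simp add: cinner_cadjoint[OF T(1)])
    also have "\<dots> \<le> norm (T (cadjoint T x)) * norm x" by (rule cinner_cauchy_schwarz)
    also have "\<dots> \<le> norm (cadjoint T x) * norm x" using T(2) by (simp add: mult_right_mono)
    finally show ?thesis using False by (simp add: power2_eq_square)
  qed simp
  have "bop (cadjoint T)"
  proof (rule bounded_clinear_onI[where B = 1])
    show "cadjoint T (x + y) = cadjoint T x + cadjoint T y" for x y
      by (rule cinner_ext) (simp add: cinner_cadjoint'[OF T(1)] cinner_simps)
    show "cadjoint T (c *\<^sub>C x) = c *\<^sub>C cadjoint T x" for c x
      by (rule cinner_ext) (simp add: cinner_cadjoint'[OF T(1)] cinner_simps)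
  qed (simp_all add: le)
  with le show ?thesis by (simp add: contraction_def)
qed

lemma cinner_pow_adjoint:
  fixes A B :: "'a::complex_hilbert \<Rightarrow> 'a"
  assumes "\<And>x y. cinner (A x) y = cinner x (B y)"
  shows "cinner ((A ^^ k) x) y = cinner x ((B ^^ k) y)"
proof (induction k arbitrary: x y)
  case (Suc k)
  have "cinner ((A ^^ Suc k) x) y = cinner ((A ^^ k) x) (B y)" using assms by simp
  also have "\<dots> = cinner x ((B ^^ k) (B y))" by (rule Suc.IH)
  finally show ?case by (simp add: funpow_swap1)
qed simp


section \<open>Square roots and defect operators\<close>

lemma positive_op_selfadjoint:
  assumes A: "bop A" and pos: "positive_op A"
  shows "cinner (A x) y = cinner x (A y)"
proof -
  have im: "Im (cinner (A u) u) = 0" for u using pos by (simp add: positive_op_def)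
  have 1: "Im (cinner (A x) y) + Im (cinner (A y) x) = 0"
    using im[of "x + y"] im[of x] im[of y] by (simp add: bop_simps[OF A] cinner_simps)
  have "Im (cinner (A (x + \<i> *\<^sub>C y)) (x + \<i> *\<^sub>C y))
      = Im (cinner (A x) x) - Re (cinner (A x) y) + Re (cinner (A y) x) + Im (cinner (A y) y)"
    by (simp add: bop_simps[OF A] cinner_simps algebra_simps)
  then have 2: "Re (cinner (A x) y) = Re (cinner (A y) x)"
    using im[of "x + \<i> *\<^sub>C y"] im[of x] im[of y] by simp
  have "cinner (A x) y = cnj (cinner (A y) x)"
    by (rule complex_eqI) (use 1 2 in simp_all)
  then show ?thesis by (simp add: cinner_commute[of x])
qed

text \<open>If \<open>A y \<noteq> 0\<close>, a small perturbation of \<open>y\<close> in the direction of \<open>- A y\<close> would make the quadratic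
  form negative.\<close>

lemma positive_op_kernel:
  assumes A: "bop A" and pos: "positive_op A" and zero: "cinner (A y) y = 0"
  shows "A y = 0"
proof -
  let ?z = "A y"
  define a where "a = (norm ?z)\<^sup>2"
  define c where "c = Re (cinner (A ?z) ?z)"
  have c: "0 \<le> c" using pos by (simp add: c_def positive_op_def)
  have a: "0 \<le> a" by (simp add: a_def)
  define t where "t = - a / (c + 1)"
  have "Re (cinner (A (y + of_real t *\<^sub>C ?z)) (y + of_real t *\<^sub>C ?z)) = 2 * t * a + t * t * c"
  proof -
    have "cinner ?z ?z = complex_of_real a" unfolding cinner_self a_def ..
    moreover have "cinner (A ?z) y = cinner ?z ?z" by (rule positive_op_selfadjoint[OF A pos])
    ultimately show ?thesis
      by (simp add: bop_simps[OF A] cinner_simps zero c_def algebra_simps)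
  qed
  moreover have "0 \<le> Re (cinner (A (y + of_real t *\<^sub>C ?z)) (y + of_real t *\<^sub>C ?z))"
    using pos by (simp add: positive_op_def)
  moreover have "t * c = - a - t" using c by (simp add: t_def field_simps)
  then have "t * t * c = t * (- a - t)" by (simp only: mult.assoc)
  then have "2 * t * a + t * t * c = t * a - t * t" by (simp add: algebra_simps)
  moreover have "t * a \<le> 0" using a c by (simp add: t_def)
  ultimately have "t * t \<le> 0" by linarith
  then have "t = 0" by (auto simp: mult_le_0_iff)
  then have "a = 0" using c by (simp add: t_def)
  then show ?thesis by (simp add: a_def)
qed

text \<open>With \<open>Y = 1 - R\<close>, the equation \<open>R\<^sup>2 = 1 - B\<close> reads \<open>Y = (B + Y\<^sup>2) / 2\<close>; the
  iterates of this fixed point equation, started at \<open>0\<close>, are the following.\<close>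

primrec sqrt_iter :: "('a::complex_hilbert \<Rightarrow> 'a) \<Rightarrow> nat \<Rightarrow> 'a \<Rightarrow> 'a" where
  "sqrt_iter B 0 = (\<lambda>x. 0)"
| "sqrt_iter B (Suc n) = (\<lambda>x. (1/2) *\<^sub>R (B x + sqrt_iter B n (sqrt_iter B n x)))"

primrec sqrt_bound :: "nat \<Rightarrow> real" where
  "sqrt_bound 0 = 0"
| "sqrt_bound (Suc n) = (1/2) * (1 + sqrt_bound n * sqrt_bound n)"

lemma sqrt_bound_range: "0 \<le> sqrt_bound n \<and> sqrt_bound n \<le> 1"
proof (induction n)
  case (Suc n)
  then have "sqrt_bound n * sqrt_bound n \<le> 1" by (simp add: mult_le_one)
  then show ?case by simp
qed simp

lemma sqrt_bound_mono: "sqrt_bound n \<le> sqrt_bound (Suc n)"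
proof -
  have "0 \<le> (1 - sqrt_bound n) * (1 - sqrt_bound n)" by simp
  then show ?thesis by (simp add: algebra_simps)
qed

text \<open>The scalar recursion, which is the case \<open>B = 1\<close>, dominates the increments of the operator
  recursion, so monotone convergence of the scalars gives convergence in norm of the operators.\<close>

lemma contraction_square_root:
  fixes B :: "'a::complex_hilbert \<Rightarrow> 'a"
  assumes B: "bop B" and le: "\<And>x. norm (B x) \<le> norm x"
    and sa: "\<And>x y. cinner (B x) y = cinner x (B y)"
  obtains R where "bop R" "positive_op R" "R \<circ> R = (\<lambda>x. x - B x)"
    "\<And>C x. bop C \<Longrightarrow> (\<And>x. C (B x) = B (C x)) \<Longrightarrow> C (R x) = R (C x)"
proof -
  let ?Y = "sqrt_iter B" and ?y = sqrt_bound
  have add: "?Y n (x + y) = ?Y n x + ?Y n y" for n x y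
    by (induction n arbitrary: x y) (simp_all add: bop_simps[OF B] algebra_simps)
  have scale: "?Y n (c *\<^sub>C x) = c *\<^sub>C ?Y n x" for n c x
  proof (induction n arbitrary: x)
    case (Suc n)
    then show ?case
      by (simp add: bop_simps[OF B] scaleR_scaleC complex_vector.scale_right_distrib mult.commute)
  qed simp
  have norm: "norm (?Y n x) \<le> ?y n * norm x" for n x
  proof (induction n arbitrary: x)
    case (Suc n)
    have "norm (?Y n (?Y n x)) \<le> ?y n * (?y n * norm x)"
      by (rule order_trans[OF Suc mult_left_mono[OF Suc]]) (use sqrt_bound_range in auto)
    then have "norm (B x + ?Y n (?Y n x)) \<le> norm x + ?y n * (?y n * norm x)"
      using norm_triangle_ineq[of "B x" "?Y n (?Y n x)"] le[of x] by linarith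
    then show ?case
      unfolding sqrt_iter.simps sqrt_bound.simps norm_scaleR by (simp add: algebra_simps)
  qed simp
  have bopY: "bop (?Y n)" for n
    by (rule bounded_clinear_onI[where B = "?y n"]) (auto simp: add scale norm)
  have saY: "cinner (?Y n x) y = cinner x (?Y n y)" for n x y
    by (induction n arbitrary: x y) (simp_all add: scaleR_scaleC cinner_simps sa)
  have step: "norm (?Y (Suc n) x - ?Y n x) \<le> (?y (Suc n) - ?y n) * norm x" for n x
  proof (induction n arbitrary: x)
    case 0
    then show ?case using le[of x] by simp
  next
    case (Suc n)
    let ?A = "?Y (Suc n)" and ?C = "?Y n" and ?a = "?y (Suc n)" and ?c = "?y n"
    have eq: "?Y (Suc (Suc n)) x - ?A x = (1/2) *\<^sub>R (?A (?A x) - ?C (?C x))"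
      unfolding sqrt_iter.simps(2)[of B "Suc n"] sqrt_iter.simps(2)[of B n, THEN fun_cong, of x]
      by (simp add: algebra_simps del: sqrt_iter.simps)
    have "norm (?A (?A x) - ?C (?C x)) = norm (?A (?A x - ?C x) + (?A (?C x) - ?C (?C x)))"
      by (simp add: bop_simps[OF bopY] del: sqrt_iter.simps)
    also have "\<dots> \<le> norm (?A (?A x - ?C x)) + norm (?A (?C x) - ?C (?C x))"
      by (rule norm_triangle_ineq)
    also have "\<dots> \<le> ?a * ((?a - ?c) * norm x) + (?a - ?c) * (?c * norm x)"
    proof (rule add_mono)
      show "norm (?A (?A x - ?C x)) \<le> ?a * ((?a - ?c) * norm x)"
        by (rule order_trans[OF norm mult_left_mono[OF Suc]]) (use sqrt_bound_range in blast)
      show "norm (?A (?C x) - ?C (?C x)) \<le> (?a - ?c) * (?c * norm x)"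
        by (rule order_trans[OF Suc mult_left_mono[OF norm]])
          (use sqrt_bound_mono in \<open>simp del: sqrt_bound.simps\<close>)
    qed
    also have "\<dots> = (?a * ?a - ?c * ?c) * norm x" by (simp only: algebra_simps)
    also have "\<dots> = 2 * ((?y (Suc (Suc n)) - ?a) * norm x)"
      unfolding sqrt_bound.simps(2)[of "Suc n"] sqrt_bound.simps(2)[of n]
      by (simp add: algebra_simps)
    finally show ?case unfolding eq by simp
  qed
  have "\<exists>l. (\<lambda>n. ?Y n x) \<longlonglongrightarrow> l" for x
  proof -
    have "convergent ?y"
    proof (rule Bseq_mono_convergent)
      show "Bseq ?y" by (rule BseqI'[of _ 1]) (use sqrt_bound_range in auto)
      show "\<forall>m. \<forall>n\<ge>m. ?y m \<le> ?y n" using lift_Suc_mono_le[of ?y] sqrt_bound_mono by blast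
    qed
    then obtain c where "?y \<longlonglongrightarrow> c" by (auto simp: convergent_def)
    then have "summable (\<lambda>n. (?y (Suc n) - ?y n) * norm x)"
      by (intro summable_mult2 telescope_summable)
    then have "summable (\<lambda>n. ?Y (Suc n) x - ?Y n x)"
      by (rule summable_comparison_test'[where N = 0]) (rule step)
    from summable_LIMSEQ[OF this] show ?thesis
      unfolding sum_lessThan_telescope[of "\<lambda>n. ?Y n x"] by auto
  qed
  then obtain Y where lim: "\<And>x. (\<lambda>n. ?Y n x) \<longlonglongrightarrow> Y x" by metis
  have Yle: "norm (Y x) \<le> norm x" for x
  proof (rule LIMSEQ_le_const2[OF tendsto_norm[OF lim]])
    have "norm (?Y n x) \<le> norm x" for n
      using norm[of n x] mult_right_mono[of "?y n" 1 "norm x"] sqrt_bound_range[of n] by simp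
    then show "\<exists>N. \<forall>n\<ge>N. norm (?Y n x) \<le> norm x" by blast
  qed
  have Yadd: "Y (x + y) = Y x + Y y" for x y
    using LIMSEQ_unique[OF lim[of "x + y"]] tendsto_add[OF lim[of x] lim[of y]] by (simp add: add)
  have Yscale: "Y (c *\<^sub>C x) = c *\<^sub>C Y x" for c x
    using LIMSEQ_unique[OF lim[of "c *\<^sub>C x"]]
      bounded_linear.tendsto[OF bounded_linear_scaleC lim[of x], of c]
    by (simp add: scale)
  have bY: "bop Y" by (rule bounded_clinear_onI[where B = 1]) (auto simp: Yadd Yscale Yle)
  have Ysa: "cinner (Y x) y = cinner x (Y y)" for x y
    using LIMSEQ_unique[OF bounded_linear.tendsto[OF bounded_linear_cinner_left lim[of x], of y]]
      bounded_linear.tendsto[OF bounded_linear_cinner_right lim[of y], of x]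
    by (simp add: saY)
  have Ycomm: "C (Y x) = Y (C x)" if C: "bop C" and CB: "\<And>x. C (B x) = B (C x)" for C x
  proof -
    have "C (?Y n x) = ?Y n (C x)" for n x
      by (induction n arbitrary: x) (simp_all add: scaleR_scaleC bop_simps[OF C] CB)
    then show ?thesis
      using LIMSEQ_unique[OF lim[of "C x"]]
        bounded_linear.tendsto[OF bop_bounded_linear[OF C] lim[of x]]
      by simp
  qed
  have YY: "Y (Y x) = 2 *\<^sub>R Y x - B x" for x
  proof -
    have "(\<lambda>n. ?Y n (?Y n x)) \<longlonglongrightarrow> Y (Y x)"
    proof -
      have "(\<lambda>n. ?Y n (?Y n x - Y x)) \<longlonglongrightarrow> 0"
      proof (rule tendsto_0_le[where f = "\<lambda>n. ?Y n x - Y x" and K = 1])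
        show "(\<lambda>n. ?Y n x - Y x) \<longlonglongrightarrow> 0" using lim by (simp add: LIM_zero_iff)
        show "\<forall>\<^sub>F n in sequentially. norm (?Y n (?Y n x - Y x)) \<le> norm (?Y n x - Y x) * 1"
        proof (intro always_eventually allI)
          fix n
          show "norm (?Y n (?Y n x - Y x)) \<le> norm (?Y n x - Y x) * 1"
            using norm[of n "?Y n x - Y x"] sqrt_bound_range[of n]
              mult_right_mono[of "?y n" 1 "norm (?Y n x - Y x)"] by simp
        qed
      qed
      from tendsto_add[OF this lim[of "Y x"]] show ?thesis
        by (simp add: bop_simps[OF bopY])
    qed
    moreover have "?Y n (?Y n x) = 2 *\<^sub>R ?Y (Suc n) x - B x" for n by simp
    moreover have "(\<lambda>n. 2 *\<^sub>R ?Y (Suc n) x - B x) \<longlonglongrightarrow> 2 *\<^sub>R Y x - B x"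
      by (intro tendsto_intros LIMSEQ_Suc lim)
    ultimately show ?thesis using LIMSEQ_unique by (metis (no_types, lifting) ext)
  qed
  show ?thesis
  proof (rule that)
    show "bop (\<lambda>x. x - Y x)" by (rule bop_diff[OF bop_id bY])
    show "positive_op (\<lambda>x. x - Y x)"
      unfolding positive_op_def
    proof (intro allI conjI)
      fix x
      have "cinner (Y x) x = cnj (cinner (Y x) x)" by (metis Ysa cinner_commute)
      then have "Im (cinner (Y x) x) = 0" by (simp add: complex_eq_iff)
      then show "Im (cinner (x - Y x) x) = 0" by (simp add: cinner_diff_left cinner_self)
      have "Re (cinner (Y x) x) \<le> norm (Y x) * norm x"
        using complex_Re_le_cmod cinner_cauchy_schwarz order_trans by blast
      also have "\<dots> \<le> norm x * norm x" using Yle by (simp add: mult_right_mono)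
      finally show "0 \<le> Re (cinner (x - Y x) x)"
        by (simp add: cinner_diff_left cinner_self power2_eq_square)
    qed
    show "(\<lambda>x. x - Y x) \<circ> (\<lambda>x. x - Y x) = (\<lambda>x. x - B x)"
      by (rule ext) (simp add: bop_simps[OF bY] YY scaleR_2)
    show "C (x - Y x) = C x - Y (C x)"
      if "bop C" "\<And>x. C (B x) = B (C x)" for C x
      using Ycomm[OF that, of x] bop_simps(2)[OF that(1)] by simp
  qed
qed

text \<open>Uniqueness of the positive square root uses that any other root \<open>Q\<close> commutes with
  \<open>B = 1 - Q\<^sup>2\<close>, hence with the root constructed above.\<close>

lemma op_sqrt_spec:
  fixes B :: "'a::complex_hilbert \<Rightarrow> 'a"
  assumes B: "bop B" and le: "\<And>x. norm (B x) \<le> norm x"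
    and sa: "\<And>x y. cinner (B x) y = cinner x (B y)"
  defines "D \<equiv> op_sqrt (\<lambda>x. x - B x)"
  shows "bop D" "positive_op D" "D (D x) = x - B x"
proof -
  obtain R where R: "bop R" "positive_op R" and RR: "R \<circ> R = (\<lambda>x. x - B x)"
    and comm: "\<And>C x. bop C \<Longrightarrow> (\<And>x. C (B x) = B (C x)) \<Longrightarrow> C (R x) = R (C x)"
    by (rule contraction_square_root[OF B le sa]) blast
  have "D = R"
    unfolding D_def op_sqrt_def
  proof (rule the_equality)
    show "bop R \<and> positive_op R \<and> R \<circ> R = (\<lambda>x. x - B x)" using R RR by blast
  next
    fix Q assume Q: "bop Q \<and> positive_op Q \<and> Q \<circ> Q = (\<lambda>x. x - B x)"
    then have Qb: "bop Q" and Qp: "positive_op Q" and QQ: "\<And>x. Q (Q x) = x - B x"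
      by (auto simp: fun_eq_iff)
    have RRx: "R (R x) = x - B x" for x using RR by (auto simp: fun_eq_iff)
    have Beq: "B x = x - Q (Q x)" for x by (simp add: QQ)
    have "Q (B x) = B (Q x)" for x unfolding Beq by (simp add: bop_simps[OF Qb])
    then have QR: "Q (R x) = R (Q x)" for x by (rule comm[OF Qb])
    \<comment> \<open>As \<open>(R + Q) (R - Q) = 0\<close>, both positive operators annihilate the range of \<open>R - Q\<close>.\<close>
    show "Q = R"
    proof
      fix x
      define y where "y = R x - Q x"
      have "R y + Q y = 0"
        by (simp add: y_def bop_simps[OF R(1)] bop_simps[OF Qb] RRx QQ QR)
      then have "cinner (R y) y + cinner (Q y) y = 0" by (metis cinner_add_left cinner_zero_left)
      moreover have "0 \<le> Re (cinner (R y) y)" "0 \<le> Re (cinner (Q y) y)"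
        "Im (cinner (R y) y) = 0" "Im (cinner (Q y) y) = 0"
        using R Qp by (auto simp: positive_op_def)
      ultimately have "cinner (R y) y = 0" "cinner (Q y) y = 0"
        by (auto simp: complex_eq_iff)
      then have "R y = 0" "Q y = 0"
        using positive_op_kernel R Qb Qp by blast+
      have "cinner y y = cinner (R x) y - cinner (Q x) y" by (simp add: y_def cinner_diff_left)
      also have "\<dots> = cinner x (R y - Q y)"
        by (simp add: positive_op_selfadjoint[OF R] positive_op_selfadjoint[OF Qb Qp]
            cinner_diff_right)
      finally have "cinner y y = cinner x (R y - Q y)" .
      then have "y = 0" using \<open>R y = 0\<close> \<open>Q y = 0\<close> by simp
      then show "Q x = R x" by (simp add: y_def)
    qed
  qed
  then show "bop D" "positive_op D" "D (D x) = x - B x"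
    using R fun_cong[OF RR, of x] by simp_all
qed

definition defect_sq :: "('a::complex_hilbert \<Rightarrow> 'a) \<Rightarrow> 'a \<Rightarrow> 'a"
  where "defect_sq T x = x - cadjoint T (T x)"

lemma contraction_bop: "contraction T \<Longrightarrow> bop T"
  and contraction_le: "contraction T \<Longrightarrow> norm (T x) \<le> norm x"
  by (auto simp: contraction_def)

lemma bop_cadjoint: "contraction T \<Longrightarrow> bop (cadjoint T)"
  by (simp add: cadjoint_contraction contraction_bop)

lemma contraction_pow_le: "contraction T \<Longrightarrow> norm ((T ^^ k) x) \<le> norm x"
  by (induction k) (auto intro: order_trans[OF contraction_le])

lemma
  assumes "contraction T"
  shows bop_defect_sq: "bop (defect_sq T)"
    and defect_sq_selfadjoint: "cinner (defect_sq T x) y = cinner x (defect_sq T y)"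
proof -
  note T = contraction_bop[OF assms]
  have "bop (\<lambda>x. x - cadjoint T (T x))"
    by (intro bop_diff bop_id bounded_clinear_on_comp[OF T bop_cadjoint[OF assms]])
  then show "bop (defect_sq T)" by (simp add: defect_sq_def[abs_def])
  show "cinner (defect_sq T x) y = cinner x (defect_sq T y)"
    by (simp add: defect_sq_def cinner_simps cinner_cadjoint[OF T] cinner_cadjoint'[OF T])
qed

lemma
  assumes T: "contraction T"
  shows bop_defect_op: "bop (defect_op T)"
    and defect_op_selfadjoint: "cinner (defect_op T x) y = cinner x (defect_op T y)"
    and defect_op_square: "defect_op T (defect_op T x) = defect_sq T x"
    and defect_op_eq_0: "defect_op T x = 0 \<longleftrightarrow> defect_sq T x = 0"
proof -
  note Tb = contraction_bop[OF T]
  let ?B = "\<lambda>x. cadjoint T (T x)"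
  have B: "bop ?B" by (rule bounded_clinear_on_comp[OF Tb bop_cadjoint[OF T]])
  have le: "norm (?B x) \<le> norm x" for x
    using contraction_le[OF T, of x] contraction_le[OF cadjoint_contraction[OF T], of "T x"]
    by linarith
  have sa: "cinner (?B x) y = cinner x (?B y)" for x y
    by (simp add: cinner_cadjoint[OF Tb] cinner_cadjoint'[OF Tb])
  note spec = op_sqrt_spec[OF B le sa, folded defect_op_def]
  show 1: "bop (defect_op T)" by (rule spec)
  show 2: "cinner (defect_op T x) y = cinner x (defect_op T y)" for x y
    by (rule positive_op_selfadjoint[OF spec(1,2)])
  show 3: "defect_op T (defect_op T x) = defect_sq T x" for x
    unfolding defect_sq_def by (rule spec)
  have "cinner (defect_op T x) (defect_op T x) = cinner x (defect_sq T x)"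
    by (simp add: 2 3)
  then show "defect_op T x = 0 \<longleftrightarrow> defect_sq T x = 0"
    using 3[of x] bop_simps(4)[OF 1] by (metis cinner_self_eq_0 cinner_zero_right)
qed

lemma defect_op_star_eq:
  "contraction T \<Longrightarrow> defect_op_star T = defect_op (cadjoint T)"
  by (simp add: defect_op_star_def defect_op_def cadjoint_cadjoint contraction_bop)

lemma defect_space_star_eq:
  "contraction T \<Longrightarrow> defect_space_star T = defect_space (cadjoint T)"
  by (simp add: defect_space_star_def defect_space_def defect_op_star_eq)

lemma closed_csubspace_defect_space:
  assumes "contraction T"
  shows "closed_csubspace (defect_space T)"
  unfolding defect_space_def
proof (rule closed_csubspace_closure)
  note D = bop_simps[OF bop_defect_op[OF assms]]
  show "csubspace (range (defect_op T))"
    unfolding complex_vector.subspace_def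
  proof (intro conjI ballI allI)
    show "0 \<in> range (defect_op T)" using D(4) by (metis rangeI)
    fix x y c assume "x \<in> range (defect_op T)"
    then obtain u where u: "x = defect_op T u" by blast
    show "c *\<^sub>C x \<in> range (defect_op T)" unfolding u D(3)[symmetric] by (rule rangeI)
    assume "y \<in> range (defect_op T)"
    then obtain v where v: "y = defect_op T v" by blast
    show "x + y \<in> range (defect_op T)" unfolding u v D(1)[symmetric] by (rule rangeI)
  qed
qed

text \<open>The reason is that \<open>(norm (T\<^sup>*T x - x))\<^sup>2 \<le> (norm x)\<^sup>2 - (norm (T x))\<^sup>2\<close> for a contraction.  So being
  isometric is a linear condition, and isometric parts are subspaces.\<close>

lemma defect_sq_eq_0_iff:
  assumes T: "contraction T"
  shows "defect_sq T x = 0 \<longleftrightarrow> norm (T x) = norm x"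
proof -
  note Tb = contraction_bop[OF T]
  have sq: "cinner (cadjoint T (T x)) x = of_real ((norm (T x))\<^sup>2)"
    by (simp add: cinner_cadjoint'[OF Tb] cinner_self)
  show ?thesis
  proof
    assume "defect_sq T x = 0"
    then have "cadjoint T (T x) = x" by (simp add: defect_sq_def)
    with sq have "cinner x x = of_real ((norm (T x))\<^sup>2)" by (simp only:)
    then have "(norm x)\<^sup>2 = (norm (T x))\<^sup>2"
      unfolding cinner_self by (simp only: of_real_eq_iff)
    then show "norm (T x) = norm x" by (simp add: power2_eq_iff_nonneg)
  next
    assume eq: "norm (T x) = norm x"
    have "Re (cinner (cadjoint T (T x)) x) = (norm x)\<^sup>2"
      unfolding sq eq by (rule Re_complex_of_real)
    then have "cadjoint T (T x) \<bullet> x = (norm x)\<^sup>2" unfolding Re_cinner .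
    with dot_norm_neg[of "cadjoint T (T x)" x]
    have "(norm (cadjoint T (T x) - x))\<^sup>2 = (norm (cadjoint T (T x)))\<^sup>2 - (norm x)\<^sup>2"
      by argo
    also have "\<dots> \<le> 0"
    proof -
      have "norm (cadjoint T (T x)) \<le> norm x"
        using contraction_le[OF cadjoint_contraction[OF T], of "T x"] unfolding eq .
      from power_mono[OF this norm_ge_zero, of 2] show ?thesis by (rule diff_le_0_iff_le[THEN iffD2])
    qed
    finally have "(norm (cadjoint T (T x) - x))\<^sup>2 \<le> 0" .
    then show "defect_sq T x = 0" by (simp add: defect_sq_def)
  qed
qed


section \<open>Polynomial characteristic functions\<close>

text \<open>The coefficient of \<open>z\<^sup>m\<^sup>+\<^sup>1\<close> in the characteristic function is, on \<open>defect_space T\<close>, the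
  operator \<open>D\<^sub>* T\<^sup>*\<^sup>m D\<close>.  Multiplying its adjoint by a defect operator on both sides removes the
  square roots without changing whether it vanishes.\<close>

definition defect_chain :: "('a::complex_hilbert \<Rightarrow> 'a) \<Rightarrow> nat \<Rightarrow> 'a \<Rightarrow> 'a"
  where "defect_chain T m x = defect_sq T ((T ^^ m) (defect_sq (cadjoint T) x))"

definition defect_degree :: "('a::complex_hilbert \<Rightarrow> 'a) \<Rightarrow> nat \<Rightarrow> bool"
  where "defect_degree T n \<longleftrightarrow>
    (\<forall>m\<ge>n. \<forall>x. defect_chain T m x = 0) \<and> (n = 0 \<or> (\<exists>x. defect_chain T (n - 1) x \<noteq> 0))"

lemma cinner_pow_cadjoint:
  "contraction T \<Longrightarrow> cinner ((T ^^ k) x) y = cinner x ((cadjoint T ^^ k) y)"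
  by (rule cinner_pow_adjoint) (simp add: cinner_cadjoint contraction_bop)

lemma defect_chain_adjoint:
  assumes T: "contraction T"
  shows "cinner (defect_chain T m x) y = cinner x (defect_chain (cadjoint T) m y)"
  using cadjoint_contraction[OF T]
  by (simp add: defect_chain_def defect_sq_selfadjoint T cinner_pow_cadjoint
      cadjoint_cadjoint contraction_bop)

lemma zero_iff_adjoint_zero:
  assumes "\<And>x y. cinner (A x) y = cinner x (B y)"
  shows "(\<forall>x. A x = 0) \<longleftrightarrow> (\<forall>y. B y = 0)"
  by (metis assms cinner_self_eq_0 cinner_zero_left cinner_zero_right)

lemma defect_degree_cadjoint:
  assumes T: "contraction T"
  shows "defect_degree (cadjoint T) n \<longleftrightarrow> defect_degree T n"
  using zero_iff_adjoint_zero[OF defect_chain_adjoint[OF T]] unfolding defect_degree_def by blast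

text \<open>After division by \<open>z\<^sup>k\<close>, the first coefficient that is not yet known to vanish is the limit of
  the series at \<open>0\<close>.\<close>

lemma power_series_zero_coeffs:
  fixes c :: "nat \<Rightarrow> complex"
  assumes "\<And>z. norm z < 1 \<Longrightarrow> (\<lambda>k. c k * z ^ k) sums 0"
  shows "c k = 0"
proof (induction k rule: less_induct)
  case (less k)
  have sums: "(\<lambda>j. c (j + k) * z ^ j) sums 0" if z: "z \<noteq> 0" "norm z < 1" for z
  proof -
    have "(\<lambda>j. c (j + k) * z ^ (j + k)) sums 0"
      using assms[OF z(2)] less by (subst sums_zero_iff_shift) auto
    from sums_mult[OF this, of "1 / z ^ k"] show ?thesis
      using z by (simp add: power_add field_simps)
  qed
  have "((\<lambda>z::complex. 0::complex) \<longlongrightarrow> c (0 + k)) (at 0)"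
    by (rule powser_limit_0_strong[of 1 "\<lambda>j. c (j + k)"]) (simp_all add: sums)
  then show "c k = 0" by (simp add: tendsto_const_iff)
qed

text \<open>The inverse in the characteristic function is given by the Neumann series.\<close>

lemma resolvent_sums:
  assumes S: "contraction S" and z: "norm z < 1"
  shows "(\<lambda>k. z ^ k *\<^sub>C (S ^^ k) w) sums (inv (\<lambda>x. x - z *\<^sub>C S x) w)"
proof -
  note Sb = contraction_bop[OF S]
  let ?f = "\<lambda>x. x - z *\<^sub>C S x" and ?g = "\<lambda>k. z ^ k *\<^sub>C (S ^^ k) w"
  have "norm (?g k) \<le> norm z ^ k * norm w" for k
    unfolding norm_scaleC norm_power by (intro mult_left_mono contraction_pow_le[OF S]) simp
  moreover have "summable (\<lambda>k. norm z ^ k * norm w)"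
    using z by (intro summable_mult2 summable_geometric) simp
  ultimately have sm: "summable ?g" by (rule summable_comparison_test'[where N = 0, rotated])
  have "z *\<^sub>C S (suminf ?g) = (\<Sum>k. z *\<^sub>C S (?g k))"
    using bounded_linear.suminf[OF bounded_linear_compose[OF bounded_linear_scaleC[of z]
          bop_bounded_linear[OF Sb]] sm] .
  also have "\<dots> = (\<Sum>k. ?g (Suc k))"
    by (simp add: bop_simps[OF Sb] complex_vector.scale_scale)
  also have "\<dots> = suminf ?g - w" using suminf_split_head[OF sm] by simp
  finally have fw: "?f (suminf ?g) = w" by simp
  have "inj ?f"
  proof (rule injI)
    fix x y assume "?f x = ?f y"
    then have "x - y = z *\<^sub>C S (x - y)"
      by (simp add: bop_simps[OF Sb] complex_vector.scale_right_diff_distrib algebra_simps)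
    then have "norm (x - y) = norm z * norm (S (x - y))" by (metis norm_scaleC)
    also have "\<dots> \<le> norm z * norm (x - y)"
      by (rule mult_left_mono[OF contraction_le[OF S] norm_ge_zero])
    finally have "norm (x - y) \<le> norm z * norm (x - y)" .
    then have "(1 - norm z) * norm (x - y) \<le> 0" by (simp add: left_diff_distrib)
    then show "x = y" using z by (simp add: mult_le_0_iff)
  qed
  from inv_f_eq[OF this fw] show ?thesis using sm by (simp add: summable_sums)
qed

text \<open>Paired with a fixed vector, the Neumann series turns the characteristic function into a scalar
  power series on the unit disc, whose coefficients are unique.\<close>

lemma char_fun_degree_coefficients:
  assumes T: "contraction T" and deg: "char_fun_degree T n"
  defines "a \<equiv> \<lambda>m x. defect_op (cadjoint T) ((cadjoint T ^^ m) (defect_op T x))"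
  shows "n \<le> m \<Longrightarrow> a m x = 0" and "0 < n \<Longrightarrow> \<exists>x. a (n - 1) x \<noteq> 0"
proof -
  note Tb = contraction_bop[OF T] and cT = cadjoint_contraction[OF T]
  let ?K = "defect_space T" and ?S = "cadjoint T"
  note D = bop_defect_op[OF T] and D' = bop_defect_op[OF cT]
  from deg obtain A where
    eq: "\<And>z h. z \<in> ball 0 1 \<Longrightarrow> h \<in> ?K \<Longrightarrow> char_fun T z h = (\<Sum>k\<le>n. z ^ k *\<^sub>C A k h)"
    and nz: "n = 0 \<or> (\<exists>h\<in>?K. A n h \<noteq> 0)"
    unfolding char_fun_degree_def op_polynomial_of_degree_def by blast
  have coeff: "a k h = (if Suc k \<le> n then A (Suc k) h else 0)" if h: "h \<in> ?K" for k h
  proof (rule cinner_ext)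
    fix y
    define c where "c k = (case k of 0 \<Rightarrow> - cinner (T h) y | Suc j \<Rightarrow> cinner (a j h) y)" for k
    define b where "b k = (if k \<le> n then cinner (A k h) y else 0)" for k
    have "(\<lambda>k. (c k - b k) * z ^ k) sums 0" if z: "norm z < 1" for z
    proof -
      let ?w = "inv (\<lambda>x. x - z *\<^sub>C ?S x) (defect_op T h)"
      have "bounded_linear (\<lambda>w. z * cinner (defect_op ?S w) y)"
        by (intro bounded_linear_mult_right[THEN bounded_linear_compose]
            bounded_linear_cinner_left[THEN bounded_linear_compose] bop_bounded_linear D')
      from bounded_linear.sums[OF this resolvent_sums[OF cT z, of "defect_op T h"]]
      have "(\<lambda>k. c (Suc k) * z ^ Suc k) sums (z * cinner (defect_op ?S ?w) y)"
        by (simp add: c_def a_def bop_simps[OF D'] cinner_scaleC_left mult_ac)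
      from sums_Suc[OF this]
      have c: "(\<lambda>k. c k * z ^ k) sums (z * cinner (defect_op ?S ?w) y + c 0)" by simp
      have "z * cinner (defect_op ?S ?w) y + c 0 = cinner (char_fun T z h) y"
        using h by (simp add: char_fun_def c_def cinner_simps defect_op_star_eq[OF T])
      moreover have b: "(\<lambda>k. b k * z ^ k) sums (\<Sum>k\<le>n. b k * z ^ k)"
        by (rule sums_finite) (auto simp: b_def)
      moreover have "(\<Sum>k\<le>n. b k * z ^ k) = cinner (char_fun T z h) y"
        using z h by (simp add: eq cinner_sum_left cinner_scaleC_left b_def mult.commute)
      ultimately show ?thesis
        using sums_diff[OF c b]
        by (simp add: left_diff_distrib)
    qed
    then have "c (Suc k) - b (Suc k) = 0" by (rule power_series_zero_coeffs)
    then show "cinner (a k h) y = cinner (if Suc k \<le> n then A (Suc k) h else 0) y"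
      by (simp add: c_def b_def split: if_splits)
  qed
  show "a m x = 0" if "n \<le> m"
  proof -
    note K = closed_csubspace_defect_space[OF T]
    have "defect_op T (x - cproj ?K x) = 0"
    proof (rule cinner_ext)
      fix z
      have "defect_op T z \<in> ?K"
        unfolding defect_space_def by (rule closure_subset[THEN subsetD]) (rule rangeI)
      then show "cinner (defect_op T (x - cproj ?K x)) z = cinner 0 z"
        by (simp add: defect_op_selfadjoint[OF T] cproj_orth[OF K])
    qed
    then have "a m x = a m (cproj ?K x)" by (simp add: a_def bop_simps[OF D])
    then show ?thesis using coeff[OF cproj_in[OF K]] that by simp
  qed
  show "\<exists>x. a (n - 1) x \<noteq> 0" if "0 < n"
  proof -
    from nz that obtain h where "h \<in> ?K" "A n h \<noteq> 0" by auto
    with coeff[of h "n - 1"] that have "a (n - 1) h \<noteq> 0" by simp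
    then show ?thesis by blast
  qed
qed

text \<open>A defect operator and its square have the same kernel.  This removes the square root on the left
  of a coefficient; the one on the right becomes the left one of the adjoint.\<close>

lemma char_fun_degree_imp_defect_degree:
  assumes T: "contraction T" and deg: "char_fun_degree T n"
  shows "defect_degree T n"
proof -
  note Tb = contraction_bop[OF T] and cT = cadjoint_contraction[OF T]
  let ?S = "cadjoint T"
  let ?a = "\<lambda>m x. defect_op ?S ((?S ^^ m) (defect_op T x))"
  let ?b = "\<lambda>m x. defect_op T ((T ^^ m) (defect_op ?S x))"
  note coeffs = char_fun_degree_coefficients[OF T deg]
  note D = bop_defect_op[OF T] and D' = bop_defect_op[OF cT]
  have chain: "defect_chain ?S m x = defect_op ?S (?a m (defect_op T x))" for m x
    by (simp add: defect_chain_def cadjoint_cadjoint[OF Tb] defect_op_square T cT)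
  have ab: "cinner (?a m x) y = cinner x (?b m y)" for m x y
    by (simp add: defect_op_selfadjoint T cT cinner_pow_cadjoint cadjoint_cadjoint[OF Tb])
  have "defect_chain ?S m x = 0" if "n \<le> m" for m x
    using coeffs(1)[OF that] by (simp add: chain bop_simps[OF D'])
  moreover have "\<exists>x. defect_chain ?S (n - 1) x \<noteq> 0" if "0 < n"
  proof (rule ccontr)
    assume "\<not> ?thesis"
    then have "defect_sq ?S ((?S ^^ (n - 1)) (defect_op T (defect_op T x))) = 0" for x
      by (simp add: defect_chain_def cadjoint_cadjoint[OF Tb] defect_op_square T)
    then have "\<forall>x. ?a (n - 1) (defect_op T x) = 0" by (simp add: defect_op_eq_0[OF cT])
    moreover have "cinner (?a (n - 1) (defect_op T x)) y
        = cinner x (defect_op T (?b (n - 1) y))" for x y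
      by (simp add: ab defect_op_selfadjoint[OF T])
    ultimately have "\<forall>y. defect_op T (?b (n - 1) y) = 0"
      using zero_iff_adjoint_zero[of "\<lambda>x. ?a (n - 1) (defect_op T x)"
          "\<lambda>y. defect_op T (?b (n - 1) y)"] by blast
    then have "\<forall>y. ?b (n - 1) y = 0"
      by (metis bop_simps(4)[OF D] defect_op_eq_0[OF T] defect_op_square[OF T])
    then have "\<forall>x. ?a (n - 1) x = 0" using zero_iff_adjoint_zero[OF ab] by blast
    then show False using coeffs(2)[OF that] by blast
  qed
  ultimately have "defect_degree ?S n" unfolding defect_degree_def by blast
  then show ?thesis by (simp add: defect_degree_cadjoint[OF T])
qed


section \<open>Shifts and triangular representations\<close>

lemma cadjoint_of_isometric:
  "contraction T \<Longrightarrow> norm (T x) = norm x \<Longrightarrow> cadjoint T (T x) = x"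
  using defect_sq_eq_0_iff[of T x] by (simp add: defect_sq_def)

lemma pow_in: "(\<And>x. x \<in> E \<Longrightarrow> T x \<in> E) \<Longrightarrow> x \<in> E \<Longrightarrow> (T ^^ k) x \<in> E"
  by (induction k) auto

lemma pow_cong:
  assumes "\<And>x. x \<in> E \<Longrightarrow> T x \<in> E" "\<And>x. x \<in> E \<Longrightarrow> S x = T x" "x \<in> E"
  shows "(S ^^ k) x = (T ^^ k) x"
  by (induction k) (auto simp: assms(2) pow_in[OF assms(1,3)])

text \<open>If \<open>T\<^sup>*\<close> is unitary on a reducing subspace, then \<open>T\<close> is its inverse there.\<close>

lemma completely_non_unitary_cadjoint:
  assumes T: "contraction T" and cnu: "completely_non_unitary T"
  shows "completely_non_unitary (cadjoint T)"
  unfolding completely_non_unitary_def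
proof
  note Tb = contraction_bop[OF T] and cT = cadjoint_contraction[OF T]
  assume "\<exists>M. closed_csubspace M \<and> M \<noteq> {0} \<and> cadjoint T ` M \<subseteq> M \<and>
    cadjoint (cadjoint T) ` M \<subseteq> M \<and> (\<forall>x\<in>M. norm (cadjoint T x) = norm x) \<and> cadjoint T ` M = M"
  then obtain M where M: "closed_csubspace M" "M \<noteq> {0}" "cadjoint T ` M \<subseteq> M" "T ` M \<subseteq> M"
    "\<forall>x\<in>M. norm (cadjoint T x) = norm x" "cadjoint T ` M = M"
    unfolding cadjoint_cadjoint[OF Tb] by blast
  have inv: "T (cadjoint T m) = m" if "m \<in> M" for m
    using cadjoint_of_isometric[OF cT] M(5) that by (simp add: cadjoint_cadjoint[OF Tb])
  have "norm (T x) = norm x" if "x \<in> M" for x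
  proof -
    have "x \<in> cadjoint T ` M" by (subst M(6)) (rule that)
    then obtain m where m: "m \<in> M" and x: "x = cadjoint T m" by (rule imageE)
    show ?thesis unfolding x inv[OF m] by (rule M(5)[rule_format, OF m, symmetric])
  qed
  moreover have "T ` M = M"
  proof (rule equalityI[OF M(4)], rule subsetI)
    fix x assume x: "x \<in> M"
    then have "cadjoint T x \<in> M" using M(3) by blast
    then show "x \<in> T ` M" using inv[OF x] by (intro image_eqI) simp_all
  qed
  ultimately show False using cnu M(1-4) unfolding completely_non_unitary_def by blast
qed

text \<open>The Wold decomposition: the part of \<open>E\<close> orthogonal to all \<open>T\<^sup>k (E \<ominus> T E)\<close> is mapped onto
  itself by \<open>T\<close>, hence reduces \<open>T\<close> to a unitary operator, hence is trivial.\<close>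

lemma isometric_restriction_is_shift:
  assumes T: "contraction T" and cnu: "completely_non_unitary T"
    and E: "closed_csubspace E" and inv: "\<And>x. x \<in> E \<Longrightarrow> T x \<in> E"
    and iso: "\<And>x. x \<in> E \<Longrightarrow> norm (T x) = norm x"
    and S: "\<And>x. x \<in> E \<Longrightarrow> S x = T x"
  shows "unilateral_shift E S"
proof -
  note Tb = contraction_bop[OF T]
  have adj: "cadjoint T (T x) = x" if "x \<in> E" for x
    using that by (simp add: cadjoint_of_isometric[OF T] iso)
  have ci: "cinner (T x) (T y) = cinner x y" if "y \<in> E" for x y
    by (simp add: cinner_cadjoint[OF Tb] adj that)
  have powE: "(T ^^ k) x \<in> E" if "x \<in> E" for k x using pow_in[OF inv that] .
  have Spow: "(S ^^ k) x = (T ^^ k) x" if "x \<in> E" for k x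
    using pow_cong[OF inv S that] .
  have TE: "closed_csubspace (T ` E)"
  proof -
    have "T ` E = {x. cadjoint T x \<in> E} \<inter> {x. T (cadjoint T x) = x}"
    proof (intro equalityI subsetI)
      fix x assume "x \<in> {x. cadjoint T x \<in> E} \<inter> {x. T (cadjoint T x) = x}"
      then show "x \<in> T ` E" by (intro image_eqI[of _ _ "cadjoint T x"]) auto
    qed (auto simp: adj)
    moreover have "closed_csubspace {x. T (cadjoint T x) = x}"
      by (intro closed_csubspace_eq bop_id bounded_clinear_on_comp[OF bop_cadjoint[OF T] Tb])
    ultimately show ?thesis
      using closed_csubspace_Int closed_csubspace_vimage[OF bop_cadjoint[OF T] E] by metis
  qed
  define W where "W = E \<ominus> (T ` E)"
  have W: "closed_csubspace W" unfolding W_def by (rule closed_csubspace_orth_minus[OF E])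
  have WE: "W \<subseteq> E" by (auto simp: W_def orth_minus_def)
  have WT: "cinner w (T x) = 0" if "w \<in> W" "x \<in> E" for w x
    using that by (auto simp: W_def orth_minus_def)
  have shift: "cinner ((T ^^ j) x) ((T ^^ (j + i)) y) = cinner x ((T ^^ i) y)"
    if "y \<in> E" for i j x y
    by (induction j) (simp_all add: ci powE that)
  have orth: "cinner ((T ^^ j) x) ((T ^^ k) y) = 0" if "j < k" "x \<in> W" "y \<in> W" for j k x y
  proof -
    obtain i where k: "k = j + Suc i" using less_imp_Suc_add[OF \<open>j < k\<close>] by auto
    have "cinner ((T ^^ j) x) ((T ^^ k) y) = cinner x ((T ^^ Suc i) y)"
      unfolding k using that WE by (intro shift) auto
    also have "\<dots> = 0" using that WE powE by (simp add: WT subset_iff)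
    finally show ?thesis .
  qed
  have orthS: "cinner ((S ^^ j) x) ((S ^^ k) y) = 0" if jk: "j \<noteq> k" and xy: "x \<in> W" "y \<in> W" for j k x y
  proof -
    have "cinner ((T ^^ j) x) ((T ^^ k) y) = 0"
      using orth[of j k x y] orth[of k j y x] jk xy by (auto simp: cinner_eq_0_commute[of "(T ^^ j) x"] neq_iff)
    moreover have "x \<in> E" "y \<in> E" using xy WE by blast+
    ultimately show ?thesis by (simp only: Spow)
  qed
  let ?G = "\<Union>k. (S ^^ k) ` W"
  have G_eq: "?G = (\<Union>k. (T ^^ k) ` W)" using Spow WE by (auto simp: subset_iff)
  have "closed_cspan ?G = E"
  proof (rule eq_if_orth_minus_trivial[OF closed_csubspace_closed_cspan E])
    show sub: "closed_cspan ?G \<subseteq> E"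
      unfolding G_eq using powE WE by (intro closed_cspan_minimal E) auto
    define U where "U = E \<ominus> ?G"
    have U: "closed_csubspace U" unfolding U_def by (rule closed_csubspace_orth_minus[OF E])
    have UI: "x \<in> U" if "x \<in> E" "\<And>k w. w \<in> W \<Longrightarrow> cinner x ((T ^^ k) w) = 0" for x
      using that by (auto simp: U_def orth_minus_def G_eq)
    have UD: "x \<in> E" "w \<in> W \<Longrightarrow> cinner x ((T ^^ k) w) = 0" if "x \<in> U" for x k w
      using that by (auto simp: U_def orth_minus_def G_eq)
    have TU: "T x \<in> U" if x: "x \<in> U" for x
    proof (rule UI)
      show "T x \<in> E" using UD(1)[OF x] inv by blast
      fix k w assume w: "w \<in> W"
      show "cinner (T x) ((T ^^ k) w) = 0"
      proof (cases k)
        case 0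
        then show ?thesis using WT[OF w UD(1)[OF x]] by (simp add: cinner_eq_0_commute)
      next
        case (Suc j)
        then show ?thesis using UD(2)[OF x w, of j] w WE by (auto simp: ci powE)
      qed
    qed
    have UT: "x \<in> T ` U" if x: "x \<in> U" for x
    proof -
      have "x \<in> T ` E"
      proof (rule orthogonal_to_complement[OF TE])
        fix z assume z: "\<And>y. y \<in> T ` E \<Longrightarrow> cinner z y = 0"
        have "cproj E z \<in> W"
          unfolding W_def orth_minus_def using z inv cproj_in[OF E] cproj_cinner(1)[OF E] by auto
        from UD(2)[OF x this, of 0] have "cinner x (cproj E z) = 0" by simp
        then show "cinner x z = 0" using cproj_cinner(2)[OF E UD(1)[OF x]] by simp
      qed
      then obtain e where e: "e \<in> E" "x = T e" by blast
      have "e \<in> U"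
      proof (rule UI[OF e(1)])
        fix k w assume w: "w \<in> W"
        have "cinner e ((T ^^ k) w) = cinner (T e) (T ((T ^^ k) w))" using w WE powE by (auto simp: ci)
        also have "\<dots> = 0" using UD(2)[OF x w, of "Suc k"] e(2) by simp
        finally show "cinner e ((T ^^ k) w) = 0" .
      qed
      then show ?thesis using e by blast
    qed
    have TUU: "T ` U = U" using TU UT by blast
    moreover have "cadjoint T ` U \<subseteq> U"
    proof (rule image_subsetI)
      fix x assume "x \<in> U"
      then obtain u where u: "u \<in> U" "x = T u" using UT by blast
      have "cadjoint T x = u" unfolding u(2) by (rule adj[OF UD(1)[OF u(1)]])
      then show "cadjoint T x \<in> U" using u(1) by simp
    qed
    moreover have "\<forall>x\<in>U. norm (T x) = norm x" using UD(1) iso by blast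
    ultimately have "U = {0}" using cnu U unfolding completely_non_unitary_def by blast
    fix x assume x: "x \<in> E" "\<And>y. y \<in> closed_cspan ?G \<Longrightarrow> cinner x y = 0"
    have "x \<in> U"
      unfolding U_def orth_minus_def using x closed_cspan_superset[of ?G] by blast
    then show "x = 0" using \<open>U = {0}\<close> by blast
  qed
  moreover have "bounded_clinear_on E E S"
    by (rule bounded_clinear_on_cong[OF E bounded_clinear_on_subset[OF Tb subset_UNIV] S])
      (rule inv)
  ultimately show ?thesis
    unfolding unilateral_shift_def using iso S W WE orthS by auto
qed

lemma bounded_clinear_on_compression:
  assumes "bop T" "closed_csubspace K"
  shows "bounded_clinear_on K K (compression K T)"
proof (rule bounded_clinear_on_cong[OF assms(2)])
  have "bop (\<lambda>x. cproj K (T x))"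
    by (rule bounded_clinear_on_comp[OF assms(1) bop_cproj[OF assms(2)]])
  then show "bounded_clinear_on K K (\<lambda>x. cproj K (T x))"
    by (rule bounded_clinear_on_subset) (auto simp: cproj_in[OF assms(2)])
qed (simp add: block_def)

lemma cinner_compression:
  assumes T: "contraction T" and K: "closed_csubspace K" and xy: "x \<in> K" "y \<in> K"
  shows "cinner (compression K T x) y = cinner x (compression K (cadjoint T) y)"
  using xy by (simp add: block_def cproj_cinner[OF K] cinner_cadjoint contraction_bop[OF T])

lemma adjoint_on_compression:
  assumes T: "contraction T" and K: "closed_csubspace K" and y: "y \<in> K"
  shows "adjoint_on K (compression K T) y = compression K (cadjoint T) y"
proof (rule adjoint_on_eqI[OF K y])
  show "compression K (cadjoint T) y \<in> K" by (simp add: block_def y cproj_in[OF K])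
qed (rule cinner_compression[OF T K _ y])

text \<open>The intrinsic form of a triangular representation: an invariant subspace on which \<open>T\<close> is
  isometric, and a subspace invariant under \<open>T\<^sup>*\<close> on which \<open>T\<^sup>*\<close> is isometric.\<close>

definition shift_triangular ::
    "('a::complex_hilbert \<Rightarrow> 'a) \<Rightarrow> 'a set \<Rightarrow> 'a set \<Rightarrow> 'a set \<Rightarrow> bool"
  where "shift_triangular T H1 H2 H3 \<longleftrightarrow> orth_decomposition H1 H2 H3 \<and>
    (\<forall>x\<in>H1. T x \<in> H1 \<and> norm (T x) = norm x) \<and>
    (\<forall>x\<in>H3. cadjoint T x \<in> H3 \<and> norm (cadjoint T x) = norm x)"

lemma orth_decompositionD:
  assumes "orth_decomposition H1 H2 H3"
  shows "closed_csubspace H1" "closed_csubspace H2" "closed_csubspace H3"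
    "x \<in> H1 \<Longrightarrow> y \<in> H2 \<Longrightarrow> cinner x y = 0" "x \<in> H1 \<Longrightarrow> z \<in> H3 \<Longrightarrow> cinner x z = 0"
    "y \<in> H2 \<Longrightarrow> z \<in> H3 \<Longrightarrow> cinner y z = 0" "y \<in> H2 \<Longrightarrow> x \<in> H1 \<Longrightarrow> cinner y x = 0"
    "z \<in> H3 \<Longrightarrow> x \<in> H1 \<Longrightarrow> cinner z x = 0" "z \<in> H3 \<Longrightarrow> y \<in> H2 \<Longrightarrow> cinner z y = 0"
  using assms cinner_eq_0_commute unfolding orth_decomposition_def by blast+

lemma orth_decomposition_split:
  assumes "orth_decomposition H1 H2 H3"
  obtains a b c where "a \<in> H1" "b \<in> H2" "c \<in> H3" "x = a + b + c"
proof -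
  have "x \<in> H1 \<oplus> H2 \<oplus> H3" using assms by (simp add: orth_decomposition_def)
  then show thesis using that unfolding sum_space_def by blast
qed

lemma orth_decomposition_reverse:
  assumes "orth_decomposition H1 H2 H3"
  shows "orth_decomposition H3 H2 H1"
proof -
  have "x \<in> H3 \<oplus> H2 \<oplus> H1" for x
  proof -
    obtain a b c where "a \<in> H1" "b \<in> H2" "c \<in> H3" "x = a + b + c"
      by (rule orth_decomposition_split[OF assms])
    moreover from this have "x = (c + b) + a" by (simp add: ac_simps)
    ultimately show ?thesis unfolding sum_space_def by blast
  qed
  then show ?thesis
    using orth_decompositionD[OF assms] unfolding orth_decomposition_def by blast
qed

lemma shift_triangular_cadjoint:
  assumes "contraction T" "shift_triangular T H1 H2 H3"
  shows "shift_triangular (cadjoint T) H3 H2 H1"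
  using assms(2) orth_decomposition_reverse
  unfolding shift_triangular_def cadjoint_cadjoint[OF contraction_bop[OF assms(1)]] by blast

lemma unilateral_shift_isometric: "unilateral_shift K S \<Longrightarrow> x \<in> K \<Longrightarrow> norm (S x) = norm x"
  unfolding unilateral_shift_def by blast

text \<open>The diagonal entries on \<open>H1\<close> and of the adjoint on \<open>H3\<close> are isometric compressions of contractions,
  so these subspaces are invariant under \<open>T\<close> and \<open>T\<^sup>*\<close>.  Conversely, the entries are then shifts by the
  Wold decomposition, and complete non-unitarity excludes unitary summands.\<close>

lemma shift_nilpotent_rep_iff:
  assumes T: "contraction T" and cnu: "completely_non_unitary T"
  shows "shift_nilpotent_rep n T H1 H2 H3 \<longleftrightarrow>
    shift_triangular T H1 H2 H3 \<and> nilpotent_order H2 (compression H2 T) n"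
proof
  note Tb = contraction_bop[OF T] and cT = cadjoint_contraction[OF T]
  have into: "S x \<in> K \<and> norm (S x) = norm x"
    if S: "contraction S" and K: "closed_csubspace K" and eq: "norm (cproj K (S x)) = norm x"
    for S :: "'a \<Rightarrow> 'a" and K x
  proof -
    have "S x \<in> K" using contraction_le[OF S, of x] eq by (intro cproj_eq_self_if_norm[OF K]) simp
    then show ?thesis using eq cproj_id[OF K] by simp
  qed
  {
    assume rep: "shift_nilpotent_rep n T H1 H2 H3"
    then have dec: "orth_decomposition H1 H2 H3" by (simp add: shift_nilpotent_rep_def)
    note D = orth_decompositionD[OF dec]
    have iso1: "norm (compression H1 T x) = norm x" if "x \<in> H1" for x
      by (rule unilateral_shift_isometric[OF _ that])
        (use rep in \<open>simp only: shift_nilpotent_rep_def\<close>)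
    have "norm (cproj H1 (T x)) = norm x" if "x \<in> H1" for x
      using iso1[OF that] that by (simp only: block_def restrict_apply if_True)
    then have tri1: "\<forall>x\<in>H1. T x \<in> H1 \<and> norm (T x) = norm x"
      by (intro ballI into[OF T D(1)])
    have iso3: "norm (adjoint_on H3 (compression H3 T) x) = norm x" if "x \<in> H3" for x
      by (rule unilateral_shift_isometric[OF _ that])
        (use rep in \<open>simp only: shift_nilpotent_rep_def\<close>)
    have "norm (cproj H3 (cadjoint T x)) = norm x" if "x \<in> H3" for x
      using iso3[OF that] unfolding adjoint_on_compression[OF T D(3) that]
      by (simp only: block_def restrict_apply that if_True)
    then have "\<forall>x\<in>H3. cadjoint T x \<in> H3 \<and> norm (cadjoint T x) = norm x"
      by (intro ballI into[OF cT D(3)])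
    with tri1 show "shift_triangular T H1 H2 H3 \<and> nilpotent_order H2 (compression H2 T) n"
      using rep unfolding shift_triangular_def shift_nilpotent_rep_def by blast
  }
  {
    assume *: "shift_triangular T H1 H2 H3 \<and> nilpotent_order H2 (compression H2 T) n"
    then have dec: "orth_decomposition H1 H2 H3" by (simp add: shift_triangular_def)
    note D = orth_decompositionD[OF dec]
    have T1: "T x \<in> H1" "norm (T x) = norm x" if "x \<in> H1" for x
      using * that by (auto simp: shift_triangular_def)
    have T3: "cadjoint T x \<in> H3" "norm (cadjoint T x) = norm x" if "x \<in> H3" for x
      using * that by (auto simp: shift_triangular_def)
    have "\<forall>x\<in>H1. block H1 H2 T x = 0"
      using T1(1) D(4) by (auto simp: block_def intro!: cproj_eq_0[OF D(2)])
    moreover have "\<forall>x\<in>H1. block H1 H3 T x = 0"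
      using T1(1) D(5) by (auto simp: block_def intro!: cproj_eq_0[OF D(3)])
    moreover have "\<forall>x\<in>H2. block H2 H3 T x = 0"
      using T3(1) D(6) by (auto simp: block_def cinner_cadjoint[OF Tb] intro!: cproj_eq_0[OF D(3)])
    moreover have "unilateral_shift H1 (compression H1 T)"
      by (rule isometric_restriction_is_shift[OF T cnu D(1) T1])
        (auto simp: block_def cproj_id[OF D(1)] T1)
    moreover have "unilateral_shift H3 (adjoint_on H3 (compression H3 T))"
    proof (rule isometric_restriction_is_shift[OF cT completely_non_unitary_cadjoint[OF T cnu] D(3) T3])
      fix x assume x: "x \<in> H3"
      show "adjoint_on H3 (compression H3 T) x = cadjoint T x"
        unfolding adjoint_on_compression[OF T D(3) x] by (simp add: block_def x cproj_id[OF D(3)] T3)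
    qed
    ultimately show "shift_nilpotent_rep n T H1 H2 H3"
      using * dec unfolding shift_nilpotent_rep_def by blast
  }
qed


section \<open>Jordan systems of nilpotent operators\<close>

text \<open>A nilpotent operator \<open>N\<close> on a separable Hilbert space \<open>K\<close>, together with its adjoint \<open>M\<close>.
  Carrying the adjoint along makes the situation symmetric in \<open>N\<close> and \<open>M\<close>.\<close>

locale nilpotent_pair =
  fixes K :: "'a::complex_hilbert set" and N M :: "'a \<Rightarrow> 'a" and n :: nat
  assumes K: "closed_csubspace K"
    and N: "bounded_clinear_on K K N" and M: "bounded_clinear_on K K M"
    and adj: "\<And>x y. x \<in> K \<Longrightarrow> y \<in> K \<Longrightarrow> cinner (N x) y = cinner x (M y)"
    and nil: "\<And>x. x \<in> K \<Longrightarrow> (N ^^ n) x = 0"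
    and separable: "\<exists>D\<subseteq>K. countable D \<and> K \<subseteq> closure D"
begin

lemmas Kmem = closed_csubspaceD[OF K]

lemma K_sum: "(\<And>i. i \<in> I \<Longrightarrow> f i \<in> K) \<Longrightarrow> (\<Sum>i\<in>I. f i) \<in> K"
  using Kmem(1) by (auto intro: complex_vector.subspace_sum)

lemma NK: "x \<in> K \<Longrightarrow> (N ^^ k) x \<in> K"
  and MK: "x \<in> K \<Longrightarrow> (M ^^ k) x \<in> K"
  using bounded_clinear_onD(1)[OF N] bounded_clinear_onD(1)[OF M] by (auto intro: pow_in)

lemma N_pow: "bounded_clinear_on K K (N ^^ k)"
proof (induction k)
  case 0
  show ?case by (rule bounded_clinear_onI[where B = 1]) auto
next
  case (Suc k)
  then show ?case using bounded_clinear_on_comp[OF Suc N] by (simp add: comp_def)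
qed

lemma adj_pow: "x \<in> K \<Longrightarrow> y \<in> K \<Longrightarrow> cinner ((N ^^ k) x) y = cinner x ((M ^^ k) y)"
proof (induction k arbitrary: y)
  case (Suc k)
  have "cinner ((N ^^ Suc k) x) y = cinner ((N ^^ k) x) (M y)" using Suc.prems NK by (simp add: adj)
  also have "\<dots> = cinner x ((M ^^ k) (M y))"
    using Suc.prems bounded_clinear_onD(1)[OF M] by (intro Suc.IH) auto
  finally show ?case by (simp add: funpow_swap1)
qed simp

lemma N_pow_mono: "x \<in> K \<Longrightarrow> (N ^^ k) x = 0 \<Longrightarrow> k \<le> m \<Longrightarrow> (N ^^ m) x = 0"
  using bounded_clinear_on_0[OF N_pow K, of "m - k"] funpow_add[of "m - k" k N] by simp

lemma zero_in_K_if: "x \<in> K \<Longrightarrow> (\<And>y. y \<in> K \<Longrightarrow> cinner x y = 0) \<Longrightarrow> x = 0"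
  by (metis cinner_self_eq_0)

lemma adjoint_nil: "y \<in> K \<Longrightarrow> (M ^^ n) y = 0"
proof (rule zero_in_K_if)
  fix x assume "y \<in> K" "x \<in> K"
  then have "cinner x ((M ^^ n) y) = 0" using adj_pow[of x y n] nil by simp
  then show "cinner ((M ^^ n) y) x = 0" by (simp add: cinner_eq_0_commute)
qed (rule MK)

lemma adjoint_pair: "nilpotent_pair K M N n"
proof
  fix x y assume "x \<in> K" "y \<in> K"
  then show "cinner (M x) y = cinner x (N y)" by (metis adj cinner_commute)
qed (use K N M adjoint_nil separable in auto)

text \<open>Solving the triangular system by which a functional is prescribed on the cyclic subspace
  of \<open>v\<close>: one value after the other is corrected, from \<open>N\<^sup>d\<^sup>-\<^sup>1 v\<close> downwards.\<close>

lemma dual_vector: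
  assumes v: "v \<in> K" and d: "0 < d" "(N ^^ d) v = 0" "(N ^^ (d - 1)) v \<noteq> 0"
  shows "\<exists>z\<in>K. \<forall>i. cinner ((N ^^ i) v) z = (if Suc i = d then 1 else 0)"
proof -
  define e where "e = d - 1"
  have de: "d = Suc e" using d(1) by (simp add: e_def)
  have "\<exists>z\<in>K. cinner ((N ^^ e) v) z = 1 \<and> (\<forall>i. i < e \<and> e \<le> i + m \<longrightarrow> cinner ((N ^^ i) v) z = 0)"
    for m
  proof (induction m)
    case 0
    let ?w = "(N ^^ e) v"
    have "?w \<noteq> 0" using d(3) by (simp add: e_def)
    then have "cinner ?w ((1 / cnj (cinner ?w ?w)) *\<^sub>C ?w) = 1" by (simp add: cinner_scaleC_right)
    moreover have "(1 / cnj (cinner ?w ?w)) *\<^sub>C ?w \<in> K" using NK[OF v] Kmem(6) by blast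
    ultimately show ?case by auto
  next
    case (Suc m)
    then obtain z where z: "z \<in> K" "cinner ((N ^^ e) v) z = 1"
      "\<And>i. i < e \<Longrightarrow> e \<le> i + m \<Longrightarrow> cinner ((N ^^ i) v) z = 0" by blast
    show ?case
    proof (cases "m < e")
      case False
      then show ?thesis using z by (intro bexI[of _ z]) auto
    next
      case True
      define a where "a = cinner ((N ^^ (e - Suc m)) v) z"
      define z' where "z' = z - cnj a *\<^sub>C (M ^^ Suc m) z"
      have eq: "cinner ((N ^^ i) v) z' = cinner ((N ^^ i) v) z - a * cinner ((N ^^ (i + Suc m)) v) z" for i
      proof -
        have "cinner ((N ^^ i) v) ((M ^^ Suc m) z) = cinner ((N ^^ Suc m) ((N ^^ i) v)) z"
          by (rule adj_pow[OF NK[OF v] z(1), symmetric])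
        also have "(N ^^ Suc m) ((N ^^ i) v) = (N ^^ (i + Suc m)) v"
          by (subst add.commute) (simp only: funpow_add comp_def)
        finally show ?thesis by (simp only: z'_def cinner_diff_right cinner_scaleC_right complex_cnj_cnj)
      qed
      have beyond: "(N ^^ i) v = 0" if "e < i" for i
        by (rule N_pow_mono[OF v d(2)]) (use that de in simp)
      have "z' \<in> K" unfolding z'_def by (intro Kmem(5,6) MK z(1))
      moreover have "cinner ((N ^^ e) v) z' = 1" using z(2) by (simp add: eq beyond del: funpow.simps)
      moreover have "cinner ((N ^^ i) v) z' = 0" if "i < e" "e \<le> i + Suc m" for i
      proof (cases "i + Suc m = e")
        case True
        then have "i = e - Suc m" by simp
        then show ?thesis using True z(2) by (simp add: eq a_def del: funpow.simps)
      next
        case False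
        then have "e < i + Suc m" "e \<le> i + m" using that by auto
        then show ?thesis using z(3)[OF that(1)] by (simp add: eq beyond del: funpow.simps)
      qed
      ultimately show ?thesis by blast
    qed
  qed
  from this[of e] obtain z where z: "z \<in> K" "cinner ((N ^^ e) v) z = 1"
    "\<And>i. i < e \<Longrightarrow> cinner ((N ^^ i) v) z = 0" by auto
  have "cinner ((N ^^ i) v) z = (if Suc i = d then 1 else 0)" for i
  proof (cases "i < e")
    case False
    then show ?thesis using z(2) N_pow_mono[OF v d(2), of i] de by (cases "i = e") auto
  qed (use z(3) de in auto)
  then show ?thesis using z(1) by blast
qed

end

text \<open>Finitely many cyclic subspaces, spanned by \<open>N\<^sup>i v\<^sub>j\<close> for \<open>i < d\<^sub>j\<close>, with a biorthogonal
  family of cyclic subspaces of the adjoint.  The pairing is normalised at the last vector of each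
  chain, so \<open>M\<^sup>d\<^sup>-\<^sup>1\<^sup>-\<^sup>i y\<close> is dual to \<open>N\<^sup>i v\<close>.\<close>

definition biorthogonal_chains :: "'a::complex_hilbert set \<Rightarrow> ('a \<Rightarrow> 'a) \<Rightarrow> ('a \<Rightarrow> 'a) \<Rightarrow>
    (nat \<Rightarrow> 'a) \<Rightarrow> (nat \<Rightarrow> 'a) \<Rightarrow> (nat \<Rightarrow> nat) \<Rightarrow> nat \<Rightarrow> bool"
  where "biorthogonal_chains K N M v y d k \<longleftrightarrow>
    (\<forall>j<k. v j \<in> K \<and> y j \<in> K \<and> (N ^^ d j) (v j) = 0 \<and> (M ^^ d j) (y j) = 0 \<and>
      (\<forall>l<k. \<forall>i. cinner ((N ^^ i) (v j)) (y l) = (if j = l \<and> Suc i = d j then 1 else 0)))"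

definition chain_annihilator :: "'a::complex_hilbert set \<Rightarrow> ('a \<Rightarrow> 'a) \<Rightarrow> (nat \<Rightarrow> 'a) \<Rightarrow> nat \<Rightarrow> 'a set"
  where "chain_annihilator K N y k = {x \<in> K. \<forall>l<k. \<forall>i. cinner ((N ^^ i) x) (y l) = 0}"

definition chain_part ::
    "('a::complex_hilbert \<Rightarrow> 'a) \<Rightarrow> (nat \<Rightarrow> 'a) \<Rightarrow> (nat \<Rightarrow> 'a) \<Rightarrow> (nat \<Rightarrow> nat) \<Rightarrow> nat \<Rightarrow> 'a \<Rightarrow> 'a"
  where "chain_part N v y d k x =
    (\<Sum>j<k. \<Sum>i<d j. cinner ((N ^^ (d j - 1 - i)) x) (y j) *\<^sub>C (N ^^ i) (v j))"

text \<open>A Jordan system exhausts \<open>K\<close>, and each chain is as long as the complement of the preceding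
  ones permits.  When the complement is \<open>{0}\<close>, the remaining chains have length \<open>0\<close>.\<close>

definition jordan_system :: "'a::complex_hilbert set \<Rightarrow> ('a \<Rightarrow> 'a) \<Rightarrow> ('a \<Rightarrow> 'a) \<Rightarrow>
    (nat \<Rightarrow> 'a) \<Rightarrow> (nat \<Rightarrow> 'a) \<Rightarrow> (nat \<Rightarrow> nat) \<Rightarrow> bool"
  where "jordan_system K N M v y d \<longleftrightarrow>
    (\<forall>k. biorthogonal_chains K N M v y d k) \<and>
    (\<forall>k. v k \<in> chain_annihilator K N y k) \<and>
    (\<forall>k. \<forall>x\<in>chain_annihilator K N y k. (N ^^ d k) x = 0) \<and>
    (\<forall>x\<in>K. (\<forall>j i. cinner ((N ^^ i) (v j)) x = 0) \<longrightarrow> x = 0)"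

context nilpotent_pair
begin

text \<open>\<^const>\<open>chain_part\<close> is the projection onto the span of the chains along the common kernel
  of the dual functionals.\<close>

lemma
  assumes sys: "biorthogonal_chains K N M v y d k"
  shows chain_part_in: "x \<in> K \<Longrightarrow> chain_part N v y d k x \<in> K"
    and chain_rest: "x \<in> K \<Longrightarrow> x - chain_part N v y d k x \<in> chain_annihilator K N y k"
    and chain_part_chain: "l < k \<Longrightarrow> chain_part N v y d k ((N ^^ m) (v l)) = (N ^^ m) (v l)"
    and chain_part_annihilator: "x \<in> chain_annihilator K N y k \<Longrightarrow> chain_part N v y d k x = 0"
proof -
  have vK: "v j \<in> K" and yK: "y j \<in> K" and Nv: "(N ^^ d j) (v j) = 0" and My: "(M ^^ d j) (y j) = 0"
    if "j < k" for j using sys that by (auto simp: biorthogonal_chains_def)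
  have bi: "cinner ((N ^^ i) (v j)) (y l) = (if j = l \<and> Suc i = d j then 1 else 0)"
    if "j < k" "l < k" for i j l using sys that unfolding biorthogonal_chains_def by blast
  show part: "chain_part N v y d k x \<in> K" for x
    unfolding chain_part_def by (intro K_sum Kmem(6) NK vK) simp
  show "chain_part N v y d k x = 0" if "x \<in> chain_annihilator K N y k"
    using that by (simp add: chain_part_def chain_annihilator_def)
  show "x - chain_part N v y d k x \<in> chain_annihilator K N y k" if x: "x \<in> K"
  proof -
    have "cinner ((N ^^ m) (x - chain_part N v y d k x)) (y l) = 0" if l: "l < k" for l m
    proof -
      have "(N ^^ m) (chain_part N v y d k x) = (\<Sum>j<k. \<Sum>i<d j.
          cinner ((N ^^ (d j - 1 - i)) x) (y j) *\<^sub>C (N ^^ (m + i)) (v j))"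
      proof -
        have in1: "cinner ((N ^^ (d j - 1 - i)) x) (y j) *\<^sub>C (N ^^ i) (v j) \<in> K" if "j < k" for i j
          using that NK vK Kmem(6) by blast
        have inner: "(N ^^ m) (\<Sum>i<d j. cinner ((N ^^ (d j - 1 - i)) x) (y j) *\<^sub>C (N ^^ i) (v j))
          = (\<Sum>i<d j. (N ^^ m) (cinner ((N ^^ (d j - 1 - i)) x) (y j) *\<^sub>C (N ^^ i) (v j)))"
          if "j < k" for j
          by (rule bounded_clinear_on_sum[OF N_pow K]) (rule in1[OF that])
        have "(N ^^ m) (chain_part N v y d k x) = (\<Sum>j<k. (N ^^ m) (\<Sum>i<d j.
          cinner ((N ^^ (d j - 1 - i)) x) (y j) *\<^sub>C (N ^^ i) (v j)))"
          unfolding chain_part_def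
          by (rule bounded_clinear_on_sum[OF N_pow K]) (rule K_sum, rule in1, simp)
        also have "\<dots> = (\<Sum>j<k. \<Sum>i<d j.
          (N ^^ m) (cinner ((N ^^ (d j - 1 - i)) x) (y j) *\<^sub>C (N ^^ i) (v j)))"
          by (intro sum.cong refl inner) simp
        also have "\<dots> = (\<Sum>j<k. \<Sum>i<d j.
          cinner ((N ^^ (d j - 1 - i)) x) (y j) *\<^sub>C (N ^^ (m + i)) (v j))"
          using NK vK by (intro sum.cong refl) (simp add: bounded_clinear_onD(3)[OF N_pow] funpow_add)
        finally show ?thesis .
      qed
      then have "cinner ((N ^^ m) (chain_part N v y d k x)) (y l) = (\<Sum>j<k. \<Sum>i<d j.
          cinner ((N ^^ (d j - 1 - i)) x) (y j) * (if j = l \<and> Suc (m + i) = d j then 1 else 0))"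
        by (simp only: cinner_sum_left cinner_scaleC_left)
          (intro sum.cong refl arg_cong2[where f = "(*)"] bi l, simp)
      also have "\<dots> = (\<Sum>j<k. if j = l then (\<Sum>i<d l.
          cinner ((N ^^ (d l - 1 - i)) x) (y l) * (if Suc (m + i) = d l then 1 else 0)) else 0)"
        by (intro sum.cong refl) auto
      also have "\<dots> = (\<Sum>i<d l.
          cinner ((N ^^ (d l - 1 - i)) x) (y l) * (if Suc (m + i) = d l then 1 else 0))"
        using l by simp
      also have "\<dots> = (\<Sum>i<d l. if i = d l - 1 - m \<and> m < d l then cinner ((N ^^ m) x) (y l) else 0)"
        by (intro sum.cong refl) auto
      also have "\<dots> = (if m < d l then cinner ((N ^^ m) x) (y l) else 0)" by auto
      also have "\<dots> = cinner ((N ^^ m) x) (y l)"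
      proof (cases "m < d l")
        case False
        then have "(M ^^ m) (y l) = 0"
          using nilpotent_pair.N_pow_mono[OF adjoint_pair yK[OF l] My[OF l]] by simp
        then show ?thesis using False adj_pow[OF x yK[OF l]] by simp
      qed simp
      finally show ?thesis
        using x part[of x] by (simp add: bounded_clinear_on_diff[OF N_pow K] cinner_diff_left)
    qed
    then show ?thesis using part x Kmem(5) by (simp add: chain_annihilator_def)
  qed
  show "chain_part N v y d k ((N ^^ m) (v l)) = (N ^^ m) (v l)" if l: "l < k"
  proof -
    have "chain_part N v y d k ((N ^^ m) (v l)) = (\<Sum>j<k. \<Sum>i<d j.
        (if l = j \<and> Suc (d j - 1 - i + m) = d l then 1 else 0) *\<^sub>C (N ^^ i) (v j))"
      unfolding chain_part_def
      by (intro sum.cong refl) (simp add: bi l funpow_add[THEN fun_cong, unfolded comp_def, symmetric])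
    also have "\<dots> = (\<Sum>j<k. if j = l then
        (\<Sum>i<d l. (if Suc (d l - 1 - i + m) = d l then 1 else 0) *\<^sub>C (N ^^ i) (v l)) else 0)"
      by (intro sum.cong refl) auto
    also have "\<dots> = (\<Sum>i<d l. (if Suc (d l - 1 - i + m) = d l then 1 else 0) *\<^sub>C (N ^^ i) (v l))"
      using l by simp
    also have "\<dots> = (\<Sum>i<d l. if i = m then (N ^^ m) (v l) else 0)"
      by (intro sum.cong refl) auto
    also have "\<dots> = (N ^^ m) (v l)" using N_pow_mono[OF vK[OF l] Nv[OF l], of m] by auto
    finally show ?thesis .
  qed
qed

text \<open>The adjoint of \<open>x \<mapsto> x - chain_part N v y d k x\<close>.\<close>

lemma chain_rest_adjoint:
  assumes sys: "biorthogonal_chains K N M v y d k" and z: "z \<in> K"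
  shows "\<exists>w\<in>K. \<forall>x\<in>K. cinner x w = cinner (x - chain_part N v y d k x) z"
proof -
  have vK: "v j \<in> K" and yK: "y j \<in> K" if "j < k" for j
    using sys that by (auto simp: biorthogonal_chains_def)
  define w where "w = z - (\<Sum>j<k. \<Sum>i<d j.
    cnj (cinner ((N ^^ i) (v j)) z) *\<^sub>C (M ^^ (d j - 1 - i)) (y j))"
  have "w \<in> K" unfolding w_def using z MK yK Kmem(6) by (intro Kmem(5) K_sum) auto
  moreover have "cinner x w = cinner (x - chain_part N v y d k x) z" if x: "x \<in> K" for x
    unfolding w_def chain_part_def cinner_diff_left cinner_diff_right cinner_sum_left
      cinner_sum_right cinner_scaleC_left cinner_scaleC_right complex_cnj_cnj
    using yK by (intro arg_cong[of _ _ "\<lambda>t. cinner x z - t"] sum.cong refl)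
      (simp add: adj_pow[OF x] mult.commute)
  ultimately show ?thesis by blast
qed

text \<open>The splitting step: a new chain of maximal length in the annihilator.  Its generator is
  the component of the target \<open>h\<close>, perturbed by at most \<open>e\<close> when that component has too small an
  order; its dual generator annihilates the previous chains.\<close>

lemma next_chain:
  assumes sys: "biorthogonal_chains K N M v y d k" and h: "h \<in> K" and e: "0 < e"
  shows "\<exists>u\<in>chain_annihilator K N y k. \<exists>w\<in>K. \<exists>c.
    (N ^^ c) u = 0 \<and> (M ^^ c) w = 0 \<and>
    (\<forall>i. cinner ((N ^^ i) u) w = (if Suc i = c then 1 else 0)) \<and>
    (\<forall>j<k. \<forall>i. cinner ((N ^^ i) (v j)) w = 0) \<and>
    (\<forall>x\<in>chain_annihilator K N y k. (N ^^ c) x = 0) \<and>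
    (\<forall>x\<in>K. (\<forall>j<k. \<forall>i. cinner ((N ^^ i) (v j)) x = 0) \<longrightarrow> (\<forall>i. cinner ((N ^^ i) u) x = 0) \<longrightarrow>
      cmod (cinner h x) \<le> e * norm x)"
proof -
  let ?P = "chain_part N v y d k" and ?Z = "chain_annihilator K N y k"
  have vK: "v j \<in> K" if "j < k" for j using sys that by (auto simp: biorthogonal_chains_def)
  have ZK: "x \<in> K" if "x \<in> ?Z" for x using that by (simp add: chain_annihilator_def)
  have ZN: "(N ^^ m) x \<in> ?Z" if "x \<in> ?Z" for x m
    using that NK by (simp add: chain_annihilator_def funpow_add[THEN fun_cong, unfolded comp_def, symmetric])
  have Zlin: "x + c *\<^sub>C z \<in> ?Z" if "x \<in> ?Z" "z \<in> ?Z" for x z c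
    using that Kmem NK by (simp add: chain_annihilator_def bounded_clinear_onD(2,3)[OF N_pow]
        cinner_add_left cinner_scaleC_left)
  define c where "c = (LEAST c. \<forall>x\<in>?Z. (N ^^ c) x = 0)"
  have cZ: "\<forall>x\<in>?Z. (N ^^ c) x = 0"
    unfolding c_def by (rule LeastI[of _ n]) (use ZK nil in blast)
  have orth_part: "cinner (?P x) z = 0" if "\<forall>j<k. \<forall>i. cinner ((N ^^ i) (v j)) z = 0" for x z
    using that by (simp add: chain_part_def cinner_sum_left cinner_scaleC_left)
  show ?thesis
  proof (cases "c = 0")
    case True
    have "h - ?P h = 0" using bspec[OF cZ chain_rest[OF sys h]] by (simp add: True)
    then have "cmod (cinner h x) \<le> e * norm x"
      if "\<forall>j<k. \<forall>i. cinner ((N ^^ i) (v j)) x = 0" for x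
      using orth_part[OF that, of h] e by simp
    moreover have "0 \<in> ?Z"
      using Kmem(3) bounded_clinear_on_0[OF N_pow K] by (simp add: chain_annihilator_def)
    ultimately show ?thesis
      using cZ True Kmem(3) bounded_clinear_on_0[OF N_pow K]
      by (intro bexI[of _ 0] exI[of _ 0]) auto
  next
    case False
    then have c: "0 < c" by simp
    have "\<not> (\<forall>x\<in>?Z. (N ^^ (c - 1)) x = 0)"
      using not_less_Least[of "c - 1" "\<lambda>c. \<forall>x\<in>?Z. (N ^^ c) x = 0"] c by (simp add: c_def[symmetric])
    then obtain t where t: "t \<in> ?Z" "(N ^^ (c - 1)) t \<noteq> 0" by blast
    let ?r = "h - ?P h"
    have r: "?r \<in> ?Z" by (rule chain_rest[OF sys h])
    have "\<exists>u\<in>?Z. (N ^^ (c - 1)) u \<noteq> 0 \<and> norm (?r - u) \<le> e"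
    proof (cases "(N ^^ (c - 1)) ?r = 0")
      case True
      define s where "s = complex_of_real (e / norm t)"
      have t0: "t \<noteq> 0" using t(2) bounded_clinear_on_0[OF N_pow K] by auto
      have "(N ^^ (c - 1)) (?r + s *\<^sub>C t) = (N ^^ (c - 1)) ?r + s *\<^sub>C (N ^^ (c - 1)) t"
        using r t ZK Kmem(6) by (simp add: bounded_clinear_onD(2,3)[OF N_pow])
      also have "\<dots> \<noteq> 0" using True t(2) t0 e by (simp add: s_def)
      finally have "(N ^^ (c - 1)) (?r + s *\<^sub>C t) \<noteq> 0" .
      moreover have "norm (?r - (?r + s *\<^sub>C t)) \<le> e"
      proof -
        have "norm (?r - (?r + s *\<^sub>C t)) = cmod s * norm t" by (simp add: norm_scaleC)
        also have "\<dots> = e" using t0 e by (simp add: s_def norm_divide)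
        finally show ?thesis by simp
      qed
      ultimately show ?thesis using Zlin[OF r t(1)] by blast
    next
      case False
      then show ?thesis using r e by (intro bexI[of _ ?r]) auto
    qed
    then obtain u where u: "u \<in> ?Z" "(N ^^ (c - 1)) u \<noteq> 0" "norm (?r - u) \<le> e" by blast
    have Nu: "(N ^^ c) u = 0" using cZ u(1) by blast
    obtain z where z: "z \<in> K" "\<And>i. cinner ((N ^^ i) u) z = (if Suc i = c then 1 else 0)"
      using dual_vector[OF ZK[OF u(1)] c Nu u(2)] by blast
    obtain w where w: "w \<in> K" "\<And>x. x \<in> K \<Longrightarrow> cinner x w = cinner (x - ?P x) z"
      using chain_rest_adjoint[OF sys z(1)] by blast
    have wu: "cinner ((N ^^ i) u) w = (if Suc i = c then 1 else 0)" for i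
      using w(2)[OF ZK[OF ZN[OF u(1)]]] z(2) chain_part_annihilator[OF sys ZN[OF u(1)]] by simp
    have wv: "cinner ((N ^^ i) (v j)) w = 0" if "j < k" for i j
      using w(2)[OF NK[OF vK[OF that]]] by (simp add: chain_part_chain[OF sys that])
    have "(M ^^ c) w = 0"
    proof (rule zero_in_K_if[OF MK[OF w(1)]])
      fix x assume x: "x \<in> K"
      have "cinner ((N ^^ c) x) w = cinner ((N ^^ c) (x - ?P x)) w + cinner ((N ^^ c) (?P x)) w"
        using x chain_part_in[OF sys x] by (simp add: bounded_clinear_on_diff[OF N_pow K] cinner_diff_left)
      moreover have "(N ^^ c) (x - ?P x) = 0" using cZ chain_rest[OF sys x] by blast
      moreover have "cinner ((N ^^ c) (?P x)) w = 0"
      proof -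
        have "cinner (?P x) ((M ^^ c) w) = 0"
        proof (rule orth_part, intro allI impI)
          fix j i assume j: "j < k"
          have "cinner ((N ^^ i) (v j)) ((M ^^ c) w) = cinner ((N ^^ (c + i)) (v j)) w"
            using adj_pow[OF NK[OF vK[OF j]] w(1)] by (simp add: funpow_add)
          then show "cinner ((N ^^ i) (v j)) ((M ^^ c) w) = 0" by (simp add: wv j)
        qed
        then show ?thesis using adj_pow[OF chain_part_in[OF sys x] w(1)] by simp
      qed
      ultimately have "cinner x ((M ^^ c) w) = 0" using adj_pow[OF x w(1), of c] by simp
      then show "cinner ((M ^^ c) w) x = 0" by (simp add: cinner_eq_0_commute)
    qed
    moreover have "cmod (cinner h x) \<le> e * norm x"
      if "\<forall>j<k. \<forall>i. cinner ((N ^^ i) (v j)) x = 0" "\<forall>i. cinner ((N ^^ i) u) x = 0" for x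
    proof -
      have "cinner h x = cinner (?r - u) x"
        using orth_part[OF that(1), of h] that(2)[rule_format, of 0] by (simp add: cinner_diff_left)
      then have "cmod (cinner h x) \<le> norm (?r - u) * norm x" using cinner_cauchy_schwarz by metis
      also have "\<dots> \<le> e * norm x" using u(3) by (simp add: mult_right_mono)
      finally show ?thesis .
    qed
    ultimately show ?thesis using u(1) w(1) Nu wu wv cZ by blast
  qed
qed

text \<open>Every element \<open>h\<close> of a countable dense set is a target infinitely often, with errors
  tending to \<open>0\<close>; hence the chains are total.\<close>

lemma jordan_system_exists: "\<exists>v y d. jordan_system K N M v y d"
proof -
  obtain D where D: "D \<subseteq> K" "countable D" "K \<subseteq> closure D" using separable by blast
  have "D \<noteq> {}" using D(3) Kmem(3) by auto
  then have rD: "range (from_nat_into D) = D" using D(2) by (rule range_from_nat_into)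
  define h where "h k = from_nat_into D (fst (prod_decode k))" for k
  define e where "e k = 1 / real (Suc (snd (prod_decode k)))" for k
  have hK: "h k \<in> K" for k using D(1) rD by (auto simp: h_def)
  have e0: "0 < e k" for k by (simp add: e_def)
  define P :: "(nat \<Rightarrow> 'a \<times> 'a \<times> nat) \<Rightarrow> nat \<Rightarrow> 'a \<times> 'a \<times> nat \<Rightarrow> bool" where
    "P f k r \<longleftrightarrow> (case r of (u, w, c) \<Rightarrow>
      u \<in> K \<and> (\<forall>l<k. \<forall>i. cinner ((N ^^ i) u) (fst (snd (f l))) = 0) \<and> w \<in> K \<and>
      (N ^^ c) u = 0 \<and> (M ^^ c) w = 0 \<and>
      (\<forall>i. cinner ((N ^^ i) u) w = (if Suc i = c then 1 else 0)) \<and>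
      (\<forall>j<k. \<forall>i. cinner ((N ^^ i) (fst (f j))) w = 0) \<and>
      (\<forall>x\<in>K. (\<forall>l<k. \<forall>i. cinner ((N ^^ i) x) (fst (snd (f l))) = 0) \<longrightarrow> (N ^^ c) x = 0) \<and>
      (\<forall>x\<in>K. (\<forall>j<k. \<forall>i. cinner ((N ^^ i) (fst (f j))) x = 0) \<longrightarrow>
        (\<forall>i. cinner ((N ^^ i) u) x = 0) \<longrightarrow> cmod (cinner (h k) x) \<le> e k * norm x))" for f k r
  have chains: "biorthogonal_chains K N M (\<lambda>j. fst (f j)) (\<lambda>j. fst (snd (f j))) (\<lambda>j. snd (snd (f j))) k"
    if f: "\<And>j. j < k \<Longrightarrow> P f j (f j)" for f k
    unfolding biorthogonal_chains_def
  proof (intro allI impI conjI)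
    fix j assume j: "j < k"
    note Pj = f[OF j, unfolded P_def case_prod_beta]
    show "fst (f j) \<in> K" "fst (snd (f j)) \<in> K" "(N ^^ snd (snd (f j))) (fst (f j)) = 0"
      "(M ^^ snd (snd (f j))) (fst (snd (f j))) = 0" using Pj by blast+
    fix l i assume l: "l < k"
    note Pl = f[OF l, unfolded P_def case_prod_beta]
    consider "l < j" | "j < l" | "j = l" by linarith
    then show "cinner ((N ^^ i) (fst (f j))) (fst (snd (f l)))
        = (if j = l \<and> Suc i = snd (snd (f j)) then 1 else 0)"
    proof cases
      case 1
      then show ?thesis using Pj by simp
    next
      case 2
      then show ?thesis using Pl by simp
    next
      case 3
      then show ?thesis using Pj by simp
    qed
  qed
  have "\<exists>f. \<forall>k. P f k (f k)"
  proof (rule dependent_wellorder_choice)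
    fix r :: "'a \<times> 'a \<times> nat" and f g :: "nat \<Rightarrow> 'a \<times> 'a \<times> nat" and k :: nat
    assume "\<And>j. j < k \<Longrightarrow> f j = g j"
    then show "P f k r = P g k r" unfolding P_def by (simp cong: conj_cong imp_cong split: prod.splits)
  next
    fix k :: nat and f :: "nat \<Rightarrow> 'a \<times> 'a \<times> nat"
    assume "\<And>j. j < k \<Longrightarrow> P f j (f j)"
    from next_chain[OF chains[OF this] hK[of k] e0[of k]]
    obtain u w c where
      "u \<in> chain_annihilator K N (\<lambda>j. fst (snd (f j))) k" "w \<in> K" "(N ^^ c) u = 0" "(M ^^ c) w = 0"
      "\<forall>i. cinner ((N ^^ i) u) w = (if Suc i = c then 1 else 0)"
      "\<forall>j<k. \<forall>i. cinner ((N ^^ i) (fst (f j))) w = 0"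
      "\<forall>x\<in>chain_annihilator K N (\<lambda>j. fst (snd (f j))) k. (N ^^ c) x = 0"
      "\<forall>x\<in>K. (\<forall>j<k. \<forall>i. cinner ((N ^^ i) (fst (f j))) x = 0) \<longrightarrow>
        (\<forall>i. cinner ((N ^^ i) u) x = 0) \<longrightarrow> cmod (cinner (h k) x) \<le> e k * norm x"
      by blast
    then have "P f k (u, w, c)" unfolding P_def chain_annihilator_def by simp
    then show "\<exists>r. P f k r" ..
  qed
  then obtain f where f: "\<And>k. P f k (f k)" by blast
  define v y d where "v = (\<lambda>j. fst (f j))" and "y = (\<lambda>j. fst (snd (f j)))"
    and "d = (\<lambda>j. snd (snd (f j)))"
  have 1: "biorthogonal_chains K N M v y d k" for k
    unfolding v_def y_def d_def by (rule chains[OF f])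
  have 2: "v k \<in> chain_annihilator K N y k" for k
    using f[of k] by (simp add: P_def case_prod_beta chain_annihilator_def v_def y_def)
  have 3: "(N ^^ d k) x = 0" if "x \<in> chain_annihilator K N y k" for k x
    using f[of k] that by (simp add: P_def case_prod_beta chain_annihilator_def d_def y_def)
  have 4: "x = 0" if x: "x \<in> K" "\<And>j i. cinner ((N ^^ i) (v j)) x = 0" for x
  proof -
    have small: "cmod (cinner (h k) x) \<le> e k * norm x" for k
      using f[of k] x by (simp add: P_def case_prod_beta v_def)
    have "cinner q x = 0" if "q \<in> D" for q
    proof -
      have "q \<in> range (from_nat_into D)" by (subst rD) (rule that)
      then obtain i where i: "q = from_nat_into D i" by (rule rangeE)
      have "cmod (cinner q x) \<le> norm x * (1 / real (Suc m))" for m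
        using small[of "prod_encode (i, m)"] by (simp add: h_def e_def i)
      moreover have "(\<lambda>m. norm x * (1 / real (Suc m))) \<longlonglongrightarrow> norm x * 0"
        by (intro tendsto_intros LIMSEQ_Suc lim_1_over_n)
      ultimately have "cmod (cinner q x) \<le> norm x * 0" using LIMSEQ_le_const by blast
      then show ?thesis by simp
    qed
    then have "D \<subseteq> {q. \<forall>z\<in>{x}. cinner q z = 0}" by blast
    then have "closure D \<subseteq> {q. \<forall>z\<in>{x}. cinner q z = 0}"
      by (rule closure_minimal) (rule closed_orthogonal)
    then have "cinner x x = 0" using D(3) x(1) by blast
    then show "x = 0" by simp
  qed
  have "jordan_system K N M v y d"
    unfolding jordan_system_def using 1 2 3 4 by blast
  then show ?thesis by blast
qed

end


section \<open>Comparing nilpotent operators\<close>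

text \<open>\<open>N\<close> has at least \<open>k + 1\<close> chains of length at least \<open>p\<close>, expressed without reference to
  a Jordan system: the space \<open>N\<^sup>p\<^sup>-\<^sup>1 (ker N\<^sup>p)\<close> has dimension greater than \<open>k\<close>.\<close>

definition has_chains :: "'a::complex_hilbert set \<Rightarrow> ('a \<Rightarrow> 'a) \<Rightarrow> nat \<Rightarrow> nat \<Rightarrow> bool"
  where "has_chains K N k p \<longleftrightarrow> (\<exists>u. (\<forall>j\<le>k. u j \<in> K \<and> (N ^^ p) (u j) = 0) \<and>
    (\<forall>c. (\<Sum>j\<le>k. c j *\<^sub>C (N ^^ (p - 1)) (u j)) = 0 \<longrightarrow> (\<forall>j\<le>k. c j = 0)))"

lemma too_many_vectors_dependent:
  fixes b w :: "nat \<Rightarrow> 'a::complex_hilbert"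
  assumes b: "\<And>j. j \<le> k \<Longrightarrow> b j \<in> cspan (w ` {..<k})"
  shows "\<exists>c. (\<Sum>j\<le>k. c j *\<^sub>C b j) = 0 \<and> (\<exists>j\<le>k. c j \<noteq> 0)"
proof (rule ccontr)
  assume "\<not> ?thesis"
  then have ind: "\<And>c j. (\<Sum>j\<le>k. c j *\<^sub>C b j) = 0 \<Longrightarrow> j \<le> k \<Longrightarrow> c j = 0" by blast
  have inj: "inj_on b {..k}"
  proof (rule inj_onI, rule ccontr)
    fix i j assume ij: "i \<in> {..k}" "j \<in> {..k}" "b i = b j" "i \<noteq> j"
    define c where "c l = (if l = i then 1 else if l = j then - 1 else 0 :: complex)" for l
    have "(\<Sum>l\<le>k. c l *\<^sub>C b l) = (\<Sum>l\<in>{i, j}. c l *\<^sub>C b l)"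
      using ij by (intro sum.mono_neutral_right) (auto simp: c_def)
    also have "\<dots> = 0" using ij by (simp add: c_def)
    finally show False using ind[of c i] ij by (simp add: c_def)
  qed
  have "\<not> complex_vector.dependent (b ` {..k})"
  proof
    assume "complex_vector.dependent (b ` {..k})"
    then obtain g v where g: "v \<in> b ` {..k}" "g v \<noteq> 0" "(\<Sum>v\<in>b ` {..k}. g v *\<^sub>C v) = 0"
      by (auto simp: complex_vector.dependent_finite)
    then have "(\<Sum>j\<le>k. g (b j) *\<^sub>C b j) = 0" by (simp add: sum.reindex[OF inj])
    then show False using ind[of "\<lambda>j. g (b j)"] g by auto
  qed
  moreover have "b ` {..k} \<subseteq> cspan (w ` {..<k})" using b by auto
  ultimately have "card (b ` {..k}) \<le> card (w ` {..<k})"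
    using complex_vector.independent_span_bound[of "w ` {..<k}" "b ` {..k}"] by simp
  also have "\<dots> \<le> k" using card_image_le[of "{..<k}" w] by simp
  finally show False by (simp add: card_image[OF inj])
qed

context nilpotent_pair
begin

lemma jordan_systemD:
  assumes "jordan_system K N M v y d"
  shows "v j \<in> K" "y j \<in> K" "(N ^^ d j) (v j) = 0" "(M ^^ d j) (y j) = 0"
    "cinner ((N ^^ i) (v j)) (y l) = (if j = l \<and> Suc i = d j then 1 else 0)"
    "biorthogonal_chains K N M v y d k"
    "x \<in> chain_annihilator K N y k \<Longrightarrow> (N ^^ d k) x = 0"
    "x \<in> K \<Longrightarrow> (\<And>j i. cinner ((N ^^ i) (v j)) x = 0) \<Longrightarrow> x = 0"
proof -
  have chains: "biorthogonal_chains K N M v y d m" for m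
    using assms by (simp add: jordan_system_def)
  have "j < Suc (max j l)" "l < Suc (max j l)" by auto
  with chains[of "Suc (max j l)"]
  show "v j \<in> K" "y j \<in> K" "(N ^^ d j) (v j) = 0" "(M ^^ d j) (y j) = 0"
    "cinner ((N ^^ i) (v j)) (y l) = (if j = l \<and> Suc i = d j then 1 else 0)"
    unfolding biorthogonal_chains_def by blast+
  show "biorthogonal_chains K N M v y d k" by (rule chains)
  show "x \<in> chain_annihilator K N y k \<Longrightarrow> (N ^^ d k) x = 0"
    using assms unfolding jordan_system_def by blast
  show "x \<in> K \<Longrightarrow> (\<And>j i. cinner ((N ^^ i) (v j)) x = 0) \<Longrightarrow> x = 0"
    using assms unfolding jordan_system_def by blast
qed

text \<open>The annihilators decrease, so the chains, being of maximal length there, get no longer.\<close>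

lemma jordan_system_antimono:
  assumes sys: "jordan_system K N M v y d" and jk: "j \<le> k"
  shows "d k \<le> d j"
proof (rule ccontr)
  assume "\<not> ?thesis"
  then have less: "d j < d k" by simp
  have "v k \<in> chain_annihilator K N y j"
    using sys jk by (auto simp: jordan_system_def chain_annihilator_def)
  then have "(N ^^ d j) (v k) = 0" by (rule jordan_systemD(7)[OF sys])
  then have "(N ^^ (d k - 1)) (v k) = 0"
    by (rule N_pow_mono[OF jordan_systemD(1)[OF sys]]) (use less in simp)
  then show False using jordan_systemD(5)[OF sys, of "d k - 1" k k] less by simp
qed

lemma has_chains_iff:
  assumes sys: "jordan_system K N M v y d" and p: "1 \<le> p"
  shows "has_chains K N k p \<longleftrightarrow> p \<le> d k"
proof
  note D = jordan_systemD[OF sys]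
  assume pd: "p \<le> d k"
  define u where "u j = (N ^^ (d j - p)) (v j)" for j
  have pj: "p \<le> d j" if "j \<le> k" for j using jordan_system_antimono[OF sys that] pd by simp
  have u1: "(N ^^ m) (u j) = (N ^^ (m + (d j - p))) (v j)" for m j
    by (simp add: u_def funpow_add)
  have "u j \<in> K" for j using NK D(1) by (simp add: u_def)
  moreover have "(N ^^ p) (u j) = 0" if "j \<le> k" for j
    unfolding u1 using pj[OF that] D(3) by simp
  moreover have "c j = 0" if c: "(\<Sum>j\<le>k. c j *\<^sub>C (N ^^ (p - 1)) (u j)) = 0" and j: "j \<le> k" for c j
  proof -
    have "c i * cinner ((N ^^ (p - 1)) (u i)) (y j) = (if i = j then c j else 0)" if "i \<le> k" for i
      using pj[OF that] p unfolding u1 D(5) by auto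
    then have "cinner (\<Sum>i\<le>k. c i *\<^sub>C (N ^^ (p - 1)) (u i)) (y j) = (\<Sum>i\<le>k. if i = j then c j else 0)"
      unfolding cinner_sum_left cinner_scaleC_left by (intro sum.cong) auto
    then have "(\<Sum>i\<le>k. if i = j then c j else 0) = 0" unfolding c by simp
    then show ?thesis using j by simp
  qed
  ultimately show "has_chains K N k p" unfolding has_chains_def by blast
next
  note D = jordan_systemD[OF sys]
  assume "has_chains K N k p"
  then obtain u where u: "\<And>j. j \<le> k \<Longrightarrow> u j \<in> K" "\<And>j. j \<le> k \<Longrightarrow> (N ^^ p) (u j) = 0"
    and ind: "\<And>c j. (\<Sum>j\<le>k. c j *\<^sub>C (N ^^ (p - 1)) (u j)) = 0 \<Longrightarrow> j \<le> k \<Longrightarrow> c j = 0"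
    unfolding has_chains_def by blast
  show "p \<le> d k"
  proof (rule ccontr)
    assume "\<not> ?thesis"
    then have less: "d k \<le> p - 1" by simp
    \<comment> \<open>All of \<open>N\<^sup>p\<^sup>-\<^sup>1 (ker N\<^sup>p)\<close> comes from the first \<open>k\<close> chains, each of which contributes only
      its last vector.\<close>
    define w where "w l = (N ^^ (d l - 1)) (v l)" for l
    have "(N ^^ (p - 1)) x \<in> cspan (w ` {..<k})" if x: "x \<in> K" "(N ^^ p) x = 0" for x
    proof -
      let ?P = "chain_part N v y d k"
      have PK: "?P x \<in> K" by (rule chain_part_in[OF D(6) x(1)])
      have "(N ^^ d k) (x - ?P x) = 0" by (rule D(7)[OF chain_rest[OF D(6) x(1)]])
      then have "(N ^^ (p - 1)) (x - ?P x) = 0"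
        using less x(1) PK Kmem(5) N_pow_mono by blast
      then have "(N ^^ (p - 1)) x = (N ^^ (p - 1)) (?P x)"
        using x(1) PK by (simp add: bounded_clinear_on_diff[OF N_pow K])
      also have "\<dots> = (\<Sum>l<k. \<Sum>i<d l. cinner ((N ^^ (d l - 1 - i)) x) (y l) *\<^sub>C (N ^^ (p - 1 + i)) (v l))"
      proof -
        have in1: "cinner ((N ^^ (d l - 1 - i)) x) (y l) *\<^sub>C (N ^^ i) (v l) \<in> K" for i l
          using NK D(1) Kmem(6) by blast
        have "(N ^^ (p - 1)) (cinner ((N ^^ (d l - 1 - i)) x) (y l) *\<^sub>C (N ^^ i) (v l))
            = cinner ((N ^^ (d l - 1 - i)) x) (y l) *\<^sub>C (N ^^ (p - 1 + i)) (v l)" for i l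
          using NK[OF D(1)] by (simp add: bounded_clinear_onD(3)[OF N_pow] funpow_add)
        then show ?thesis
          unfolding chain_part_def
          by (simp only: bounded_clinear_on_sum[OF N_pow K] in1 K_sum)
      qed
      also have "\<dots> \<in> cspan (w ` {..<k})"
      proof (intro complex_vector.span_sum)
        fix l i assume l: "l \<in> {..<k}" and i: "i \<in> {..<d l}"
        consider "p \<le> d l - 1 - i" | "d l \<le> p - 1 + i" | "p - 1 + i = d l - 1" by linarith
        then show "cinner ((N ^^ (d l - 1 - i)) x) (y l) *\<^sub>C (N ^^ (p - 1 + i)) (v l) \<in> cspan (w ` {..<k})"
        proof cases
          case 1
          then have "(N ^^ (d l - 1 - i)) x = 0" by (rule N_pow_mono[OF x])
          then show ?thesis by (simp add: complex_vector.span_zero)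
        next
          case 2
          then have "(N ^^ (p - 1 + i)) (v l) = 0" by (rule N_pow_mono[OF D(1,3)])
          then show ?thesis by (simp add: complex_vector.span_zero)
        next
          case 3
          then show ?thesis using l by (intro complex_vector.span_scale complex_vector.span_base) (auto simp: w_def)
        qed
      qed
      finally show ?thesis .
    qed
    from too_many_vectors_dependent[of k "\<lambda>j. (N ^^ (p - 1)) (u j)" w, OF this[OF u]]
    show False using ind by blast
  qed
qed

text \<open>The dual generators of a Jordan system generate equally long chains of the adjoint.\<close>

lemma has_chains_imp_adjoint:
  assumes p: "1 \<le> p" and "has_chains K N k p"
  shows "has_chains K M k p"
proof -
  obtain v y d where sys: "jordan_system K N M v y d" using jordan_system_exists by blast
  note D = jordan_systemD[OF sys]
  have "p \<le> d k" using has_chains_iff[OF sys p] assms(2) by blast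
  then have pj: "p \<le> d j" if "j \<le> k" for j using jordan_system_antimono[OF sys that] by simp
  define u where "u j = (M ^^ (d j - p)) (y j)" for j
  have u1: "(M ^^ m) (u j) = (M ^^ (m + (d j - p))) (y j)" for m j by (simp add: u_def funpow_add)
  have "u j \<in> K" for j using MK D(2) by (simp add: u_def)
  moreover have "(M ^^ p) (u j) = 0" if "j \<le> k" for j
    unfolding u1 using pj[OF that] D(4) by simp
  moreover have "c j = 0" if c: "(\<Sum>j\<le>k. c j *\<^sub>C (M ^^ (p - 1)) (u j)) = 0" and j: "j \<le> k" for c j
  proof -
    have "cinner (v j) ((M ^^ (p - 1)) (u i)) = (if i = j then 1 else 0)" if "i \<le> k" for i
      unfolding u1 adj_pow[OF D(1) D(2), symmetric] D(5) using pj[OF that] p by auto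
    then have "cinner (v j) (\<Sum>i\<le>k. c i *\<^sub>C (M ^^ (p - 1)) (u i)) = (\<Sum>i\<le>k. if i = j then cnj (c j) else 0)"
      unfolding cinner_sum_right cinner_scaleC_right by (intro sum.cong) auto
    then have "(\<Sum>i\<le>k. if i = j then cnj (c j) else 0) = 0" unfolding c by simp
    then show ?thesis using j by simp
  qed
  ultimately show ?thesis unfolding has_chains_def by blast
qed

lemma has_chains_adjoint: "1 \<le> p \<Longrightarrow> has_chains K M k p \<longleftrightarrow> has_chains K N k p"
  using has_chains_imp_adjoint nilpotent_pair.has_chains_imp_adjoint[OF adjoint_pair] by blast

end

lemma injected_has_chains:
  assumes K: "closed_csubspace K" and N: "bounded_clinear_on K K N"
    and inj: "injected K N K' N'" and chains: "has_chains K N k p"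
  shows "has_chains K' N' k p"
proof -
  obtain X where X: "bounded_clinear_on K K' X" "inj_on X K" "\<And>x. x \<in> K \<Longrightarrow> X (N x) = N' (X x)"
    using inj unfolding injected_def by blast
  have NK: "(N ^^ m) x \<in> K" if "x \<in> K" for m x
    using bounded_clinear_onD(1)[OF N] that by (rule pow_in)
  have X0: "X 0 = 0" by (rule bounded_clinear_on_0[OF X(1) K])
  have pow: "(N' ^^ m) (X x) = X ((N ^^ m) x)" if "x \<in> K" for m x
    by (induction m) (use X(3) NK[OF that] in auto)
  obtain u where u: "\<And>j. j \<le> k \<Longrightarrow> u j \<in> K" "\<And>j. j \<le> k \<Longrightarrow> (N ^^ p) (u j) = 0"
    and ind: "\<And>c j. (\<Sum>j\<le>k. c j *\<^sub>C (N ^^ (p - 1)) (u j)) = 0 \<Longrightarrow> j \<le> k \<Longrightarrow> c j = 0"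
    using chains unfolding has_chains_def by blast
  have "X (u j) \<in> K'" "(N' ^^ p) (X (u j)) = 0" if "j \<le> k" for j
    using bounded_clinear_onD(1)[OF X(1)] u that by (auto simp: pow X0)
  moreover have "c j = 0" if c: "(\<Sum>j\<le>k. c j *\<^sub>C (N' ^^ (p - 1)) (X (u j))) = 0" and j: "j \<le> k" for c j
  proof -
    let ?s = "\<Sum>j\<le>k. c j *\<^sub>C (N ^^ (p - 1)) (u j)"
    have mem: "c j *\<^sub>C (N ^^ (p - 1)) (u j) \<in> K" if "j \<in> {..k}" for j
      using closed_csubspaceD(6)[OF K] NK u(1) that by auto
    have "?s \<in> K" using closed_csubspaceD(1)[OF K] mem by (rule complex_vector.subspace_sum)
    moreover have "X ?s = (\<Sum>j\<le>k. X (c j *\<^sub>C (N ^^ (p - 1)) (u j)))"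
      by (rule bounded_clinear_on_sum[OF X(1) K mem])
    then have "X ?s = (\<Sum>j\<le>k. c j *\<^sub>C (N' ^^ (p - 1)) (X (u j)))"
      using u(1) NK by (simp add: pow bounded_clinear_onD(3)[OF X(1)])
    then have "X ?s = X 0" using c X0 by simp
    ultimately have "?s = 0" using X(2) closed_csubspaceD(3)[OF K] by (simp add: inj_on_eq_iff)
    then show ?thesis using ind j by blast
  qed
  ultimately show ?thesis unfolding has_chains_def by (intro exI[of _ "\<lambda>j. X (u j)"]) blast
qed

lemma bounded_operator_series:
  fixes A :: "nat \<Rightarrow> 'a::complex_hilbert \<Rightarrow> 'b::complex_hilbert"
  assumes K: "closed_csubspace K" and L: "closed_csubspace L"
    and A: "\<And>j. bounded_clinear_on K L (A j)"
    and bound: "\<And>j x. x \<in> K \<Longrightarrow> norm (A j x) \<le> (1 / 2) ^ j * norm x"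
  shows "bounded_clinear_on K L (\<lambda>x. \<Sum>j. A j x)" and "x \<in> K \<Longrightarrow> summable (\<lambda>j. A j x)"
proof -
  have geo: "(\<lambda>j. (1 / 2) ^ j * norm x) sums (2 * norm x)" for x :: 'a
    using sums_mult2[OF geometric_sums[of "1/2 :: real"], of "norm x"] by simp
  have sm: "summable (\<lambda>j. A j x)" if "x \<in> K" for x
    by (rule summable_comparison_test'[where N = 0, OF sums_summable[OF geo[of x]]])
      (rule bound[OF that])
  then show "x \<in> K \<Longrightarrow> summable (\<lambda>j. A j x)" .
  show "bounded_clinear_on K L (\<lambda>x. \<Sum>j. A j x)"
  proof (rule bounded_clinear_onI[where B = 2])
    fix x assume x: "x \<in> K"
    show "(\<Sum>j. A j x) \<in> L"
    proof (rule closed_sequentially[OF closed_csubspaceD(2)[OF L]])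
      show "(\<lambda>n. \<Sum>j<n. A j x) \<longlonglongrightarrow> (\<Sum>j. A j x)" by (rule summable_LIMSEQ[OF sm[OF x]])
      show "(\<Sum>j<n. A j x) \<in> L" for n
        using bounded_clinear_onD(1)[OF A x] closed_csubspaceD(1)[OF L]
        by (intro complex_vector.subspace_sum) auto
    qed
    show "norm (\<Sum>j. A j x) \<le> 2 * norm x"
      using norm_suminf_le[OF bound[OF x] sums_summable[OF geo]] by (simp add: sums_unique[OF geo, symmetric])
    show "(\<Sum>j. A j (c *\<^sub>C x)) = c *\<^sub>C (\<Sum>j. A j x)" for c
      using bounded_linear.suminf[OF bounded_linear_scaleC sm[OF x], of c]
      by (simp add: bounded_clinear_onD(3)[OF A x])
    fix y assume y: "y \<in> K"
    show "(\<Sum>j. A j (x + y)) = (\<Sum>j. A j x) + (\<Sum>j. A j y)"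
      by (simp add: suminf_add[OF sm[OF x] sm[OF y]] bounded_clinear_onD(2)[OF A x y])
  qed
qed

text \<open>Chains of \<open>N\<close>, described through a Jordan system of the adjoint, are mapped onto the ends of
  chains of \<open>N'\<close> that are at least as long.  The weights make the sum over all chains converge; the
  dual functionals recover every coordinate from the image.\<close>

lemma intertwiner_exists:
  assumes "nilpotent_pair K N M n" "nilpotent_pair K' N' M' n'"
    and sys: "jordan_system K M N v y d" and sys': "jordan_system K' N' M' v' y' d'"
    and le: "\<And>j. d j \<le> d' j"
  shows "\<exists>X. bounded_clinear_on K K' X \<and> inj_on X K \<and> (\<forall>x\<in>K. X (N x) = N' (X x)) \<and>
    (d = d' \<longrightarrow> K' \<subseteq> closure (X ` K))"
proof -
  interpret A: nilpotent_pair K N M n by fact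
  interpret A': nilpotent_pair K M N n by (rule A.adjoint_pair)
  interpret B: nilpotent_pair K' N' M' n' by fact
  note D = A'.jordan_systemD[OF sys] and D' = B.jordan_systemD[OF sys']
  define F where "F j x = (\<Sum>i<d j. cinner x ((M ^^ i) (v j)) *\<^sub>C (N' ^^ (d' j - 1 - i)) (v' j))" for j x
  define b where "b j = (\<Sum>i<d j. norm ((M ^^ i) (v j)) * norm ((N' ^^ (d' j - 1 - i)) (v' j)))" for j
  define \<epsilon> where "\<epsilon> j = (1 / 2) ^ j / (1 + b j)" for j
  have b0: "0 \<le> b j" for j by (simp add: b_def sum_nonneg)
  have \<epsilon>0: "0 < \<epsilon> j" for j using b0[of j] by (simp add: \<epsilon>_def)
  define X where "X x = (\<Sum>j. complex_of_real (\<epsilon> j) *\<^sub>C F j x)" for x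
  have Fbound: "norm (F j x) \<le> b j * norm x" for j x
  proof -
    have "norm (F j x) \<le> (\<Sum>i<d j. norm (cinner x ((M ^^ i) (v j)) *\<^sub>C (N' ^^ (d' j - 1 - i)) (v' j)))"
      unfolding F_def by (rule norm_sum)
    also have "\<dots> \<le> (\<Sum>i<d j. norm ((M ^^ i) (v j)) * norm ((N' ^^ (d' j - 1 - i)) (v' j)) * norm x)"
    proof (rule sum_mono)
      fix i
      show "norm (cinner x ((M ^^ i) (v j)) *\<^sub>C (N' ^^ (d' j - 1 - i)) (v' j))
        \<le> norm ((M ^^ i) (v j)) * norm ((N' ^^ (d' j - 1 - i)) (v' j)) * norm x"
        using mult_right_mono[OF cinner_cauchy_schwarz[of x "(M ^^ i) (v j)"],
            of "norm ((N' ^^ (d' j - 1 - i)) (v' j))"]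
        by (simp add: norm_scaleC mult_ac)
    qed
    finally show ?thesis by (simp add: b_def sum_distrib_right)
  qed
  have FL: "F j x \<in> K'" for j x
    unfolding F_def using B.NK[OF D'(1)] B.Kmem(6) by (intro B.K_sum) blast
  have term_bound: "norm (complex_of_real (\<epsilon> j) *\<^sub>C F j x) \<le> (1 / 2) ^ j * norm x" for j x
  proof -
    have "norm (complex_of_real (\<epsilon> j) *\<^sub>C F j x) = \<epsilon> j * norm (F j x)"
      using \<epsilon>0[of j] by (simp add: norm_scaleC)
    also have "\<dots> \<le> \<epsilon> j * ((1 + b j) * norm x)"
      by (rule mult_left_mono[OF order_trans[OF Fbound mult_right_mono]]) (use \<epsilon>0[of j] in auto)
    also have "\<epsilon> j * ((1 + b j) * norm x) = (\<epsilon> j * (1 + b j)) * norm x" by simp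
    also have "\<epsilon> j * (1 + b j) = (1 / 2) ^ j" using b0[of j] by (simp add: \<epsilon>_def)
    finally show ?thesis .
  qed
  have terms: "bounded_clinear_on K K' (\<lambda>x. complex_of_real (\<epsilon> j) *\<^sub>C F j x)" for j
  proof (rule bounded_clinear_onI[OF _ _ _ term_bound])
    fix x y c
    have "F j (x + y) = F j x + F j y"
      by (simp add: F_def cinner_add_left complex_vector.scale_left_distrib sum.distrib)
    then show "complex_of_real (\<epsilon> j) *\<^sub>C F j (x + y) = complex_of_real (\<epsilon> j) *\<^sub>C F j x + complex_of_real (\<epsilon> j) *\<^sub>C F j y"
      by (simp add: complex_vector.scale_right_distrib)
    have "F j (c *\<^sub>C x) = c *\<^sub>C F j x"
      by (simp add: F_def cinner_scaleC_left complex_vector.scale_sum_right)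
    then show "complex_of_real (\<epsilon> j) *\<^sub>C F j (c *\<^sub>C x) = c *\<^sub>C complex_of_real (\<epsilon> j) *\<^sub>C F j x"
      by (simp add: mult.commute)
  qed (use FL B.Kmem(6) in blast)
  note series = bounded_operator_series[OF A.K B.K terms term_bound]
  have X: "bounded_clinear_on K K' X"
    using series(1) by (simp add: X_def[abs_def])
  note sm = series(2)
  have inter: "X (N x) = N' (X x)" if x: "x \<in> K" for x
  proof -
    have FN: "F j (N x) = N' (F j x)" for j
    proof -
      let ?w = "\<lambda>i. (N' ^^ i) (v' j)"
      have mem: "cinner x ((M ^^ i) (v j)) *\<^sub>C ?w (d' j - 1 - i) \<in> K'" for i
        using B.NK[OF D'(1)] B.Kmem(6) by blast
      have "N' (F j x) = (\<Sum>i<d j. N' (cinner x ((M ^^ i) (v j)) *\<^sub>C ?w (d' j - 1 - i)))"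
        unfolding F_def by (rule bounded_clinear_on_sum[OF B.N B.K mem])
      also have "\<dots> = (\<Sum>i<d j. cinner x ((M ^^ i) (v j)) *\<^sub>C ?w (d' j - i))"
      proof (rule sum.cong[OF refl])
        fix i assume "i \<in> {..<d j}"
        then have "d' j - i = Suc (d' j - 1 - i)" using le[of j] by simp
        then show "N' (cinner x ((M ^^ i) (v j)) *\<^sub>C ?w (d' j - 1 - i)) = cinner x ((M ^^ i) (v j)) *\<^sub>C ?w (d' j - i)"
          using bounded_clinear_onD(3)[OF B.N B.NK[OF D'(1)]] by simp
      qed
      also have "\<dots> = F j (N x)"
      proof (cases "d j")
        case 0
        then show ?thesis by (simp add: F_def)
      next
        case (Suc e)
        have "(\<Sum>i<d j. cinner x ((M ^^ i) (v j)) *\<^sub>C ?w (d' j - i))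
            = (\<Sum>i<e. cinner x ((M ^^ Suc i) (v j)) *\<^sub>C ?w (d' j - Suc i))"
          unfolding Suc sum.lessThan_Suc_shift by (simp add: D'(3))
        also have "\<dots> = (\<Sum>i<d j. cinner x ((M ^^ Suc i) (v j)) *\<^sub>C ?w (d' j - Suc i))"
          using D(3)[of j] unfolding Suc by simp
        also have "\<dots> = F j (N x)"
          unfolding F_def using x A.MK[OF D(1)] by (intro sum.cong refl) (simp add: A.adj)
        finally show ?thesis .
      qed
      finally show ?thesis ..
    qed
    have NP: "bounded_linear (\<lambda>z. N' (cproj K' z))"
    proof (rule bop_bounded_linear)
      have "bounded_clinear_on UNIV K' (cproj K')"
        using bounded_clinear_on_subset[OF bop_cproj[OF B.K] subset_UNIV] cproj_in[OF B.K] by blast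
      then have "bounded_clinear_on UNIV K' (\<lambda>z. N' (cproj K' z))"
        using B.N by (rule bounded_clinear_on_comp)
      then show "bop (\<lambda>z. N' (cproj K' z))" by (rule bounded_clinear_on_subset) auto
    qed
    have "N' (X x) = N' (cproj K' (X x))"
      using cproj_id[OF B.K] bounded_clinear_onD(1)[OF X x] by simp
    also have "\<dots> = (\<Sum>j. N' (cproj K' (complex_of_real (\<epsilon> j) *\<^sub>C F j x)))"
      unfolding X_def by (rule bounded_linear.suminf[OF NP sm[OF x]])
    also have "\<dots> = (\<Sum>j. complex_of_real (\<epsilon> j) *\<^sub>C F j (N x))"
      using FL B.Kmem(6) by (simp add: cproj_id[OF B.K] bounded_clinear_onD(3)[OF B.N] FN)
    finally show ?thesis by (simp add: X_def)
  qed
  have coord: "cinner x ((M ^^ a) (v l)) = 0" if x: "x \<in> K" and X0: "X x = 0" for x a l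
  proof (cases "a < d l")
    case False
    then have "(M ^^ a) (v l) = 0" using A'.N_pow_mono[OF D(1,3)] by simp
    then show ?thesis by simp
  next
    case True
    have Fc: "cinner (F j x) ((M' ^^ a) (y' l)) = (if j = l then cinner x ((M ^^ a) (v l)) else 0)" for j
    proof -
      have "cinner (F j x) ((M' ^^ a) (y' l)) = (\<Sum>i<d j. cinner x ((M ^^ i) (v j)) *
          (if j = l \<and> Suc (a + (d' j - 1 - i)) = d' j then 1 else 0))"
        unfolding F_def cinner_sum_left cinner_scaleC_left
        by (simp add: B.adj_pow[OF B.NK[OF D'(1)] D'(2), symmetric]
            funpow_add[THEN fun_cong, unfolded comp_def, symmetric] D'(5))
      also have "\<dots> = (\<Sum>i<d j. if i = a then (if j = l then cinner x ((M ^^ a) (v l)) else 0) else 0)"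
      proof (rule sum.cong[OF refl])
        fix i assume "i \<in> {..<d j}"
        then have "Suc (a + (d' j - 1 - i)) = d' j \<longleftrightarrow> i = a" using le[of j] by auto
        then show "cinner x ((M ^^ i) (v j)) * (if j = l \<and> Suc (a + (d' j - 1 - i)) = d' j then 1 else 0)
          = (if i = a then (if j = l then cinner x ((M ^^ a) (v l)) else 0) else 0)" by simp
      qed
      also have "\<dots> = (if j = l then cinner x ((M ^^ a) (v l)) else 0)" using True by simp
      finally show ?thesis .
    qed
    have "0 = cinner (X x) ((M' ^^ a) (y' l))" by (simp add: X0)
    also have "\<dots> = (\<Sum>j. cinner (complex_of_real (\<epsilon> j) *\<^sub>C F j x) ((M' ^^ a) (y' l)))"
      unfolding X_def by (rule bounded_linear.suminf[OF bounded_linear_cinner_left sm[OF x]])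
    also have "\<dots> = (\<Sum>j. if j = l then complex_of_real (\<epsilon> l) * cinner x ((M ^^ a) (v l)) else 0)"
      by (intro arg_cong[where f = suminf] ext) (simp add: cinner_scaleC_left Fc)
    also have "\<dots> = complex_of_real (\<epsilon> l) * cinner x ((M ^^ a) (v l))"
      by (rule sums_unique[OF sums_single, symmetric])
    finally show ?thesis using \<epsilon>0[of l] by simp
  qed
  have "inj_on X K"
  proof (rule inj_onI)
    fix x y assume xy: "x \<in> K" "y \<in> K" "X x = X y"
    then have mem: "x - y \<in> K" using A.Kmem(5) by blast
    have "X (x - y) = 0" using bounded_clinear_on_diff[OF X A.K] xy by simp
    then have "x - y = 0"
      using coord[OF mem] by (intro D(8)[OF mem]) (simp add: cinner_eq_0_commute[of _ "x - y"])
    then show "x = y" by simp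
  qed
  moreover have "K' \<subseteq> closure (X ` K)" if dd: "d = d'"
  proof -
    have sub: "csubspace (X ` K)"
      unfolding complex_vector.subspace_def
    proof (intro conjI ballI allI)
      show "0 \<in> X ` K" using bounded_clinear_on_0[OF X A.K] A.Kmem(3) by (metis image_eqI)
      fix p q c assume "p \<in> X ` K"
      then obtain x where x: "x \<in> K" "p = X x" by blast
      show "c *\<^sub>C p \<in> X ` K"
        using bounded_clinear_onD(3)[OF X x(1)] A.Kmem(6)[OF x(1)] x(2) by (metis image_eqI)
      assume "q \<in> X ` K"
      then obtain z where z: "z \<in> K" "q = X z" by blast
      show "p + q \<in> X ` K"
        using bounded_clinear_onD(2)[OF X x(1) z(1)] A.Kmem(4)[OF x(1) z(1)] x(2) z(2)
        by (metis image_eqI)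
    qed
    have gen: "(N' ^^ a) (v' l) \<in> X ` K" for a l
    proof (cases "a < d l")
      case False
      then have "(N' ^^ a) (v' l) = 0" using B.N_pow_mono[OF D'(1,3)] dd by simp
      then show ?thesis using sub by (simp add: complex_vector.subspace_0)
    next
      case True
      let ?x = "(N ^^ a) (y l)"
      have xK: "?x \<in> K" by (rule A.NK[OF D(2)])
      have Fx: "F j ?x = (if j = l then (N' ^^ a) (v' l) else 0)" for j
      proof -
        have "cinner ?x ((M ^^ i) (v j)) = (if j = l \<and> Suc (a + i) = d j then 1 else 0)" for i
        proof -
          have "cinner ?x ((M ^^ i) (v j)) = cinner (y l) ((M ^^ (a + i)) (v j))"
            using A.adj_pow[OF D(2) A.MK[OF D(1)]] by (simp add: funpow_add)
          also have "\<dots> = cnj (cinner ((M ^^ (a + i)) (v j)) (y l))" by (rule cinner_commute)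
          finally show ?thesis by (simp add: D(5))
        qed
        then have "F j ?x = (\<Sum>i<d j. (if j = l \<and> Suc (a + i) = d j then 1 else 0) *\<^sub>C (N' ^^ (d' j - 1 - i)) (v' j))"
          by (simp add: F_def)
        also have "\<dots> = (\<Sum>i<d j. if i = d j - 1 - a then (if j = l then (N' ^^ a) (v' l) else 0) else 0)"
        proof (rule sum.cong[OF refl])
          fix i assume i: "i \<in> {..<d j}"
          show "(if j = l \<and> Suc (a + i) = d j then 1 else 0) *\<^sub>C (N' ^^ (d' j - 1 - i)) (v' j)
            = (if i = d j - 1 - a then (if j = l then (N' ^^ a) (v' l) else 0) else 0)"
          proof (cases "j = l")
            case jl: True
            have "Suc (a + i) = d j \<longleftrightarrow> i = d j - 1 - a" "i = d j - 1 - a \<Longrightarrow> d' j - 1 - i = a"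
              using i True jl dd by auto
            then show ?thesis using jl by simp
          qed simp
        qed
        also have "\<dots> = (if j = l then (N' ^^ a) (v' l) else 0)" using True by simp
        finally show ?thesis .
      qed
      have "X ?x = (\<Sum>j. if j = l then complex_of_real (\<epsilon> l) *\<^sub>C (N' ^^ a) (v' l) else 0)"
        unfolding X_def by (intro arg_cong[where f = suminf] ext) (simp add: Fx)
      also have "\<dots> = complex_of_real (\<epsilon> l) *\<^sub>C (N' ^^ a) (v' l)"
        by (rule sums_unique[OF sums_single, symmetric])
      finally have "complex_of_real (\<epsilon> l) *\<^sub>C (N' ^^ a) (v' l) \<in> X ` K" using xK by (metis image_eqI)
      from complex_vector.subspace_scale[OF sub this, of "1 / complex_of_real (\<epsilon> l)"]
      show ?thesis using \<epsilon>0[of l] by simp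
    qed
    have XK: "X ` K \<subseteq> K'" using bounded_clinear_onD(1)[OF X] by blast
    have "closure (X ` K) = K'"
    proof (rule eq_if_orth_minus_trivial[OF closed_csubspace_closure[OF sub] B.K])
      show "closure (X ` K) \<subseteq> K'" using XK B.Kmem(2) by (rule closure_minimal)
      fix x assume x: "x \<in> K'" "\<And>z. z \<in> closure (X ` K) \<Longrightarrow> cinner x z = 0"
      show "x = 0"
      proof (rule D'(8)[OF x(1)])
        fix j i
        have "cinner x ((N' ^^ i) (v' j)) = 0" using gen closure_subset by (intro x(2)) blast
        then show "cinner ((N' ^^ i) (v' j)) x = 0" by (simp add: cinner_eq_0_commute)
      qed
    qed
    then show ?thesis by simp
  qed
  ultimately show ?thesis using X inter by blast
qed

text \<open>The counts determine the lengths \<open>d k\<close> of the chains of any Jordan system, of the operator and of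
  its adjoint.  Thus the operators can be compared chain by chain, whichever systems are chosen.\<close>

theorem chain_counts_comparison:
  assumes A: "nilpotent_pair K N M n" and B: "nilpotent_pair K' N' M' n'"
    and le: "\<And>k p. 1 \<le> p \<Longrightarrow> has_chains K N k p \<Longrightarrow> has_chains K' N' k p"
  shows "injected K N K' N'"
    and "(\<And>k p. 1 \<le> p \<Longrightarrow> has_chains K' N' k p \<Longrightarrow> has_chains K N k p) \<Longrightarrow> quasi_affine K N K' N'"
proof -
  interpret A: nilpotent_pair K N M n by fact
  interpret A': nilpotent_pair K M N n by (rule A.adjoint_pair)
  interpret B: nilpotent_pair K' N' M' n' by fact
  obtain v y d where sys: "jordan_system K M N v y d" using A'.jordan_system_exists by blast
  obtain v' y' d' where sys': "jordan_system K' N' M' v' y' d'" using B.jordan_system_exists by blast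
  have d: "p \<le> d k \<longleftrightarrow> has_chains K N k p" if "1 \<le> p" for k p
    using A'.has_chains_iff[OF sys that] A.has_chains_adjoint[OF that] by blast
  have d': "p \<le> d' k \<longleftrightarrow> has_chains K' N' k p" if "1 \<le> p" for k p
    using B.has_chains_iff[OF sys' that] by blast
  have dle: "d j \<le> d' j" for j
    using d[of "d j" j] d'[of "d j" j] le[of "d j" j] by (cases "d j") auto
  note ex = intertwiner_exists[OF A B sys sys' dle]
  then show "injected K N K' N'" unfolding injected_def by blast
  assume ge: "\<And>k p. 1 \<le> p \<Longrightarrow> has_chains K' N' k p \<Longrightarrow> has_chains K N k p"
  have "d' j \<le> d j" for j
    using d[of "d' j" j] d'[of "d' j" j] ge[of "d' j" j] by (cases "d' j") auto
  then have "d = d'" using dle by (simp add: fun_eq_iff antisym)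
  then show "quasi_affine K N K' N'" using ex unfolding quasi_affine_def by blast
qed

corollary mutually_injected_quasi_similar:
  assumes A: "nilpotent_pair K N M n" and B: "nilpotent_pair K' N' M' n'"
    and inj: "injected K N K' N'" "injected K' N' K N"
  shows "quasi_similar K N K' N'"
proof -
  note AN = nilpotent_pair.K[OF A] nilpotent_pair.N[OF A]
  note BN = nilpotent_pair.K[OF B] nilpotent_pair.N[OF B]
  show ?thesis
    unfolding quasi_similar_def
    using chain_counts_comparison(2)[OF A B] chain_counts_comparison(2)[OF B A]
      injected_has_chains[OF AN inj(1)] injected_has_chains[OF BN inj(2)] by blast
qed


section \<open>The core of a contraction\<close>

lemma closed_csubspace_Collect_all:
  assumes "\<And>k. closed_csubspace {x. P k x}"
  shows "closed_csubspace {x. \<forall>k. P k x}"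
  using assms unfolding closed_csubspace_def complex_vector.subspace_def
  by (auto intro!: closed_Collect_all)

lemma isometric_part_eq:
  "contraction T \<Longrightarrow> isometric_part T = {x. \<forall>k. defect_sq T ((T ^^ k) x) = 0}"
  by (simp add: isometric_part_def defect_sq_eq_0_iff)

lemma isometric_partI:
  "contraction T \<Longrightarrow> (\<And>k. defect_sq T ((T ^^ k) x) = 0) \<Longrightarrow> x \<in> isometric_part T"
  by (simp add: isometric_part_eq)

lemma isometric_partD:
  "contraction T \<Longrightarrow> x \<in> isometric_part T \<Longrightarrow> defect_sq T ((T ^^ k) x) = 0"
  by (simp add: isometric_part_eq)

lemma closed_csubspace_isometric_part:
  assumes T: "contraction T"
  shows "closed_csubspace (isometric_part T)"
  unfolding isometric_part_eq[OF T]
proof (rule closed_csubspace_Collect_all)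
  fix k
  have "bop (\<lambda>x. defect_sq T ((T ^^ k) x))"
    by (rule bounded_clinear_on_comp[OF bop_pow[OF contraction_bop[OF T]] bop_defect_sq[OF T]])
  from closed_csubspace_eq[OF this bop_diff[OF bop_id bop_id]]
  show "closed_csubspace {x. defect_sq T ((T ^^ k) x) = 0}" by simp
qed

lemma isometric_part_invariant:
  assumes "x \<in> isometric_part T"
  shows "T x \<in> isometric_part T" and "norm (T x) = norm x"
proof -
  have *: "norm ((T ^^ Suc k) x) = norm ((T ^^ k) x)" for k
    using assms by (simp only: isometric_part_def mem_Collect_eq)
  have "norm ((T ^^ Suc k) (T x)) = norm ((T ^^ k) (T x))" for k
    using *[of "Suc k"] by (simp add: funpow_swap1)
  then show "T x \<in> isometric_part T" by (simp only: isometric_part_def mem_Collect_eq simp_thms)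
  show "norm (T x) = norm x" using *[of 0] by simp
qed

lemma isometric_part_maximal:
  assumes "\<And>x. x \<in> E \<Longrightarrow> T x \<in> E \<and> norm (T x) = norm x"
  shows "E \<subseteq> isometric_part T"
proof
  fix x assume "x \<in> E"
  then have "(T ^^ k) x \<in> E" for k using assms by (intro pow_in) auto
  then show "x \<in> isometric_part T" using assms by (simp add: isometric_part_def)
qed

text \<open>The outer space is the smallest closed \<open>T\<close>-invariant subspace on whose complement \<open>T\<^sup>*\<close> is
  isometric.  The core is what remains of it after removing the largest invariant subspace on which
  \<open>T\<close> is isometric.\<close>

definition outer_space :: "('a::complex_hilbert \<Rightarrow> 'a) \<Rightarrow> 'a set"
  where "outer_space T = UNIV \<ominus> isometric_part (cadjoint T)"

definition core_space :: "('a::complex_hilbert \<Rightarrow> 'a) \<Rightarrow> 'a set"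
  where "core_space T = outer_space T \<ominus> (isometric_part T \<inter> outer_space T)"

lemma outer_space_iff:
  "x \<in> outer_space T \<longleftrightarrow> (\<forall>g\<in>isometric_part (cadjoint T). cinner x g = 0)"
  by (simp add: outer_space_def orth_minus_def)

lemma orth_minus_complement:
  assumes A: "closed_csubspace A" and B: "closed_csubspace B" and AB: "A \<subseteq> B"
    and x: "x \<in> B"
  shows "x - cproj (B \<ominus> A) x \<in> A"
proof -
  let ?K = "B \<ominus> A"
  have K: "closed_csubspace ?K" by (rule closed_csubspace_orth_minus[OF B])
  define w where "w = x - cproj ?K x"
  have "cproj ?K x \<in> B" using cproj_in[OF K, of x] by (simp add: orth_minus_def)
  then have "w \<in> B" unfolding w_def using x closed_csubspaceD(5)[OF B] by blast
  then have "w - cproj A w \<in> B" using cproj_in[OF A, of w] AB closed_csubspaceD(5)[OF B] by blast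
  then have mem: "w - cproj A w \<in> ?K" using cproj_orth[OF A] by (simp add: orth_minus_def)
  have "cinner w (w - cproj A w) = 0" using cproj_orth[OF K mem, of x] by (simp only: w_def)
  moreover have "cinner (cproj A w) (w - cproj A w) = 0" by (rule cproj_orth'[OF A cproj_in[OF A]])
  ultimately have "cinner (w - cproj A w) (w - cproj A w) = 0"
    unfolding cinner_diff_left[of w "cproj A w"] by simp
  then have "w = cproj A w" by simp
  then show ?thesis using cproj_in[OF A, of w] by (simp add: w_def)
qed

text \<open>The compression to a semi-invariant subspace \<open>B \<ominus> A\<close> is the operator induced on the
  quotient of \<open>B\<close> by \<open>A\<close>.\<close>

lemma compression_quotient:
  assumes T: "bop T" and A: "closed_csubspace A" and B: "closed_csubspace B" and AB: "A \<subseteq> B"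
    and TA: "\<And>x. x \<in> A \<Longrightarrow> T x \<in> A" and TB: "\<And>x. x \<in> B \<Longrightarrow> T x \<in> B" and x: "x \<in> B"
  shows "compression (B \<ominus> A) T (cproj (B \<ominus> A) x) = cproj (B \<ominus> A) (T x)"
    and "(compression (B \<ominus> A) T ^^ m) (cproj (B \<ominus> A) x) = cproj (B \<ominus> A) ((T ^^ m) x)"
proof -
  let ?K = "B \<ominus> A"
  have K: "closed_csubspace ?K" by (rule closed_csubspace_orth_minus[OF B])
  have 1: "compression ?K T (cproj ?K x) = cproj ?K (T x)" if x: "x \<in> B" for x
  proof -
    have "T (x - cproj ?K x) \<in> A" by (intro TA orth_minus_complement[OF A B AB x])
    then have "cproj ?K (T (x - cproj ?K x)) = 0"
      by (intro cproj_eq_0[OF K]) (auto simp: orth_minus_def cinner_eq_0_commute)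
    then have "cproj ?K (T x) = cproj ?K (T (cproj ?K x))"
      by (simp add: bop_simps[OF T] cproj_diff[OF K])
    then show ?thesis using cproj_in[OF K, of x] by (simp add: block_def)
  qed
  show "compression ?K T (cproj ?K x) = cproj ?K (T x)" by (rule 1[OF x])
  show "(compression ?K T ^^ m) (cproj ?K x) = cproj ?K ((T ^^ m) x)"
    by (induction m) (simp_all add: 1 pow_in[OF TB x])
qed

lemma separable_closed_csubspace:
  assumes "\<exists>D::'a::complex_hilbert set. countable D \<and> closure D = UNIV"
    and K: "closed_csubspace (K :: 'a set)"
  shows "\<exists>D\<subseteq>K. countable D \<and> K \<subseteq> closure D"
proof -
  obtain D :: "'a set" where D: "countable D" "closure D = UNIV" using assms(1) by blast
  have "cproj K ` closure D \<subseteq> closure (cproj K ` D)"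
    by (rule image_closure_subset[OF bop_continuous[OF bop_cproj[OF K]] closed_closure closure_subset])
  then have *: "cproj K x \<in> closure (cproj K ` D)" for x using D(2) by auto
  have "K \<subseteq> closure (cproj K ` D)"
  proof
    fix x assume "x \<in> K"
    then show "x \<in> closure (cproj K ` D)" using *[of x] by (simp add: cproj_id[OF K])
  qed
  moreover have "cproj K ` D \<subseteq> K" using cproj_in[OF K] by blast
  ultimately show ?thesis using D(1) by (intro exI[of _ "cproj K ` D"]) auto
qed

lemma compression_nilpotent_pair:
  assumes sep: "\<exists>D::'a::complex_hilbert set. countable D \<and> closure D = UNIV"
    and T: "contraction (T :: 'a \<Rightarrow> 'a)" and K: "closed_csubspace K"
    and nil: "\<And>x. x \<in> K \<Longrightarrow> (compression K T ^^ n) x = 0"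
  shows "nilpotent_pair K (compression K T) (compression K (cadjoint T)) n"
  by (unfold_locales, rule K, rule bounded_clinear_on_compression[OF contraction_bop[OF T] K],
      rule bounded_clinear_on_compression[OF bop_cadjoint[OF T] K],
      rule cinner_compression[OF T K], assumption+, rule nil, assumption,
      rule separable_closed_csubspace[OF sep K])

lemma nilpotent_order_adjoint:
  assumes "nilpotent_pair K N M n" and ord: "nilpotent_order K N n"
  shows "nilpotent_order K M n"
proof -
  interpret A: nilpotent_pair K N M n by fact
  interpret B: nilpotent_pair K M N n by (rule A.adjoint_pair)
  have "\<forall>x\<in>K. (N ^^ q) x = 0" if M0: "\<forall>y\<in>K. (M ^^ q) y = 0" for q
  proof
    fix x assume x: "x \<in> K"
    show "(N ^^ q) x = 0"
    proof (rule A.zero_in_K_if[OF A.NK[OF x]])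
      fix y assume y: "y \<in> K"
      then show "cinner ((N ^^ q) x) y = 0" using M0 by (simp add: A.adj_pow[OF x y])
    qed
  qed
  then show ?thesis using ord A.adjoint_nil unfolding nilpotent_order_def by blast
qed

lemma
  assumes T: "contraction T"
  shows closed_csubspace_outer_space: "closed_csubspace (outer_space T)"
    and closed_csubspace_core_space: "closed_csubspace (core_space T)"
    and outer_space_invariant: "x \<in> outer_space T \<Longrightarrow> T x \<in> outer_space T"
    and closed_csubspace_isometric_outer: "closed_csubspace (isometric_part T \<inter> outer_space T)"
proof -
  show 1: "closed_csubspace (outer_space T)"
    unfolding outer_space_def by (rule closed_csubspace_orth_minus) simp
  then show "closed_csubspace (core_space T)"
    unfolding core_space_def by (rule closed_csubspace_orth_minus)
  show "closed_csubspace (isometric_part T \<inter> outer_space T)"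
    by (intro closed_csubspace_Int 1 closed_csubspace_isometric_part T)
  show "T x \<in> outer_space T" if "x \<in> outer_space T"
    using that isometric_part_invariant(1)[of _ "cadjoint T"]
    by (simp add: outer_space_iff cinner_cadjoint[OF contraction_bop[OF T]])
qed

lemma core_space_quotient:
  assumes T: "contraction T" and x: "x \<in> outer_space T"
  shows "x - cproj (core_space T) x \<in> isometric_part T \<inter> outer_space T"
    and "(compression (core_space T) T ^^ m) (cproj (core_space T) x) = cproj (core_space T) ((T ^^ m) x)"
proof -
  show "x - cproj (core_space T) x \<in> isometric_part T \<inter> outer_space T"
    unfolding core_space_def
    by (rule orth_minus_complement[OF closed_csubspace_isometric_outer[OF T]
          closed_csubspace_outer_space[OF T] _ x]) blast
  show "(compression (core_space T) T ^^ m) (cproj (core_space T) x) = cproj (core_space T) ((T ^^ m) x)"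
    unfolding core_space_def
    by (rule compression_quotient(2)[OF contraction_bop[OF T] closed_csubspace_isometric_outer[OF T]
          closed_csubspace_outer_space[OF T] _ _ _ x])
      (use isometric_part_invariant(1) outer_space_invariant[OF T] in auto)
qed

text \<open>Passing to the adjoint in the vanishing conditions shows that \<open>T\<^sup>*\<^sup>k\<^sup>+\<^sup>n (1 - T\<^sup>*T) y\<close> lies in the
  isometric part of \<open>T\<^sup>*\<close>, to which the outer space is orthogonal.\<close>

lemma outer_space_pow_isometric:
  assumes T: "contraction T" and deg: "defect_degree T n" and x: "x \<in> outer_space T"
  shows "(T ^^ n) x \<in> isometric_part T"
proof (rule isometric_partI[OF T])
  note cT = cadjoint_contraction[OF T]
  have van: "defect_chain (cadjoint T) m y = 0" if "n \<le> m" for m y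
    using deg that unfolding defect_degree_cadjoint[OF T, symmetric] by (simp add: defect_degree_def)
  fix k
  show "defect_sq T ((T ^^ k) ((T ^^ n) x)) = 0"
  proof (rule cinner_ext)
    fix y
    have "(cadjoint T ^^ (k + n)) (defect_sq T y) \<in> isometric_part (cadjoint T)"
    proof (rule isometric_partI[OF cT])
      fix m
      show "defect_sq (cadjoint T) ((cadjoint T ^^ m) ((cadjoint T ^^ (k + n)) (defect_sq T y))) = 0"
        using van[of "m + (k + n)" y]
        by (simp add: defect_chain_def cadjoint_cadjoint contraction_bop[OF T] funpow_add)
    qed
    then have "cinner x ((cadjoint T ^^ (k + n)) (defect_sq T y)) = 0"
      using x by (simp add: outer_space_iff)
    moreover have "(T ^^ k) ((T ^^ n) x) = (T ^^ (k + n)) x" by (simp add: funpow_add)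
    ultimately show "cinner (defect_sq T ((T ^^ k) ((T ^^ n) x))) y = cinner 0 y"
      by (simp only: defect_sq_selfadjoint[OF T] cinner_pow_cadjoint[OF T] cinner_zero_left)
  qed
qed

lemma core_space_decomposition:
  assumes T: "contraction T"
  shows "shift_triangular T (isometric_part T \<inter> outer_space T) (core_space T)
    (isometric_part (cadjoint T))"
proof -
  note cT = cadjoint_contraction[OF T]
  let ?A = "isometric_part T \<inter> outer_space T" and ?B = "core_space T"
    and ?C = "isometric_part (cadjoint T)"
  have C: "closed_csubspace ?C" by (rule closed_csubspace_isometric_part[OF cT])
  have BL: "?B \<subseteq> outer_space T" by (auto simp: core_space_def orth_minus_def)
  have "x \<in> ?A \<oplus> ?B \<oplus> ?C" for x
  proof -
    have P: "cproj ?C x \<in> ?C" by (rule cproj_in[OF C])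
    have L: "x - cproj ?C x \<in> outer_space T"
      using cproj_orth[OF C] by (simp add: outer_space_iff)
    have "x = (x - cproj ?C x - cproj ?B (x - cproj ?C x)) + cproj ?B (x - cproj ?C x) + cproj ?C x"
      by simp
    with core_space_quotient(1)[OF T L] cproj_in[OF closed_csubspace_core_space[OF T]] P
    show ?thesis unfolding sum_space_def by blast
  qed
  moreover have "cinner x y = 0" if "x \<in> outer_space T" "y \<in> ?C" for x y
    using that by (simp add: outer_space_iff)
  moreover have "cinner x y = 0" if "x \<in> ?A" "y \<in> ?B" for x y
    using that unfolding core_space_def orth_minus_def
    by (subst cinner_eq_0_commute) blast
  ultimately have "orth_decomposition ?A ?B ?C"
    using C BL closed_csubspace_core_space[OF T] closed_csubspace_isometric_outer[OF T]
    unfolding orth_decomposition_def by blast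
  then show ?thesis
    unfolding shift_triangular_def
    using isometric_part_invariant outer_space_invariant[OF T] by blast
qed

text \<open>On the quotient of the outer space by its isometric part, \<open>T\<^sup>n = 0\<close> because \<open>T\<^sup>n\<close> maps the
  outer space into the isometric part, and no smaller power vanishes because the degree is exactly
  \<open>n\<close>.\<close>

lemma core_space_nilpotent:
  assumes T: "contraction T" and deg: "defect_degree T n"
  shows "nilpotent_order (core_space T) (compression (core_space T) T) n"
  unfolding nilpotent_order_def
proof (intro conjI ballI allI impI notI)
  let ?K = "core_space T" and ?N = "compression (core_space T) T"
  have K: "closed_csubspace ?K" by (rule closed_csubspace_core_space[OF T])
  have KL: "x \<in> outer_space T" if "x \<in> ?K" for x using that by (simp add: core_space_def orth_minus_def)
  have TL: "(T ^^ m) x \<in> outer_space T" if "x \<in> outer_space T" for m x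
    by (rule pow_in[OF outer_space_invariant[OF T] that])
  have pow: "(?N ^^ m) x = cproj ?K ((T ^^ m) x)" if "x \<in> ?K" for m x
    using core_space_quotient(2)[OF T KL[OF that], of m] that by (simp add: cproj_id[OF K])
  {
    fix x assume x: "x \<in> ?K"
    have "(T ^^ n) x \<in> isometric_part T \<inter> outer_space T"
      using outer_space_pow_isometric[OF T deg] TL KL[OF x] by blast
    then have "cproj ?K ((T ^^ n) x) = 0"
      by (intro cproj_eq_0[OF K]) (auto simp: core_space_def orth_minus_def cinner_eq_0_commute)
    then show "(?N ^^ n) x = 0" by (simp add: pow[OF x])
  }
  {
    fix q assume q: "q < n" and zero: "\<forall>x\<in>?K. (?N ^^ q) x = 0"
    \<comment> \<open>Then \<open>T\<^sup>n\<^sup>-\<^sup>1\<close> maps the outer space into the isometric part, and the last coefficient of the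
      characteristic function vanishes.\<close>
    have isoq: "(T ^^ q) x \<in> isometric_part T" if x: "x \<in> outer_space T" for x
    proof -
      have "cproj ?K ((T ^^ q) x) = 0"
        using core_space_quotient(2)[OF T x, of q] zero cproj_in[OF K, of x] by simp
      then show ?thesis using core_space_quotient(1)[OF T TL[OF x], of q] by simp
    qed
    have iso: "(T ^^ (n - 1)) x \<in> isometric_part T" if "x \<in> outer_space T" for x
    proof -
      have "(T ^^ (n - 1 - q)) ((T ^^ q) x) \<in> isometric_part T"
        by (rule pow_in[OF isometric_part_invariant(1) isoq[OF that]])
      then show ?thesis using q funpow_add[of "n - 1 - q" q T] by simp
    qed
    have "defect_chain T (n - 1) y = 0" for y
    proof -
      have "defect_sq (cadjoint T) y \<in> outer_space T"
        using isometric_partD[OF cadjoint_contraction[OF T], of _ 0]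
        by (simp add: outer_space_iff defect_sq_selfadjoint[OF cadjoint_contraction[OF T]])
      from isometric_partD[OF T iso[OF this], of 0] show ?thesis by (simp add: defect_chain_def)
    qed
    then show False using deg q by (auto simp: defect_degree_def)
  }
qed

text \<open>Minimality of the core.  For a representation on \<open>H1 \<oplus> H2 \<oplus> H3\<close>, the invariant subspace
  \<open>H1 \<oplus> H2\<close> contains the outer space, and the central operator has as quotient the operator
  induced on \<open>H1 \<oplus> H2\<close> modulo its whole isometric part.  The core operator injects into that
  quotient.  A quotient need not inject into the operator, but its adjoint is a restriction of the
  adjoint; as chain counts are the same for an operator and its adjoint, this is enough.\<close>

lemma core_space_chains_least:
  assumes sep: "\<exists>D::'a::complex_hilbert set. countable D \<and> closure D = UNIV"
    and T: "contraction (T :: 'a \<Rightarrow> 'a)"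
    and tri: "shift_triangular T H1 H2 H3" and nil: "\<And>x. x \<in> H2 \<Longrightarrow> (compression H2 T ^^ n) x = 0"
    and p: "1 \<le> p" and chains: "has_chains (core_space T) (compression (core_space T) T) k p"
  shows "has_chains H2 (compression H2 T) k p"
proof -
  note Tb = contraction_bop[OF T] and cT = cadjoint_contraction[OF T]
  let ?S = "cadjoint T" and ?C = "core_space T"
  have dec: "orth_decomposition H1 H2 H3" using tri by (simp add: shift_triangular_def)
  note D = orth_decompositionD[OF dec]
  have T1: "T x \<in> H1" if "x \<in> H1" for x using tri that by (auto simp: shift_triangular_def)
  have H1M: "H1 \<subseteq> isometric_part T"
    using tri by (intro isometric_part_maximal) (auto simp: shift_triangular_def)
  have H3M: "H3 \<subseteq> isometric_part ?S"
    using tri by (intro isometric_part_maximal) (auto simp: shift_triangular_def)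
  define L where "L = UNIV \<ominus> H3"
  have L_iff: "x \<in> L \<longleftrightarrow> (\<forall>z\<in>H3. cinner x z = 0)" for x by (simp add: L_def orth_minus_def)
  have L: "closed_csubspace L" unfolding L_def by (rule closed_csubspace_orth_minus) simp
  have TL: "T x \<in> L" if "x \<in> L" for x
    using that tri by (auto simp: L_iff cinner_cadjoint[OF Tb] shift_triangular_def)
  have outer: "outer_space T \<subseteq> L" unfolding subset_iff L_iff outer_space_iff using H3M by blast
  have split: "\<exists>a\<in>H1. \<exists>b\<in>H2. x = a + b" if "x \<in> L" for x
  proof -
    obtain a b c where abc: "a \<in> H1" "b \<in> H2" "c \<in> H3" "x = a + b + c"
      by (rule orth_decomposition_split[OF dec])
    have "cinner x c = 0" using that abc(3) by (simp add: L_iff)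
    then have "c = 0" using D(5)[OF abc(1,3)] D(6)[OF abc(2,3)] by (simp add: abc(4) cinner_add_left)
    then show ?thesis using abc by auto
  qed
  define G where "G = isometric_part T \<inter> L"
  have G: "closed_csubspace G"
    unfolding G_def by (intro closed_csubspace_Int closed_csubspace_isometric_part T L)
  have TG: "T x \<in> G" if "x \<in> G" for x
    using that TL isometric_part_invariant(1) by (auto simp: G_def)
  have GL: "G \<subseteq> L" by (simp add: G_def)
  have H1G: "H1 \<subseteq> G" using H1M D(5) by (auto simp: G_def L_iff)
  define K where "K = L \<ominus> G"
  have K: "closed_csubspace K" unfolding K_def by (rule closed_csubspace_orth_minus[OF L])
  have KG: "cinner x g = 0" if "x \<in> K" "g \<in> G" for x g using that by (simp add: K_def orth_minus_def)
  have KH2: "K \<subseteq> H2"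
  proof
    fix x assume x: "x \<in> K"
    then have "x \<in> L" by (simp add: K_def orth_minus_def)
    then obtain a b where ab: "a \<in> H1" "b \<in> H2" "x = a + b" using split by blast
    have "cinner x a = 0" using KG[OF x] ab(1) H1G by blast
    then have "a = 0" using D(7)[OF ab(2,1)] by (simp add: ab(3) cinner_add_left)
    then show "x \<in> H2" using ab by simp
  qed
  \<comment> \<open>\<open>K\<close> is invariant under the adjoint of the central operator.\<close>
  have adj_eq: "compression H2 ?S x = compression K ?S x" if x: "x \<in> K" for x
  proof -
    have mem: "cproj H2 (?S x) \<in> H2" by (rule cproj_in[OF D(2)])
    have "cinner (cproj H2 (?S x)) g = 0" if g: "g \<in> G" for g
    proof -
      obtain a b where ab: "a \<in> H1" "b \<in> H2" "g = a + b" using split g GL by blast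
      have "cinner (cproj H2 (?S x)) g = cinner (?S x) b"
        using D(7)[OF mem ab(1)] by (simp add: ab(3) cinner_add_right cproj_cinner[OF D(2) ab(2)])
      also have "\<dots> = cinner x (T g) - cinner x (T a)"
        by (simp add: ab(3) cinner_cadjoint'[OF Tb] bop_simps[OF Tb] cinner_add_right)
      also have "\<dots> = 0" using KG[OF x] TG[OF g] T1[OF ab(1)] H1G by auto
      finally show ?thesis .
    qed
    moreover have "cproj H2 (?S x) \<in> L" using mem D(6) by (simp add: L_iff)
    ultimately have "cproj H2 (?S x) \<in> K" by (simp add: K_def orth_minus_def)
    then have "cproj K (?S x) = cproj H2 (?S x)"
      by (rule cproj_unique[OF K]) (use KH2 cproj_orth[OF D(2)] in blast)
    then show ?thesis using x KH2 by (auto simp: block_def)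
  qed
  have pairH2: "nilpotent_pair H2 (compression H2 T) (compression H2 ?S) n"
    by (rule compression_nilpotent_pair[OF sep T D(2) nil])
  have KK: "compression K ?S x \<in> K" if "x \<in> K" for x
    using that by (simp add: block_def cproj_in[OF K])
  have pairK: "nilpotent_pair K (compression K ?S) (compression K T) n"
  proof -
    have "(compression K ?S ^^ n) x = 0" if x: "x \<in> K" for x
    proof -
      have "(compression H2 ?S ^^ n) x = (compression K ?S ^^ n) x"
        by (rule pow_cong[OF KK adj_eq x])
      then show ?thesis using nilpotent_pair.adjoint_nil[OF pairH2] x KH2 by auto
    qed
    from compression_nilpotent_pair[OF sep cT K this] show ?thesis
      by (simp add: cadjoint_cadjoint[OF Tb])
  qed
  have C: "closed_csubspace ?C" by (rule closed_csubspace_core_space[OF T])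
  have CL: "x \<in> outer_space T" if "x \<in> ?C" for x using that by (simp add: core_space_def orth_minus_def)
  have quot: "compression K T (cproj K x) = cproj K (T x)" if "x \<in> L" for x
    unfolding K_def by (rule compression_quotient(1)[OF Tb G L GL TG TL that])
  have "injected ?C (compression ?C T) K (compression K T)"
    unfolding injected_def
  proof (intro exI[of _ "cproj K"] conjI ballI)
    show "bounded_clinear_on ?C K (cproj K)"
      by (rule bounded_clinear_on_subset[OF bop_cproj[OF K]]) (auto simp: cproj_in[OF K])
    show "inj_on (cproj K) ?C"
    proof (rule inj_onI)
      fix x y assume xy: "x \<in> ?C" "y \<in> ?C" "cproj K x = cproj K y"
      have m: "x - y \<in> ?C" using xy closed_csubspaceD(5)[OF C] by blast
      then have "x - y \<in> L" using CL outer by blast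
      from orth_minus_complement[OF G L GL this] have "x - y \<in> G"
        using xy(3) by (simp add: K_def[symmetric] cproj_diff[OF K])
      then have "x - y \<in> isometric_part T \<inter> outer_space T" using CL[OF m] by (simp add: G_def)
      then have "cinner (x - y) (x - y) = 0" using m unfolding core_space_def orth_minus_def by blast
      then show "x = y" by simp
    qed
    fix x assume x: "x \<in> ?C"
    have TxL: "T x \<in> outer_space T" by (rule outer_space_invariant[OF T CL[OF x]])
    have "T x - cproj ?C (T x) \<in> G"
      using core_space_quotient(1)[OF T TxL] outer by (auto simp: G_def)
    then have "cproj K (T x - cproj ?C (T x)) = 0"
      using KG by (intro cproj_eq_0[OF K]) (auto simp: cinner_eq_0_commute)
    then have "cproj K (cproj ?C (T x)) = cproj K (T x)" by (simp add: cproj_diff[OF K])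
    also have "\<dots> = compression K T (cproj K x)" using quot[of x] CL[OF x] outer by auto
    finally show "cproj K (compression ?C T x) = compression K T (cproj K x)"
      using x by (simp add: block_def)
  qed
  from injected_has_chains[OF C bounded_clinear_on_compression[OF Tb C] this chains]
  have "has_chains K (compression K ?S) k p"
    using nilpotent_pair.has_chains_adjoint[OF pairK p] by blast
  moreover have "injected K (compression K ?S) H2 (compression H2 ?S)"
    unfolding injected_def
  proof (intro exI[of _ "\<lambda>x. x"] conjI ballI)
    show "bounded_clinear_on K H2 (\<lambda>x. x)"
      by (rule bounded_clinear_onI[where B = 1]) (use KH2 in auto)
  qed (simp_all add: adj_eq)
  ultimately have "has_chains H2 (compression H2 ?S) k p"
    using injected_has_chains[OF K nilpotent_pair.N[OF pairK]] by blast
  then show ?thesis using nilpotent_pair.has_chains_adjoint[OF pairH2 p] by blast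
qed


section \<open>Canonical decompositions and ultra-minimality\<close>

text \<open>For \<open>k \<ge> n\<close>, the vanishing conditions say that \<open>1 - T\<^sup>*T\<close> annihilates \<open>T\<^sup>m T\<^sup>k D\<^sub>*\<close> for every \<open>m\<close>, and
  \<open>D\<^sub>* T\<^sup>*\<^sup>k\<close> vanishes on the isometric part of \<open>T\<^sup>*\<close>.\<close>

lemma H1_can_subset:
  assumes T: "contraction T" and deg: "defect_degree T n"
  shows "H1_can n T \<subseteq> isometric_part T \<inter> outer_space T"
  unfolding H1_can_def
proof (rule closed_cspan_minimal[OF _ closed_csubspace_isometric_outer[OF T]])
  note Tb = contraction_bop[OF T] and cT = cadjoint_contraction[OF T]
  let ?G = "isometric_part T \<inter> outer_space T" and ?S = "cadjoint T" and ?D = "defect_op (cadjoint T)"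
  have van: "?D ((?S ^^ m) (defect_sq T y)) = 0" if "n \<le> m" for m y
  proof -
    have "defect_chain ?S m y = 0"
      using deg that unfolding defect_degree_cadjoint[OF T, symmetric] by (simp add: defect_degree_def)
    then show ?thesis by (simp add: defect_op_eq_0[OF cT] defect_chain_def cadjoint_cadjoint[OF Tb])
  qed
  have "(T ^^ k) (?D x) \<in> ?G" if k: "n \<le> k" for k x
  proof
    show "(T ^^ k) (?D x) \<in> isometric_part T"
    proof (rule isometric_partI[OF T], rule cinner_ext)
      fix m y
      have "(T ^^ m) ((T ^^ k) (?D x)) = (T ^^ (m + k)) (?D x)" by (simp add: funpow_add)
      moreover have "?D ((?S ^^ (m + k)) (defect_sq T y)) = 0" using k by (intro van) simp
      ultimately show "cinner (defect_sq T ((T ^^ m) ((T ^^ k) (?D x)))) y = cinner 0 y"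
        by (simp only: defect_sq_selfadjoint[OF T] cinner_pow_cadjoint[OF T]
            defect_op_selfadjoint[OF cT] cinner_zero_left cinner_zero_right)
    qed
    show "(T ^^ k) (?D x) \<in> outer_space T"
      unfolding outer_space_iff
    proof
      fix g assume "g \<in> isometric_part ?S"
      then have "?D ((?S ^^ k) g) = 0"
        using isometric_partD[OF cT] by (simp add: defect_op_eq_0[OF cT])
      then show "cinner ((T ^^ k) (?D x)) g = 0"
        by (simp add: cinner_pow_cadjoint[OF T] defect_op_selfadjoint[OF cT])
    qed
  qed
  then have "range ?D \<subseteq> {h. (T ^^ k) h \<in> ?G}" if "n \<le> k" for k using that by blast
  moreover have "closed {h. (T ^^ k) h \<in> ?G}" for k
    by (rule closed_csubspaceD(2)[OF closed_csubspace_vimage[OF bop_pow[OF Tb]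
            closed_csubspace_isometric_outer[OF T]]])
  ultimately have "defect_space_star T \<subseteq> {h. (T ^^ k) h \<in> ?G}" if "n \<le> k" for k
    unfolding defect_space_star_eq[OF T] defect_space_def using that by (intro closure_minimal) auto
  then show "{(T ^^ k) h |k h. h \<in> defect_space_star T \<and> n \<le> k} \<subseteq> ?G" by blast
qed

text \<open>As \<open>H1_can n T\<close> is part of the isometric part of the outer space, it makes no difference whether
  that part is removed at once or \<open>H1_can n T\<close> first and the remainder afterwards.\<close>

lemma H00_can_eq:
  assumes T: "contraction T" and deg: "defect_degree T n"
  shows "H00_can n T = core_space T"
proof -
  let ?H = "H1_can n T" and ?G = "isometric_part T \<inter> outer_space T"
  have H: "closed_csubspace ?H" unfolding H1_can_def by (rule closed_csubspace_closed_cspan)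
  note HG = H1_can_subset[OF T deg] and G = closed_csubspace_isometric_outer[OF T]
  have H0: "x \<in> H0_can n T \<longleftrightarrow> x \<in> outer_space T \<and> (\<forall>h\<in>?H. cinner x h = 0)" for x
  proof
    assume x: "x \<in> H0_can n T"
    have "cinner x (h + g) = 0" if "h \<in> ?H" "g \<in> isometric_part (cadjoint T)" for h g
      using x that unfolding H0_can_def orth_minus_def sum_space_def by blast
    from this[OF closed_csubspaceD(3)[OF H]]
      this[OF _ closed_csubspaceD(3)[OF closed_csubspace_isometric_part[OF cadjoint_contraction[OF T]]]]
    show "x \<in> outer_space T \<and> (\<forall>h\<in>?H. cinner x h = 0)" by (simp add: outer_space_iff)
  next
    assume "x \<in> outer_space T \<and> (\<forall>h\<in>?H. cinner x h = 0)"
    then show "x \<in> H0_can n T"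
      by (auto simp: H0_can_def orth_minus_def sum_space_def outer_space_iff cinner_add_right)
  qed
  show ?thesis
  proof (intro equalityI subsetI)
    fix x assume "x \<in> H00_can n T"
    then have x: "x \<in> H0_can n T" and orth: "\<And>z. z \<in> isometric_part T \<Longrightarrow> z \<in> H0_can n T \<Longrightarrow> cinner x z = 0"
      by (auto simp: H00_can_def orth_minus_def)
    have "cinner x z = 0" if z: "z \<in> ?G" for z
    proof -
      have P: "cproj ?H z \<in> ?H" by (rule cproj_in[OF H])
      then have "z - cproj ?H z \<in> ?G" using HG z closed_csubspaceD(5)[OF G] by blast
      moreover have "z - cproj ?H z \<in> H0_can n T"
        unfolding H0 using calculation cproj_orth[OF H] by blast
      ultimately have "cinner x (z - cproj ?H z) = 0" using orth by blast
      moreover have "cinner x (cproj ?H z) = 0" using x P by (simp add: H0)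
      ultimately show ?thesis by (simp add: cinner_diff_right)
    qed
    then show "x \<in> core_space T" using x by (simp add: core_space_def orth_minus_def H0)
  next
    fix x assume x: "x \<in> core_space T"
    then have "x \<in> H0_can n T" using HG by (auto simp: H0 core_space_def orth_minus_def)
    moreover have "cinner x z = 0" if "z \<in> isometric_part T" "z \<in> H0_can n T" for z
      using x that by (auto simp: H0 core_space_def orth_minus_def)
    ultimately show "x \<in> H00_can n T" by (auto simp: H00_can_def orth_minus_def)
  qed
qed

lemma sum_space_commute: "K \<oplus> L = L \<oplus> (K :: 'a::complex_hilbert set)"
  unfolding sum_space_def by (auto intro: add.commute)

lemma H0_star0_can_eq:
  assumes T: "contraction T"
  shows "H0_star0_can n T = H00_can n (cadjoint T)"
proof -
  have "defect_space T = defect_space_star (cadjoint T)"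
    using defect_space_star_eq[OF cadjoint_contraction[OF T]]
    by (simp add: cadjoint_cadjoint[OF contraction_bop[OF T]])
  then have "Hm1_star_can n T = H1_can n (cadjoint T)"
    by (simp add: Hm1_star_can_def H1_can_def)
  then have "H0_star_can n T = H0_can n (cadjoint T)"
    by (simp add: H0_star_can_def H0_can_def sum_space_commute[of "isometric_part T"]
        cadjoint_cadjoint[OF contraction_bop[OF T]])
  then show ?thesis by (simp add: H0_star0_can_def H00_can_def Int_commute)
qed

lemma central_nilpotents_iff:
  assumes "contraction T" "completely_non_unitary T"
  shows "(K, N) \<in> central_nilpotents n T \<longleftrightarrow>
    N = compression K T \<and> nilpotent_order K N n \<and> (\<exists>H1 H3. shift_triangular T H1 K H3)"
  unfolding central_nilpotents_def using shift_nilpotent_rep_iff[OF assms] by auto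

lemma ultra_minimal_nilpotents_iff:
  "(K, N) \<in> ultra_minimal_nilpotents n T \<longleftrightarrow> (K, N) \<in> central_nilpotents n T \<and>
    (\<forall>K' N'. (K', N') \<in> central_nilpotents n T \<longrightarrow> injected K N K' N')"
  unfolding ultra_minimal_nilpotents_def by auto

text \<open>The hypothesis on the characteristic function enters in the form that is symmetric under passage
  to the adjoint.\<close>

locale polynomial_contraction =
  fixes T :: "'a::complex_hilbert \<Rightarrow> 'a" and n :: nat
  assumes separable: "\<exists>D::'a set. countable D \<and> closure D = UNIV"
    and T: "contraction T" and cnu: "completely_non_unitary T" and deg: "defect_degree T n"
begin

lemmas Tb = contraction_bop[OF T]

lemma adjoint: "polynomial_contraction (cadjoint T) n"
  using separable cadjoint_contraction[OF T] completely_non_unitary_cadjoint[OF T cnu] deg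
    defect_degree_cadjoint[OF T]
  by (simp add: polynomial_contraction_def)

lemma central_pair:
  assumes "(K, N) \<in> central_nilpotents n T"
  shows "N = compression K T" "nilpotent_pair K N (compression K (cadjoint T)) n"
proof -
  obtain H1 H3 where tri: "shift_triangular T H1 K H3" and N: "N = compression K T"
    and ord: "nilpotent_order K N n"
    using assms unfolding central_nilpotents_iff[OF T cnu] by blast
  have K: "closed_csubspace K"
    using tri orth_decompositionD(2) unfolding shift_triangular_def by blast
  show "N = compression K T" by (rule N)
  show "nilpotent_pair K N (compression K (cadjoint T)) n"
    unfolding N using ord
    by (intro compression_nilpotent_pair[OF separable T K]) (simp add: N nilpotent_order_def)
qed

abbreviation "C \<equiv> core_space T"
abbreviation "N0 \<equiv> compression (core_space T) T"

lemma core_central: "(C, N0) \<in> central_nilpotents n T"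
  unfolding central_nilpotents_iff[OF T cnu]
  using core_space_decomposition[OF T] core_space_nilpotent[OF T deg] by blast

lemma core_chains_le:
  assumes KN: "(K, N) \<in> central_nilpotents n T" and "1 \<le> p" "has_chains C N0 k p"
  shows "has_chains K N k p"
proof -
  obtain H1 H3 where tri: "shift_triangular T H1 K H3" and N: "N = compression K T"
    and ord: "nilpotent_order K N n"
    using KN unfolding central_nilpotents_iff[OF T cnu] by blast
  show ?thesis
    unfolding N
  proof (rule core_space_chains_least[OF separable T tri _ assms(2,3)])
    show "(compression K T ^^ n) x = 0" if "x \<in> K" for x
      using ord that by (simp add: N nilpotent_order_def)
  qed
qed

text \<open>The core has the least chain counts among all central nilpotents, and chain counts decide
  injectability.\<close>

lemma ultra_minimal_iff_chains:
  assumes KN: "(K, N) \<in> central_nilpotents n T"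
  shows "(K, N) \<in> ultra_minimal_nilpotents n T \<longleftrightarrow>
    (\<forall>k p. 1 \<le> p \<longrightarrow> has_chains K N k p \<longrightarrow> has_chains C N0 k p)"
proof
  note pair = central_pair(2)[OF KN]
  assume "(K, N) \<in> ultra_minimal_nilpotents n T"
  then have "injected K N C N0" using core_central unfolding ultra_minimal_nilpotents_iff by blast
  then show "\<forall>k p. 1 \<le> p \<longrightarrow> has_chains K N k p \<longrightarrow> has_chains C N0 k p"
    using injected_has_chains[OF nilpotent_pair.K[OF pair] nilpotent_pair.N[OF pair]] by blast
next
  note pair = central_pair(2)[OF KN]
  assume le: "\<forall>k p. 1 \<le> p \<longrightarrow> has_chains K N k p \<longrightarrow> has_chains C N0 k p"
  have "injected K N K' N'" if "(K', N') \<in> central_nilpotents n T" for K' N'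
    using chain_counts_comparison(1)[OF pair central_pair(2)[OF that]] le core_chains_le[OF that] by blast
  with KN show "(K, N) \<in> ultra_minimal_nilpotents n T" by (simp add: ultra_minimal_nilpotents_iff)
qed

lemma ultra_minimal_chains:
  assumes "(K, N) \<in> ultra_minimal_nilpotents n T" "1 \<le> p"
  shows "has_chains K N k p \<longleftrightarrow> has_chains C N0 k p"
proof -
  have "(K, N) \<in> central_nilpotents n T" using assms(1) by (simp add: ultra_minimal_nilpotents_iff)
  then show ?thesis using ultra_minimal_iff_chains core_chains_le assms by blast
qed

lemma core_ultra_minimal: "(C, N0) \<in> ultra_minimal_nilpotents n T"
  using ultra_minimal_iff_chains[OF core_central] by blast

text \<open>The core of the adjoint gives a representation of \<open>T\<close> by reversing the order of the three
  subspaces; its chain counts are those of the core operator of \<open>T\<^sup>*\<close>, hence again minimal.\<close>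

lemma adjoint_core_ultra_minimal:
  defines "K \<equiv> core_space (cadjoint T)"
  shows "(K, compression K T) \<in> ultra_minimal_nilpotents n T"
proof -
  interpret S: polynomial_contraction "cadjoint T" n by (rule adjoint)
  have cc: "cadjoint (cadjoint T) = T" by (rule cadjoint_cadjoint[OF Tb])
  note pairS = S.central_pair(2)[OF S.core_central, unfolded cc, folded K_def]
  obtain H1 H3 where "shift_triangular (cadjoint T) H1 K H3"
    using S.core_central unfolding central_nilpotents_iff[OF S.T S.cnu] K_def by blast
  from shift_triangular_cadjoint[OF S.T this] have tri: "shift_triangular T H3 K H1"
    unfolding cc .
  have "nilpotent_order K (compression K (cadjoint T)) n"
    using S.core_central unfolding central_nilpotents_iff[OF S.T S.cnu] K_def by blast
  from nilpotent_order_adjoint[OF pairS this]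
  have central: "(K, compression K T) \<in> central_nilpotents n T"
    unfolding central_nilpotents_iff[OF T cnu] using tri by blast
  show ?thesis
    unfolding ultra_minimal_iff_chains[OF central]
  proof (intro allI impI)
    fix k p :: nat assume p: "1 \<le> p" and "has_chains K (compression K T) k p"
    then have K: "has_chains K (compression K (cadjoint T)) k p"
      using nilpotent_pair.has_chains_adjoint[OF pairS p] by blast
    note pair = central_pair(2)[OF core_central]
    obtain H1 H3 where tri: "shift_triangular T H1 C H3" and ord: "nilpotent_order C N0 n"
      using core_central unfolding central_nilpotents_iff[OF T cnu] by blast
    have "(C, compression C (cadjoint T)) \<in> central_nilpotents n (cadjoint T)"
      unfolding central_nilpotents_iff[OF S.T S.cnu]
      using shift_triangular_cadjoint[OF T tri] nilpotent_order_adjoint[OF pair ord] by blast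
    from S.core_chains_le[OF this p K[unfolded K_def]] show "has_chains C N0 k p"
      using nilpotent_pair.has_chains_adjoint[OF pair p] by blast
  qed
qed

lemma ultra_minimal_class:
  "ultra_minimal_nilpotents n T \<in> central_nilpotents n T // quasi_similarity_on (central_nilpotents n T)"
proof (rule quotientI[OF core_central, THEN back_subst[where P = "\<lambda>X. X \<in> _"]], intro equalityI subsetI)
  fix a assume "a \<in> quasi_similarity_on (central_nilpotents n T) `` {(C, N0)}"
  then obtain K N where a: "a = (K, N)" and KN: "(K, N) \<in> central_nilpotents n T"
    and sim: "quasi_similar C N0 K N"
    by (auto simp: quasi_similarity_on_def)
  have "injected K N C N0"
    using sim unfolding quasi_similar_def quasi_affine_def injected_def by blast
  then show "a \<in> ultra_minimal_nilpotents n T"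
    unfolding a ultra_minimal_iff_chains[OF KN]
    using injected_has_chains central_pair(2)[OF KN] nilpotent_pair.K nilpotent_pair.N by blast
next
  fix a assume "a \<in> ultra_minimal_nilpotents n T"
  moreover obtain K N where a: "a = (K, N)" by (rule prod.exhaust)
  ultimately have KN: "(K, N) \<in> ultra_minimal_nilpotents n T" by simp
  then have central: "(K, N) \<in> central_nilpotents n T" by (simp add: ultra_minimal_nilpotents_iff)
  have "quasi_similar C N0 K N"
    using core_ultra_minimal KN core_central central
    by (intro mutually_injected_quasi_similar[OF central_pair(2)[OF core_central] central_pair(2)[OF central]])
      (auto simp: ultra_minimal_nilpotents_iff)
  then show "a \<in> quasi_similarity_on (central_nilpotents n T) `` {(C, N0)}"
    using core_central central by (auto simp: quasi_similarity_on_def a)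
qed

end


section \<open>Unitary invariance\<close>

locale unitary_intertwiner =
  fixes T :: "'a::complex_hilbert \<Rightarrow> 'a" and T' :: "'b::complex_hilbert \<Rightarrow> 'b" and U :: "'a \<Rightarrow> 'b"
  assumes T: "contraction T"
    and U: "bounded_clinear_on UNIV UNIV U" and surj: "surj U"
    and U_cinner: "\<And>x y. cinner (U x) (U y) = cinner x y"
    and UT: "\<And>x. U (T x) = T' (U x)"
begin

lemma U_norm: "norm (U x) = norm x"
  using U_cinner[of x x] unfolding cinner_self by (simp only: of_real_eq_iff power2_eq_iff_nonneg norm_ge_zero)

lemma U_obtain: obtains x where "y = U x"
  using surj by (metis surjD)

lemma U_eq_iff: "U x = U y \<longleftrightarrow> x = y"
  using U_norm[of "x - y"] bop_simps(2)[OF U, of x y] by auto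

lemma T'_contraction: "contraction T'"
proof -
  have le: "norm (T' y) \<le> norm y" for y
  proof -
    obtain u where u: "y = U u" by (rule U_obtain)
    show ?thesis unfolding u UT[symmetric] U_norm by (rule contraction_le[OF T])
  qed
  have "bop T'"
  proof (rule bounded_clinear_onI[where B = 1])
    fix x y :: 'b and c
    obtain u v where uv: "x = U u" "y = U v" by (metis U_obtain)
    show "T' (x + y) = T' x + T' y"
      unfolding uv bop_simps(1)[OF U, symmetric] UT[symmetric] bop_simps(1)[OF contraction_bop[OF T]] ..
    show "T' (c *\<^sub>C x) = c *\<^sub>C T' x"
      unfolding uv bop_simps(3)[OF U, symmetric] UT[symmetric] bop_simps(3)[OF contraction_bop[OF T]] ..
  qed (simp_all add: le)
  with le show ?thesis by (simp add: contraction_def)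
qed

lemma U_cadjoint: "U (cadjoint T x) = cadjoint T' (U x)"
proof (rule adjoint_on_eqI[symmetric])
  fix y
  obtain z where z: "y = U z" by (rule U_obtain)
  show "cinner (T' y) (U x) = cinner y (U (cadjoint T x))"
    unfolding z UT[symmetric] U_cinner by (rule cinner_cadjoint[OF contraction_bop[OF T]])
qed simp_all

lemma U_pow: "U ((T ^^ k) x) = (T' ^^ k) (U x)"
  by (induction k) (simp_all add: UT)

lemma adjoint: "unitary_intertwiner (cadjoint T) (cadjoint T') U"
  by unfold_locales (rule cadjoint_contraction[OF T] U surj U_cinner U_cadjoint)+

lemma U_defect_chain: "U (defect_chain T m x) = defect_chain T' m (U x)"
  by (simp add: defect_chain_def defect_sq_def bop_simps[OF U] U_cadjoint UT U_pow
      cadjoint_cadjoint contraction_bop[OF T] contraction_bop[OF T'_contraction])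

lemma T'_defect_degree: "defect_degree T n \<Longrightarrow> defect_degree T' n"
proof -
  have "defect_chain T' m (U x) = 0 \<longleftrightarrow> defect_chain T m x = 0" for m x
    unfolding U_defect_chain[symmetric] using U_eq_iff[of _ 0] bop_simps(4)[OF U] by simp
  then show "defect_degree T n \<Longrightarrow> defect_degree T' n"
    unfolding defect_degree_def by (metis U_obtain)
qed

lemma T'_completely_non_unitary:
  assumes cnu: "completely_non_unitary T"
  shows "completely_non_unitary T'"
  unfolding completely_non_unitary_def
proof
  assume "\<exists>M. closed_csubspace M \<and> M \<noteq> {0} \<and> T' ` M \<subseteq> M \<and> cadjoint T' ` M \<subseteq> M \<and>
        (\<forall>x\<in>M. norm (T' x) = norm x) \<and> T' ` M = M"
  then obtain M where M: "closed_csubspace M" "M \<noteq> {0}" "T' ` M \<subseteq> M" "cadjoint T' ` M \<subseteq> M"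
    "\<forall>x\<in>M. norm (T' x) = norm x" "T' ` M = M" by (elim exE conjE) (rule that)
  define L where "L = {x. U x \<in> M}"
  have "closed (U -` M)"
    by (rule closed_vimage[OF closed_csubspaceD(2)[OF M(1)] linear_continuous_on[OF bop_bounded_linear[OF U]]])
  then have L: "closed_csubspace L" using closed_csubspaceD[OF M(1)]
    by (auto simp: L_def closed_csubspace_def vimage_def complex_vector.subspace_def bop_simps[OF U])
  have "\<exists>m\<in>M. m \<noteq> 0" using M(2) closed_csubspaceD(3)[OF M(1)] by blast
  then obtain m where m: "m \<in> M" "m \<noteq> 0" by blast
  obtain x where x: "m = U x" by (rule U_obtain)
  have "x \<in> L" using m(1) by (simp add: L_def x)
  moreover have "x \<noteq> 0" using m(2) bop_simps(4)[OF U] unfolding x by blast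
  ultimately have L0: "L \<noteq> {0}" by blast
  have TL: "T ` L \<subseteq> L"
    unfolding L_def image_subset_iff mem_Collect_eq UT using M(3) by blast
  have SL: "cadjoint T ` L \<subseteq> L"
    unfolding L_def image_subset_iff mem_Collect_eq U_cadjoint using M(4) by blast
  have iso: "norm (T x) = norm x" if "x \<in> L" for x
  proof -
    have "norm (U (T x)) = norm (U x)" unfolding UT using that by (intro M(5)[rule_format]) (simp add: L_def)
    then show ?thesis by (simp only: U_norm)
  qed
  have "L \<subseteq> T ` L"
  proof
    fix x assume "x \<in> L"
    then have "U x \<in> T' ` M" unfolding M(6) by (simp add: L_def)
    then obtain m where m: "m \<in> M" "U x = T' m" by blast
    obtain z where z: "m = U z" by (rule U_obtain)
    have "x = T z" using m(2) by (simp add: z UT[symmetric] U_eq_iff)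
    then show "x \<in> T ` L" using m(1) by (simp add: z L_def)
  qed
  with TL have TLL: "T ` L = L" by (rule equalityI)
  show False
    by (rule notE[OF cnu[unfolded completely_non_unitary_def]])
      (intro exI[of _ L] conjI ballI L L0 TL SL iso TLL)
qed

lemma separable_transfer:
  assumes "\<exists>D::'a set. countable D \<and> closure D = UNIV"
  shows "\<exists>D::'b set. countable D \<and> closure D = UNIV"
proof -
  obtain D :: "'a set" where D: "countable D" "closure D = UNIV" using assms by blast
  have "U ` closure D \<subseteq> closure (U ` D)"
    by (rule image_closure_subset[OF linear_continuous_on[OF bop_bounded_linear[OF U]]
          closed_closure closure_subset])
  then have "closure (U ` D) = UNIV" using surj by (auto simp: D(2))
  then show ?thesis using D(1) by blast
qed

lemma U_isometric_part: "U x \<in> isometric_part T' \<longleftrightarrow> x \<in> isometric_part T"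
  unfolding isometric_part_def mem_Collect_eq U_pow[symmetric] U_norm ..

lemma U_outer_space: "U x \<in> outer_space T' \<longleftrightarrow> x \<in> outer_space T"
proof -
  interpret S: unitary_intertwiner "cadjoint T" "cadjoint T'" U by (rule adjoint)
  show ?thesis
    unfolding outer_space_iff by (metis S.U_isometric_part U_cinner U_obtain)
qed

lemma U_core_space: "U x \<in> core_space T' \<longleftrightarrow> x \<in> core_space T"
  unfolding core_space_def orth_minus_def mem_Collect_eq Ball_def Int_iff
  by (metis U_isometric_part U_outer_space U_cinner U_obtain)

lemma core_injected:
  "injected (core_space T) (compression (core_space T) T)
    (core_space T') (compression (core_space T') T')"
  unfolding injected_def
proof (intro exI[of _ U] conjI ballI)
  have C: "closed_csubspace (core_space T)" by (rule closed_csubspace_core_space[OF T])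
  have C': "closed_csubspace (core_space T')" by (rule closed_csubspace_core_space[OF T'_contraction])
  show "bounded_clinear_on (core_space T) (core_space T') U"
    by (rule bounded_clinear_on_subset[OF U]) (auto simp: U_core_space)
  show "inj_on U (core_space T)" by (rule inj_onI) (simp add: U_eq_iff)
  fix x assume x: "x \<in> core_space T"
  have "cproj (core_space T') (T' (U x)) = U (cproj (core_space T) (T x))"
  proof (rule cproj_unique[OF C'])
    show "U (cproj (core_space T) (T x)) \<in> core_space T'"
      by (simp add: U_core_space cproj_in[OF C])
    fix z assume z: "z \<in> core_space T'"
    obtain w where w: "z = U w" by (rule U_obtain)
    show "cinner (T' (U x) - U (cproj (core_space T) (T x))) z = 0"
      using z unfolding w UT[symmetric] bop_simps(2)[OF U, symmetric] U_cinner U_core_space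
      by (rule cproj_orth[OF C])
  qed
  then show "U (compression (core_space T) T x) = compression (core_space T') T' (U x)"
    using x by (simp add: block_def U_core_space)
qed

end

lemma unitarily_equivalent_intertwiners:
  assumes "contraction T" "unitarily_equivalent T T'"
  obtains U V where "unitary_intertwiner T T' U" "unitary_intertwiner T' T V"
proof -
  obtain U where U: "bounded_clinear_on UNIV UNIV U" "surj U"
    "\<forall>x y. cinner (U x) (U y) = cinner x y" "\<forall>x. U (T x) = T' (U x)"
    using assms(2) unfolding unitarily_equivalent_def by blast
  interpret U: unitary_intertwiner T T' U
    by unfold_locales (use assms(1) U in auto)
  have VU: "inv U (U x) = x" for x by (rule inv_f_f) (simp add: inj_def U.U_eq_iff)
  have UV: "U (inv U y) = y" for y by (rule surj_f_inv_f[OF U(2)])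
  have "unitary_intertwiner T' T (inv U)"
  proof
    show "contraction T'" by (rule U.T'_contraction)
    show "bounded_clinear_on UNIV UNIV (inv U)"
    proof (rule bounded_clinear_onI[where B = 1])
      show "inv U (x + y) = inv U x + inv U y" for x y
        unfolding U.U_eq_iff[symmetric] by (simp add: UV bop_simps[OF U(1)])
      show "inv U (c *\<^sub>C x) = c *\<^sub>C inv U x" for c x
        unfolding U.U_eq_iff[symmetric] by (simp add: UV bop_simps[OF U(1)])
      show "norm (inv U x) \<le> 1 * norm x" for x using U.U_norm[of "inv U x"] by (simp add: UV)
    qed simp
    show "surj (inv U)" using VU by (metis surjI)
    show "cinner (inv U x) (inv U y) = cinner x y" for x y
      using U.U_cinner[of "inv U x" "inv U y"] by (simp add: UV)
    show "inv U (T' y) = T (inv U y)" for y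
      unfolding U.U_eq_iff[symmetric] by (simp add: UV U.UT)
  qed
  with U.unitary_intertwiner_axioms show thesis by (rule that)
qed

text \<open>A unitary equivalence maps the core of \<open>T\<close> onto the core of \<open>T'\<close>, so the ultra-minimal
  operators of both have the same chain counts.\<close>

lemma ultra_minimal_unitary_invariant:
  assumes "polynomial_contraction T n" and eq: "unitarily_equivalent T T'"
    and KN: "(K, N) \<in> ultra_minimal_nilpotents n T" and KN': "(K', N') \<in> ultra_minimal_nilpotents n T'"
  shows "quasi_similar K N K' N'"
proof -
  interpret A: polynomial_contraction T n by fact
  obtain U V where UV: "unitary_intertwiner T T' U" "unitary_intertwiner T' T V"
    by (rule unitarily_equivalent_intertwiners[OF A.T eq])
  interpret U: unitary_intertwiner T T' U by (rule UV)
  interpret V: unitary_intertwiner T' T V by (rule UV)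
  interpret B: polynomial_contraction T' n
    by unfold_locales
      (rule U.separable_transfer[OF A.separable] U.T'_contraction
        U.T'_completely_non_unitary[OF A.cnu] U.T'_defect_degree[OF A.deg])+
  note pC = A.central_pair(2)[OF A.core_central] and pC' = B.central_pair(2)[OF B.core_central]
  have core: "has_chains (core_space T) (compression (core_space T) T) k p \<longleftrightarrow>
      has_chains (core_space T') (compression (core_space T') T') k p" for k p
    using injected_has_chains[OF nilpotent_pair.K[OF pC] nilpotent_pair.N[OF pC] U.core_injected]
      injected_has_chains[OF nilpotent_pair.K[OF pC'] nilpotent_pair.N[OF pC'] V.core_injected] by blast
  have chains: "has_chains K N k p \<longleftrightarrow> has_chains K' N' k p" if "1 \<le> p" for k p
    using A.ultra_minimal_chains[OF KN that] B.ultra_minimal_chains[OF KN' that] core by blast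
  have "nilpotent_pair K N (compression K (cadjoint T)) n"
    using KN by (intro A.central_pair(2)) (simp add: ultra_minimal_nilpotents_iff)
  moreover have "nilpotent_pair K' N' (compression K' (cadjoint T')) n"
    using KN' by (intro B.central_pair(2)) (simp add: ultra_minimal_nilpotents_iff)
  ultimately show ?thesis
    unfolding quasi_similar_def using chain_counts_comparison(2) chains by metis
qed

theorem theorem5p5:
  fixes T :: "'a::complex_hilbert \<Rightarrow> 'a" and n :: nat
  assumes "\<exists>D::'a set. countable D \<and> closure D = UNIV"
    and "contraction T"
    and "completely_non_unitary T"
    and "char_fun_degree T n"
  shows "ultra_minimal_nilpotents n T
           \<in> central_nilpotents n T // quasi_similarity_on (central_nilpotents n T)
    \<and> (H00_can n T, compression (H00_can n T) T) \<in> ultra_minimal_nilpotents n T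
    \<and> (H0_star0_can n T, compression (H0_star0_can n T) T) \<in> ultra_minimal_nilpotents n T
    \<and> (\<forall>T' :: 'b::complex_hilbert \<Rightarrow> 'b. unitarily_equivalent T T' \<longrightarrow>
         (\<forall>(K, N) \<in> ultra_minimal_nilpotents n T.
          \<forall>(K', N') \<in> ultra_minimal_nilpotents n T'. quasi_similar K N K' N'))"
proof (intro conjI allI impI)
  have pc: "polynomial_contraction T n"
    using assms(1-3) char_fun_degree_imp_defect_degree[OF assms(2,4)]
    by (rule polynomial_contraction.intro)
  then interpret polynomial_contraction T n .
  have adj_deg: "defect_degree (cadjoint T) n" using deg by (simp add: defect_degree_cadjoint[OF T])
  show "ultra_minimal_nilpotents n T
      \<in> central_nilpotents n T // quasi_similarity_on (central_nilpotents n T)"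
    by (rule ultra_minimal_class)
  show "(H00_can n T, compression (H00_can n T) T) \<in> ultra_minimal_nilpotents n T"
    unfolding H00_can_eq[OF T deg] by (rule core_ultra_minimal)
  show "(H0_star0_can n T, compression (H0_star0_can n T) T) \<in> ultra_minimal_nilpotents n T"
    unfolding H0_star0_can_eq[OF T] H00_can_eq[OF cadjoint_contraction[OF T] adj_deg]
    by (rule adjoint_core_ultra_minimal)
  fix T' :: "'b \<Rightarrow> 'b" assume "unitarily_equivalent T T'"
  then show "\<forall>(K, N)\<in>ultra_minimal_nilpotents n T.
      \<forall>(K', N')\<in>ultra_minimal_nilpotents n T'. quasi_similar K N K' N'"
    using ultra_minimal_unitary_invariant[OF pc] by blast
qed

end
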